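(* Let $k\ge 1$ be an integer and let $(\xi(s))_{s\in\mathbb{Z}}$ be a stationary sequence of real random variables such that, for every $\tau>0$, with $u_n=u_n^{(\tau)}$, the sequence $(\xi(s))_{s\in\mathbb{Z}}$ satisfies the $D^{(k)}(u_n)$ condition and the sequence $(\xi(S_n))_{n\ge 0}$ satisfies the $\Delta(u_n)$ condition. Assume that the extremal index of $(\xi(s))_{s\in\mathbb{Z}}$ exists and is equal to $\sigma\in(0,1]$. Assume that, for some $\tau_0>0$, $p_n^{(\tau_0)}(j)$ converges as $n\to\infty$ to some number $p(j)$ for every $j\ge1$. Then, for every $\tau>0$, the point process $\Phi_n^{(\tau)}$ converges in distribution, as $n\to\infty$, to a compound Poisson point process in $[0,1]$ with intensity $\theta\tau$, where $\theta=\sigma q$, and cluster size distribution $$\pi(j)=\frac1\theta\big(p(j)-p(j+1)\big),\qquad j\ge1.$$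
   Context: Random walk: $S_0=0$, $S_n=X_1+\cdots+X_n$ for $n\ge1$, where $(X_i)_{i\ge1}$ are independent with $\mathbb{P}(X_i=1)=\rho$, $\mathbb{P}(X_i=-1)=1-\rho$, $\rho\in(0,1)\setminus\{1/2\}$. The sequence $(\xi(s))_{s\in\mathbb{Z}}$ is independent of $(X_i)_{i\ge1}$. Set $q=\mathbb{P}(S_i\ne0\ \forall i\ge1)$ (one has $q=|2\rho-1|$). Thresholds: it is assumed that for every $\tau>0$ there is a sequence of positive numbers $u_n=u_n^{(\tau)}$ with $n\,\mathbb{P}(\xi(0)>u_n)\to\tau$; these sequences are fixed. Extremal index: $(\xi(s))_{s\in\mathbb{Z}}$ has extremal index $\sigma$ if $\mathbb{P}(\max_{0\le s\le n}\xi(s)\le u_n^{(\tau)})\to e^{-\sigma\tau}$ for every $\tau>0$. Point process of exceedances: $\Phi_n=\Phi_n^{(\tau)}=\{i/n:\ \xi(S_i)>u_n^{(\tau)},\ 0\le i\le n\}$. Let $(k_n)$ be a sequence of positive integers with $k_n\to\infty$ and $k_n=o(n)$, and put $\Phi_{k_n}=\{i/n:\ \xi(S_i)>u_n^{(\tau)},\ 0\le i\le k_n\}$. For $j\ge1$, $p_n^{(\tau)}(j)=\mathbb{P}(\#\Phi_{k_n}=j\mid\xi(0)>u_n^{(\tau)})$. Compound Poisson point process in $[0,1]$ of intensity $\lambda>0$ and cluster size distribution $\pi$: a point process of the form $\{(x_j,n_j),\,j\ge1\}$ (a point at $x_j$ with multiplicity $n_j$), where $\{x_j\}$ is a stationary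 Poisson point process in $[0,1]$ of intensity $\lambda$ and $(n_j)$ are i.i.d. with distribution $\pi$, independent of the $x_j$'s. $\Delta(u_n)$ condition: let $(u_n)_{n\ge 0}$ be a sequence of positive numbers and let $(\zeta(s))$ be a stationary sequence (indexed by $\mathbb{Z}$ or by the nonnegative integers). For $0\le m_1\le m_2\le n$ let $\mathcal{B}_{m_1}^{m_2}(u_n)$ be the $\sigma$-field generated by the events $\{\zeta(s)\le u_n\}$, $m_1\le s\le m_2$, and for $1\le\ell\le n-1$ let $$\alpha_{n,\ell}=\max_{1\le j\le n-\ell}\ \max_{A\in\mathcal{B}_0^j(u_n),\,B\in\mathcal{B}_{j+\ell}^n(u_n)}|\mathbb{P}(A\cap B)-\mathbb{P}(A)\mathbb{P}(B)|.$$ The sequence $(\zeta(s))$ satisfies $\Delta(u_n)$ if there is a sequence $(\ell_n)$ with $\alpha_{n,\ell_n}\to0$ and $\ell_n=o(n)$. For $(\xi(S_n))_{n\ge0}$ this is applied with $\zeta(i)=\xi(S_i)$. $D^{(k)}(u_n)$ condition ($k\ge1$): $(\zeta(s))$ satisfies $\Delta(u_n)$ and there exist sequences of integers $(s_n)$, $(\ell_n)$ such that $s_n\to\infty$, $s_n\alpha_{n,\ell_n}\to0$, $s_n\ell_n/n\to0$ and $$\lim_{n\to\infty}n\,\mathbb{P}\big(\zeta(0)>u_n\ge M_{1,k-1},\ M_{k,r_n}>u_n\big)=0,$$ where $r_n=\lfloor n/s_n\rfloor$, $M_{i,j}=\max_{i\le t\le j}\zeta(t)$ for $0\le i\le j$,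 and $M_{i,j}=-\infty$ for $i>j$. *)

theory Defs
  imports "HOL-Probability.Probability" "HOL-Library.Landau_Symbols"
begin

text \<open>The library constant \<open>indep_var\<close> requires both variables to have the same type.\<close>

definition indep_rvs ::
  "'a measure \<Rightarrow> 'b measure \<Rightarrow> ('a \<Rightarrow> 'b) \<Rightarrow> 'c measure \<Rightarrow> ('a \<Rightarrow> 'c) \<Rightarrow> bool" where
  "indep_rvs M A Y B Z \<longleftrightarrow>
     Y \<in> M \<rightarrow>\<^sub>M A \<and> Z \<in> M \<rightarrow>\<^sub>M B \<and>
     prob_space.indep_set M {Y -` S \<inter> space M | S. S \<in> sets A} {Z -` S \<inter> space M | S. S \<in> sets B}"


section \<open>Stationary sequences and mixing conditions\<close>

definition stationary :: "'a measure \<Rightarrow> (int \<Rightarrow> 'a \<Rightarrow> real) \<Rightarrow> bool" where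
  "stationary M \<xi> \<longleftrightarrow>
     (\<forall>h. distr M (\<Pi>\<^sub>M s\<in>UNIV. borel) (\<lambda>\<omega> s. \<xi> (s + h) \<omega>) =
          distr M (\<Pi>\<^sub>M s\<in>UNIV. borel) (\<lambda>\<omega> s. \<xi> s \<omega>))"

text \<open>
  The maximum \<open>M\<^bsub>i,j\<^esub>\<close> is taken in the extended reals, so that the empty maximum (\<open>i > j\<close>)
  is \<open>-\<infinity>\<close>.
\<close>

definition range_max :: "(nat \<Rightarrow> 'a \<Rightarrow> real) \<Rightarrow> nat \<Rightarrow> nat \<Rightarrow> 'a \<Rightarrow> ereal" where
  "range_max \<zeta> i j \<omega> = (SUP t\<in>{i..j}. ereal (\<zeta> t \<omega>))"

definition level_sigma ::
  "'a measure \<Rightarrow> (nat \<Rightarrow> 'a \<Rightarrow> real) \<Rightarrow> real \<Rightarrow> nat \<Rightarrow> nat \<Rightarrow> 'a set set" where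
  "level_sigma M \<zeta> v m\<^sub>1 m\<^sub>2 =
     sigma_sets (space M) {{\<omega> \<in> space M. \<zeta> s \<omega> \<le> v} | s. m\<^sub>1 \<le> s \<and> s \<le> m\<^sub>2}"

text \<open>Meaningful for \<open>1 \<le> l \<le> n - 1\<close>; the supremum is then a maximum over a nonempty finite set.\<close>

definition mixing_coeff ::
  "'a measure \<Rightarrow> (nat \<Rightarrow> 'a \<Rightarrow> real) \<Rightarrow> (nat \<Rightarrow> real) \<Rightarrow> nat \<Rightarrow> nat \<Rightarrow> real" where
  "mixing_coeff M \<zeta> u n l =
     Sup {\<bar>measure M (A \<inter> B) - measure M A * measure M B\<bar> | A B j.
            1 \<le> j \<and> j \<le> n - l \<and>
            A \<in> level_sigma M \<zeta> (u n) 0 j \<and> B \<in> level_sigma M \<zeta> (u n) (j + l) n}"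

definition Delta_cond ::
  "'a measure \<Rightarrow> (nat \<Rightarrow> 'a \<Rightarrow> real) \<Rightarrow> (nat \<Rightarrow> real) \<Rightarrow> bool" where
  "Delta_cond M \<zeta> u \<longleftrightarrow>
     (\<exists>l :: nat \<Rightarrow> nat.
        (\<forall>\<^sub>F n in sequentially. 1 \<le> l n \<and> l n \<le> n - 1) \<and>
        (\<lambda>n. mixing_coeff M \<zeta> u n (l n)) \<longlonglongrightarrow> 0 \<and>
        (\<lambda>n. real (l n)) \<in> o(\<lambda>n. real n))"

definition D_cond ::
  "nat \<Rightarrow> 'a measure \<Rightarrow> (nat \<Rightarrow> 'a \<Rightarrow> real) \<Rightarrow> (nat \<Rightarrow> real) \<Rightarrow> bool" where
  "D_cond k M \<zeta> u \<longleftrightarrow>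
     Delta_cond M \<zeta> u \<and>
     (\<exists>(s :: nat \<Rightarrow> nat) (l :: nat \<Rightarrow> nat).
        (\<forall>\<^sub>F n in sequentially. 1 \<le> l n \<and> l n \<le> n - 1) \<and>
        filterlim s at_top sequentially \<and>
        (\<lambda>n. real (s n) * mixing_coeff M \<zeta> u n (l n)) \<longlonglongrightarrow> 0 \<and>
        (\<lambda>n. real (s n) * real (l n) / real n) \<longlonglongrightarrow> 0 \<and>
        (\<lambda>n. real n * \<P>(\<omega> in M. \<zeta> 0 \<omega> > u n \<and> ereal (u n) \<ge> range_max \<zeta> 1 (k - 1) \<omega> \<and>
                                range_max \<zeta> k (n div s n) \<omega> > ereal (u n))) \<longlonglongrightarrow> 0)"

text \<open>Here \<open>u \<tau>\<close> is the threshold sequence attached to \<open>\<tau>\<close>.\<close>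

definition has_extremal_index ::
  "'a measure \<Rightarrow> (nat \<Rightarrow> 'a \<Rightarrow> real) \<Rightarrow> (real \<Rightarrow> nat \<Rightarrow> real) \<Rightarrow> real \<Rightarrow> bool" where
  "has_extremal_index M \<zeta> u \<sigma> \<longleftrightarrow>
     (\<forall>\<tau>>0. (\<lambda>n. \<P>(\<omega> in M. range_max \<zeta> 0 n \<omega> \<le> ereal (u \<tau> n))) \<longlonglongrightarrow> exp (- \<sigma> * \<tau>))"


section \<open>The random walk and the exceedances along it\<close>

definition walk :: "(nat \<Rightarrow> 'a \<Rightarrow> int) \<Rightarrow> nat \<Rightarrow> 'a \<Rightarrow> int" where
  "walk X n \<omega> = (\<Sum>i=1..n. X i \<omega>)"

definition scenery_walk ::
  "(int \<Rightarrow> 'a \<Rightarrow> real) \<Rightarrow> (nat \<Rightarrow> 'a \<Rightarrow> int) \<Rightarrow> nat \<Rightarrow> 'a \<Rightarrow> real" where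
  "scenery_walk \<xi> X i \<omega> = \<xi> (walk X i \<omega>) \<omega>"

text \<open>Times \<open>i \<le> m\<close> at which \<open>\<zeta>\<close> exceeds the level \<open>v\<close>, rescaled by \<open>n\<close>.\<close>

definition exceedances ::
  "(nat \<Rightarrow> 'a \<Rightarrow> real) \<Rightarrow> real \<Rightarrow> nat \<Rightarrow> nat \<Rightarrow> 'a \<Rightarrow> real set" where
  "exceedances \<zeta> v n m \<omega> = {real i / real n | i. i \<le> m \<and> \<zeta> i \<omega> > v}"


section \<open>Point processes in [0,1]\<close>

text \<open>
  Since \<open>[0,1]\<close> is compact, the locally finite counting measures on it are the finite ones;
  they are represented by the finite multisets with elements in \<open>[0,1]\<close>, the
  integral of \<open>f\<close> against \<open>N\<close> being \<open>\<Sum>x\<in>#N. f x\<close>. They carry the vague topology, the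
  coarsest one making all integrals of continuous functions continuous.
\<close>

definition point_measures :: "real multiset set" where
  "point_measures = {N. set_mset N \<subseteq> {0..1}}"

definition vague_topology :: "real multiset topology" where
  "vague_topology = topology_generated_by
     {{N \<in> point_measures. (\<Sum>x\<in>#N. f x) \<in> U} | (f :: real \<Rightarrow> real) (U :: real set).
        continuous_on {0..1} f \<and> open U}"

definition borel_of_topology :: "'b topology \<Rightarrow> 'b measure" where
  "borel_of_topology T = sigma (topspace T) {U. openin T U}"

definition converges_in_distribution ::
  "'b topology \<Rightarrow> 'a measure \<Rightarrow> (nat \<Rightarrow> 'a \<Rightarrow> 'b) \<Rightarrow> 'c measure \<Rightarrow> ('c \<Rightarrow> 'b) \<Rightarrow> bool" where
  "converges_in_distribution T M Y M' Z \<longleftrightarrow>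
     (\<forall>n. Y n \<in> M \<rightarrow>\<^sub>M borel_of_topology T) \<and> Z \<in> M' \<rightarrow>\<^sub>M borel_of_topology T \<and>
     (\<forall>F :: 'b \<Rightarrow> real. continuous_map T euclideanreal F \<and> bounded (F ` topspace T) \<longrightarrow>
        (\<lambda>n. \<integral>\<omega>. F (Y n \<omega>) \<partial>M) \<longlonglongrightarrow> (\<integral>\<omega>. F (Z \<omega>) \<partial>M'))"

definition stationary_poisson_process :: "'a measure \<Rightarrow> real \<Rightarrow> ('a \<Rightarrow> real multiset) \<Rightarrow> bool" where
  "stationary_poisson_process M lam N \<longleftrightarrow>
     N \<in> M \<rightarrow>\<^sub>M borel_of_topology vague_topology \<and>
     (\<forall>B\<in>sets borel. B \<subseteq> {0..1} \<longrightarrow>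
        (\<forall>m. \<P>(\<omega> in M. size {#x \<in># N \<omega>. x \<in> B#} = m) =
             (lam * measure lborel B) ^ m / fact m * exp (- (lam * measure lborel B)))) \<and>
     (\<forall>(r :: nat) B. (\<forall>i<r. B i \<in> sets borel \<and> B i \<subseteq> {0..1}) \<and> disjoint_family_on B {..<r} \<longrightarrow>
        prob_space.indep_vars M (\<lambda>_. count_space UNIV)
          (\<lambda>i \<omega>. size {#x \<in># N \<omega>. x \<in> B i#}) {..<r})"

text \<open>
  The Poisson process has finitely many points \<open>x 0, \<dots>, x (K - 1)\<close>, where \<open>K\<close> is random. The
  variables \<open>x j\<close> with \<open>j \<ge> K\<close> play no role. The marks \<open>\<nu> j\<close> are i.i.d. on the positive integers
  with law \<open>\<pi>\<close> (only the values \<open>\<pi> i\<close>, \<open>i \<ge> 1\<close>, matter) and jointly independent of the points.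
\<close>

definition compound_poisson_process ::
  "'a measure \<Rightarrow> real \<Rightarrow> (nat \<Rightarrow> real) \<Rightarrow> ('a \<Rightarrow> real multiset) \<Rightarrow> bool" where
  "compound_poisson_process M lam \<pi> N \<longleftrightarrow>
     (\<exists>(K :: 'a \<Rightarrow> nat) (x :: nat \<Rightarrow> 'a \<Rightarrow> real) (\<nu> :: nat \<Rightarrow> 'a \<Rightarrow> nat).
        stationary_poisson_process M lam (\<lambda>\<omega>. {#x j \<omega>. j \<in># mset_set {..<K \<omega>}#}) \<and>
        prob_space.indep_vars M (\<lambda>_. count_space UNIV) \<nu> UNIV \<and>
        (\<forall>j. \<P>(\<omega> in M. \<nu> j \<omega> = 0) = 0 \<and> (\<forall>i\<ge>1. \<P>(\<omega> in M. \<nu> j \<omega> = i) = \<pi> i)) \<and>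
        indep_rvs M
          (\<Pi>\<^sub>M j\<in>UNIV. count_space UNIV) (\<lambda>\<omega> j. \<nu> j \<omega>)
          (count_space UNIV \<Otimes>\<^sub>M (\<Pi>\<^sub>M j\<in>UNIV. borel)) (\<lambda>\<omega>. (K \<omega>, \<lambda>j. x j \<omega>)) \<and>
        (\<forall>\<omega>\<in>space M. N \<omega> = (\<Sum>j<K \<omega>. replicate_mset (\<nu> j \<omega>) (x j \<omega>))))"

end

theory Submission
  imports Defs "HOL-Combinatorics.Multiset_Permutations" "HOL-Real_Asymp.Real_Asymp"
begin

text \<open>
  Split the time interval into m blocks separated by short gaps. By the condition \<open>\<Delta>\<close> the
  numbers of exceedances in the blocks are asymptotically independent, and by stationarity
  \<open>P(N[0,b] \<ge> j) = (\<Sum>t\<le>b. P(\<zeta> 0 > u, N[0,t] = j))\<close>, where \<open>N[a,b]\<close> counts the exceedances of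
  the process \<open>\<zeta>\<close> along the walk. Each summand is asymptotically \<open>\<tau> p(j) / n\<close>, whatever the length
  t of the window: the transient walk soon leaves any bounded set for good, and by \<open>D\<^sup>(\<^sup>k\<^sup>)\<close> few
  exceedances near the origin make an exceedance far away unlikely. Hence a block contains
  \<open>j \<ge> 1\<close> exceedances with probability about \<open>\<tau> (p(j) - p(j + 1)) / m\<close>. For \<open>j = 1\<close> the limit is
  computed from the extremal index and the escape probability, giving \<open>p(1) = \<sigma> q\<close>.

  These block probabilities are those of the compound Poisson process up to o(1/m). Bounding
  them from below is enough to bound \<open>E F(\<Phi>\<^sub>n)\<close> from below for \<open>0 \<le> F \<le> 1\<close>, because the limit
  weights sum to 1; applied to F and 1 - F this gives convergence without a separate tightness
  argument. In particular, clusters whose size tends to infinity are allowed: they lower the sum of the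
  p(j), but are too rare to be seen in the limit.
\<close>

section \<open>The vague topology on finite point measures\<close>

text \<open>Three window lengths have to be reconciled: \<open>D_cond\<close> controls windows of
  length \<open>n div s n\<close> with \<open>s n\<close> tending to infinity, the cluster
  probabilities use windows of length \<open>kn n\<close>, which is o(n), but the blocks have length
  proportional to n. The bridge is \<open>last_prob\<close>, the probability of an exceedance at 0
  followed by none up to t. It decreases in t, and \<open>gap_prob_eq\<close> writes the gap event
  of \<open>D_cond\<close> as a difference of two of its values. Mixing and \<open>D_cond\<close>
  bound n times its value at t = k - 1 from above by \<sigma> \<tau> + o(1); the extremal index
  bounds n times its value at t = \<delta> n from below by nearly \<sigma> \<tau> when \<delta> is
  small. Monotonicity then fixes all values in between, so late exceedances are rare for every
  window up to \<delta> n.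

  The limits are taken in a fixed order: n tends to infinity with the number m of blocks held fixed,
  and m afterwards. The bounds L on the mass of a block and Q on the total mass are chosen before m,
  so that a test function has to be uniformly continuous only on configurations of at most Q
  points.\<close>

lemma topspace_vague_topology [simp]: "topspace vague_topology = point_measures"
proof -
  have "point_measures \<in> {{N \<in> point_measures. (\<Sum>x\<in>#N. f x) \<in> U} | (f :: real \<Rightarrow> real) (U :: real set).
        continuous_on {0..1} f \<and> open U}"
    by (intro CollectI exI[of _ "\<lambda>_. 0"] exI[of _ UNIV]) auto
  then show ?thesis
    unfolding vague_topology_def topology_generated_by_topspace by blast
qed

text \<open>The vague topology is generated by preimages under the integrals, so continuity of a map
  into it can be tested on integrals of continuous functions.\<close>

lemma continuous_map_into_vague:
  assumes "\<And>z. z \<in> topspace T \<Longrightarrow> \<Phi> z \<in> point_measures"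
    and "\<And>f. continuous_on {0..1} f \<Longrightarrow> continuous_map T euclideanreal (\<lambda>z. \<Sum>x\<in>#\<Phi> z. f x)"
  shows "continuous_map T vague_topology \<Phi>"
  unfolding vague_topology_def
proof (rule continuous_on_generated_topo)
  fix V assume "V \<in> {{N \<in> point_measures. (\<Sum>x\<in>#N. f x) \<in> U} | (f :: real \<Rightarrow> real) (U :: real set).
        continuous_on {0..1} f \<and> open U}"
  then obtain f U where V: "V = {N \<in> point_measures. (\<Sum>x\<in>#N. f x) \<in> U}"
      "continuous_on {0..1} (f :: real \<Rightarrow> real)" "open (U :: real set)" by auto
  have "\<Phi> -` V \<inter> topspace T = {z \<in> topspace T. (\<Sum>x\<in>#\<Phi> z. f x) \<in> U}"
    using assms(1) V(1) by auto
  then show "openin T (\<Phi> -` V \<inter> topspace T)"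
    using openin_continuous_map_preimage[OF assms(2)[OF V(2)], of U] V(3) by simp
next
  have "\<Phi> ` topspace T \<subseteq> topspace vague_topology" using assms(1) by auto
  then show "\<Phi> ` topspace T \<subseteq> \<Union> {{N \<in> point_measures. (\<Sum>x\<in>#N. f x) \<in> U} | (f :: real \<Rightarrow> real) (U :: real set).
        continuous_on {0..1} f \<and> open U}"
    unfolding vague_topology_def topology_generated_by_topspace .
qed

text \<open>Positions are infinite sequences, so that one compact space serves for every number of
  points; \<open>marked_points c\<close> reads only the first \<open>length c\<close>
  coordinates.\<close>

definition unit_seqs :: "(nat \<Rightarrow> real) set" where
  "unit_seqs = {z. \<forall>i. z i \<in> {0..1}}"

definition marked_points :: "nat list \<Rightarrow> (nat \<Rightarrow> real) \<Rightarrow> real multiset" where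
  "marked_points c z = (\<Sum>j<length c. replicate_mset (c ! j) (z j))"

lemma sum_mset_sum_replicate:
  fixes f :: "'b \<Rightarrow> 'c :: semiring_1"
  assumes "finite I"
  shows "(\<Sum>x\<in>#(\<Sum>j\<in>I. replicate_mset (c j) (z j)). f x) = (\<Sum>j\<in>I. of_nat (c j) * f (z j))"
  using assms by (induction I rule: finite_induct) auto

lemma set_mset_sum_replicate:
  assumes "finite I"
  shows "set_mset (\<Sum>j\<in>I. replicate_mset (c j) (z j)) = {z j |j. j \<in> I \<and> c j > 0}"
  using assms by (induction I rule: finite_induct) auto

lemma compact_unit_seqs: "compact unit_seqs"
proof -
  have "unit_seqs = (\<Pi>\<^sub>E i\<in>UNIV. {0..1})"
    by (auto simp: unit_seqs_def PiE_def Pi_def)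
  moreover have "compactin (product_topology (\<lambda>i::nat. euclideanreal) UNIV) (\<Pi>\<^sub>E i\<in>UNIV. {0..1})"
    by (subst compactin_PiE) auto
  ultimately show ?thesis
    by (metis compactin_euclidean_iff euclidean_product_topology)
qed

lemma continuous_map_marked_points:
  "continuous_map (top_of_set unit_seqs) vague_topology (marked_points c)"
proof (rule continuous_map_into_vague)
  fix z assume "z \<in> topspace (top_of_set unit_seqs)"
  then show "marked_points c z \<in> point_measures"
    by (auto simp: point_measures_def marked_points_def set_mset_sum_replicate unit_seqs_def)
next
  fix f :: "real \<Rightarrow> real" assume f: "continuous_on {0..1} f"
  have "continuous_on unit_seqs (\<lambda>z. f (z j))" for j
    by (rule continuous_on_compose2[OF f])
       (auto simp: unit_seqs_def intro!: continuous_on_product_coordinates continuous_on_subset[OF _ subset_UNIV])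
  then have "continuous_on unit_seqs (\<lambda>z. \<Sum>j<length c. of_nat (c ! j) * f (z j))"
    by (intro continuous_intros)
  then show "continuous_map (top_of_set unit_seqs) euclideanreal (\<lambda>z. \<Sum>x\<in>#marked_points c z. f x)"
    by (simp add: marked_points_def sum_mset_sum_replicate)
qed

text \<open>Pulled back in this way, a test function lives on a compact metric space, where uniform
  continuity and sequential arguments are available; the vague topology itself never has to be
  metrized.\<close>

lemma continuous_on_vague_marked_points:
  assumes "continuous_map vague_topology euclideanreal F"
  shows "continuous_on unit_seqs (\<lambda>z. F (marked_points c z))"
  using continuous_map_compose[OF continuous_map_marked_points assms, of c]
  by (simp add: o_def)

text \<open>The product metric is the sum of the truncated coordinate distances with weights
  (1/2)^n, and these weights add up to 2.\<close>

lemma dist_fun_le: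
  fixes x y :: "nat \<Rightarrow> real"
  assumes "\<And>i. \<bar>x i - y i\<bar> \<le> d"
  shows "dist x y \<le> 2 * d"
proof -
  have s: "summable (\<lambda>n. (1/2)^n * d :: real)"
    by (intro summable_mult2 summable_geometric) auto
  have le: "(1/2)^n * min (dist (x (from_nat n)) (y (from_nat n))) 1 \<le> (1/2)^n * d" for n
    using assms[of "from_nat n"] by (intro mult_left_mono) (auto simp: dist_real_def)
  have "dist x y \<le> (\<Sum>n. (1/2)^n * d)"
    unfolding dist_fun_def
    by (rule suminf_le[OF le summable_comparison_test[OF _ s] s], rule exI[of _ 0])
       (use le in \<open>auto simp: abs_mult\<close>)
  also have "\<dots> = 2 * d"
    using suminf_mult2[OF summable_geometric[of "1/2::real"], of d] by (simp add: suminf_geometric)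
  finally show ?thesis .
qed

text \<open>The coordinates beyond the list are filled with 0, a point of the unit interval, so that
  the sequence belongs to \<open>unit_seqs\<close> whenever the listed positions are in the
  interval.\<close>

lemma image_mset_eq_marked_points:
  "image_mset y (mset xs) = marked_points (replicate (length xs) 1) (\<lambda>j. if j < length xs then y (xs ! j) else 0)"
proof -
  have "marked_points (replicate (length xs) 1) (\<lambda>j. if j < length xs then y (xs ! j) else 0)
      = (\<Sum>j<length xs. {#y (xs ! j)#})"
    by (simp add: marked_points_def)
  also have "\<dots> = image_mset y (mset xs)"
    by (induction xs rule: rev_induct) (auto simp: nth_append)
  finally show ?thesis by simp
qed

text \<open>Compactness yields a modulus of continuity for each fixed number J of points. The bound
  Q on the size leaves finitely many J, so the least of the moduli is still positive. This is what
  allows exceedance times to be moved to the ends of their blocks.\<close>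

lemma vague_uniformly_continuous:
  fixes F :: "real multiset \<Rightarrow> real"
  assumes F: "continuous_map vague_topology euclideanreal F" and "\<eta> > 0"
  shows "\<exists>\<delta>>0. \<forall>(A :: 'i multiset) y z. size A \<le> Q \<longrightarrow>
      (\<forall>i\<in>#A. y i \<in> {0..1} \<and> z i \<in> {0..1} \<and> \<bar>y i - z i\<bar> \<le> \<delta>) \<longrightarrow>
      \<bar>F (image_mset y A) - F (image_mset z A)\<bar> \<le> \<eta>"
proof -
  have "\<exists>\<delta>>0. \<forall>(A :: 'i multiset) y z. size A = J \<longrightarrow>
      (\<forall>i\<in>#A. y i \<in> {0..1} \<and> z i \<in> {0..1} \<and> \<bar>y i - z i\<bar> \<le> \<delta>) \<longrightarrow>
      \<bar>F (image_mset y A) - F (image_mset z A)\<bar> \<le> \<eta>" for J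
  proof -
    let ?G = "\<lambda>z. F (marked_points (replicate J 1) z)"
    have "uniformly_continuous_on unit_seqs ?G"
      by (intro compact_uniformly_continuous continuous_on_vague_marked_points F compact_unit_seqs)
    then obtain d where d: "d > 0"
        "\<And>x x'. x \<in> unit_seqs \<Longrightarrow> x' \<in> unit_seqs \<Longrightarrow> dist x' x < d \<Longrightarrow> dist (?G x') (?G x) < \<eta>"
      unfolding uniformly_continuous_on_def using \<open>\<eta> > 0\<close> by metis
    show ?thesis
    \<comment> \<open>By \<open>dist_fun_le\<close> the product distance may be twice the largest
      coordinate distance; d / 4 keeps it at d / 2, strictly below d.\<close>
    proof (intro exI[of _ "d / 4"] conjI allI impI)
      fix A :: "'i multiset" and y z :: "'i \<Rightarrow> real"
      assume A: "size A = J" and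
        yz: "\<forall>i\<in>#A. y i \<in> {0..1} \<and> z i \<in> {0..1} \<and> \<bar>y i - z i\<bar> \<le> d / 4"
      obtain xs where xs: "A = mset xs" by (metis ex_mset)
      let ?l = "\<lambda>y j. if j < length xs then y (xs ! j) else 0 :: real"
      have "dist (?l y) (?l z) \<le> 2 * (d / 4)"
        using yz xs d(1) by (intro dist_fun_le) auto
      then have "dist (?G (?l y)) (?G (?l z)) < \<eta>"
        using d(1) yz xs by (intro d(2)) (auto simp: unit_seqs_def)
      then show "\<bar>F (image_mset y A) - F (image_mset z A)\<bar> \<le> \<eta>"
        using A xs by (auto simp: image_mset_eq_marked_points dist_real_def)
    qed (use d in auto)
  qed
  then obtain d where d: "\<And>J. d J > 0" "\<And>J A y z. size (A :: 'i multiset) = J \<Longrightarrow>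
      (\<forall>i\<in>#A. y i \<in> {0..1} \<and> z i \<in> {0..1} \<and> \<bar>y i - z i\<bar> \<le> d J) \<Longrightarrow>
      \<bar>F (image_mset y A) - F (image_mset z A)\<bar> \<le> \<eta>"
    by metis
  show ?thesis
  proof (intro exI[of _ "Min (d ` {..Q})"] conjI allI impI)
    show "Min (d ` {..Q}) > 0" using d(1) by auto
    fix A :: "'i multiset" and y z :: "'i \<Rightarrow> real"
    assume A: "size A \<le> Q" and
        yz: "\<forall>i\<in>#A. y i \<in> {0..1} \<and> z i \<in> {0..1} \<and> \<bar>y i - z i\<bar> \<le> Min (d ` {..Q})"
    have "Min (d ` {..Q}) \<le> d (size A)" using A by (intro Min_le) auto
    with yz show "\<bar>F (image_mset y A) - F (image_mset z A)\<bar> \<le> \<eta>"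
      by (intro d(2)[OF refl]) (meson order_trans)
  qed
qed

section \<open>Borel sets of a topology and measurability of point processes\<close>

lemma space_borel_of_topology [simp]: "space (borel_of_topology T) = topspace T"
  by (simp add: borel_of_topology_def space_measure_of_conv)

lemma sets_borel_of_topology: "sets (borel_of_topology T) = sigma_sets (topspace T) {U. openin T U}"
  unfolding borel_of_topology_def
  by (rule sets_measure_of) (auto dest: openin_subset)

lemma measurable_borel_of_topologyI:
  assumes "\<And>\<omega>. \<omega> \<in> space M \<Longrightarrow> f \<omega> \<in> topspace T"
    and "\<And>U. openin T U \<Longrightarrow> f -` U \<inter> space M \<in> sets M"
  shows "f \<in> M \<rightarrow>\<^sub>M borel_of_topology T"
  unfolding borel_of_topology_def
  using assms by (intro measurable_measure_of) (auto dest: openin_subset)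

lemma continuous_map_measurable_borel_of_topology:
  assumes "continuous_map T euclideanreal F"
  shows "F \<in> borel_of_topology T \<rightarrow>\<^sub>M borel"
proof (rule borel_measurableI)
  fix S :: "real set" assume "open S"
  then have "openin T {x \<in> topspace T. F x \<in> S}"
    by (intro openin_continuous_map_preimage[OF assms]) auto
  moreover have "{x \<in> topspace T. F x \<in> S} = F -` S \<inter> space (borel_of_topology T)" by auto
  ultimately show "F -` S \<inter> space (borel_of_topology T) \<in> sets (borel_of_topology T)"
    by (auto simp: sets_borel_of_topology)
qed

text \<open>The list of multiplicities takes countably many values and can be held fixed. The map is
  then continuous in the positions, and on the sequence space the Borel \<sigma>-algebra is the
  product one, so that measurability of each coordinate suffices.\<close>

lemma measurable_marked_points:
  assumes c: "c \<in> M \<rightarrow>\<^sub>M count_space UNIV"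
    and x: "\<And>j. (\<lambda>\<omega>. x \<omega> j) \<in> borel_measurable M" "\<And>\<omega> j. \<omega> \<in> space M \<Longrightarrow> x \<omega> j \<in> {0..1}"
  shows "(\<lambda>\<omega>. marked_points (c \<omega>) (x \<omega>)) \<in> M \<rightarrow>\<^sub>M borel_of_topology vague_topology"
proof (rule measurable_compose_countable[OF _ c])
  fix c :: "nat list"
  show "(\<lambda>\<omega>. marked_points c (x \<omega>)) \<in> M \<rightarrow>\<^sub>M borel_of_topology vague_topology"
  proof (rule measurable_borel_of_topologyI)
    fix \<omega> assume "\<omega> \<in> space M"
    then have "x \<omega> \<in> topspace (top_of_set unit_seqs)" using x(2) by (auto simp: unit_seqs_def)
    then show "marked_points c (x \<omega>) \<in> topspace vague_topology"
      using continuous_map_image_subset_topspace[OF continuous_map_marked_points[of c]] by blast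
  next
    fix U assume "openin vague_topology U"
    then have "openin (top_of_set unit_seqs) {z \<in> unit_seqs. marked_points c z \<in> U}"
      using openin_continuous_map_preimage[OF continuous_map_marked_points[of c]] by simp
    then obtain V where V: "open V" "{z \<in> unit_seqs. marked_points c z \<in> U} = V \<inter> unit_seqs"
      by (auto simp: openin_open)
    have "x \<in> M \<rightarrow>\<^sub>M (\<Pi>\<^sub>M i\<in>UNIV. borel)"
      by (rule measurable_PiM_single') (use x(1) in auto)
    then have "x \<in> borel_measurable M"
      using measurable_cong_sets[OF refl sets_PiM_equal_borel] by blast
    then have "x -` V \<inter> space M \<in> sets M" using V(1) by (auto intro: measurable_sets)
    also have "x -` V \<inter> space M = (\<lambda>\<omega>. marked_points c (x \<omega>)) -` U \<inter> space M"
      using V(2) x(2) by (auto simp: unit_seqs_def set_eq_iff)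
    finally show "(\<lambda>\<omega>. marked_points c (x \<omega>)) -` U \<inter> space M \<in> sets M" .
  qed
qed

section \<open>The limiting compound Poisson process\<close>

text \<open>
  The limit must take its values in the point measures of the unit interval everywhere and not
  just almost surely; hence the coordinates, uniformly distributed on the interval but real
  numbers as such, are truncated.
\<close>

definition clip :: "real \<Rightarrow> real" where
  "clip y = (if y \<in> {0..1} then y else 0)"

lemma clip_mem [simp]: "0 \<le> clip y" "clip y \<le> 1"
  by (auto simp: clip_def)

lemma measurable_clip [measurable]: "clip \<in> borel_measurable borel"
  unfolding clip_def by measurable

abbreviation unif01 :: "real measure" where
  "unif01 \<equiv> uniform_measure lborel {0..1}"

interpretation unif01: prob_space unif01
  by (rule prob_space_uniform_measure) auto

lemma measure_unif01_clip:
  assumes "A \<in> sets borel" "A \<subseteq> {0..1}"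
  shows "emeasure unif01 {y. clip y \<in> A} = emeasure lborel A"
proof -
  have "{y. clip y \<in> A} \<in> sets borel"
    using measurable_sets[OF measurable_clip assms(1)] by (simp add: vimage_def)
  moreover have "{0..1} \<inter> {y. clip y \<in> A} = A" using assms(2) by (auto simp: clip_def)
  ultimately show ?thesis by (simp add: emeasure_uniform_measure divide_ennreal_def)
qed

lemma size_mset_sum: "size (\<Sum>i\<in>I. A i :: 'b multiset) = (\<Sum>i\<in>I. size (A i))"
  by (induction I rule: infinite_finite_induct) auto

text \<open>With countably many values the fibres generate all preimages under \<open>X i\<close>,
  and together with the empty set they are stable under intersection. Independence therefore reduces
  to joint point probabilities.\<close>

lemma (in prob_space) indep_vars_countableI:
  fixes X :: "'i \<Rightarrow> 'a \<Rightarrow> 'b :: countable"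
  assumes rv: "\<And>i. i \<in> I \<Longrightarrow> X i \<in> M \<rightarrow>\<^sub>M count_space UNIV"
    and prod: "\<And>J k. J \<subseteq> I \<Longrightarrow> finite J \<Longrightarrow> J \<noteq> {} \<Longrightarrow>
      prob {\<omega> \<in> space M. \<forall>i\<in>J. X i \<omega> = k i} = (\<Prod>i\<in>J. prob {\<omega> \<in> space M. X i \<omega> = k i})"
  shows "indep_vars (\<lambda>_. count_space UNIV) X I"
proof -
  define G where "G i = insert {} {X i -` {k} \<inter> space M |k. True}" for i
  have ev: "X i -` A \<inter> space M \<in> events" if "i \<in> I" for i A
    using measurable_sets[OF rv[OF that]] by simp
  have "indep_sets G I"
  proof (rule indep_setsI)
    fix i assume "i \<in> I" then show "G i \<subseteq> events" using ev by (auto simp: G_def)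
  next
    fix A J assume J: "J \<noteq> {}" "J \<subseteq> I" "finite J" and A: "\<forall>j\<in>J. A j \<in> G j"
    show "prob (\<Inter>j\<in>J. A j) = (\<Prod>j\<in>J. prob (A j))"
    proof (cases "\<exists>j\<in>J. A j = {}")
      case True
      then obtain j where j: "j \<in> J" "A j = {}" by blast
      then have "(\<Inter>j\<in>J. A j) = {}" by blast
      moreover have "(\<Prod>j\<in>J. prob (A j)) = 0"
        using j J(3) by (intro prod_zero bexI[of _ j]) simp_all
      ultimately
      show ?thesis by simp
    next
      case False
      then have "\<forall>j\<in>J. \<exists>k. A j = X j -` {k} \<inter> space M" using A by (auto simp: G_def)
      then obtain k where k: "\<And>j. j \<in> J \<Longrightarrow> A j = X j -` {k j} \<inter> space M" by metis
      then have k': "\<And>j. j \<in> J \<Longrightarrow> A j = {\<omega> \<in> space M. X j \<omega> = k j}" by auto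
      then have "(\<Inter>j\<in>J. A j) = {\<omega> \<in> space M. \<forall>i\<in>J. X i \<omega> = k i}" using J(1) by auto
      then show ?thesis using prod[OF J(2,3,1), of k] k' by simp
    qed
  qed
  moreover have "Int_stable (G i)" for i by (auto simp: Int_stable_def G_def)
  ultimately have "indep_sets (\<lambda>i. sigma_sets (space M) (G i)) I" by (rule indep_sets_sigma)
  moreover have "{X i -` A \<inter> space M | A. A \<in> sets (count_space UNIV)} \<subseteq> sigma_sets (space M) (G i)" for i
  proof safe
    fix A
    have "X i -` A \<inter> space M = (\<Union>k\<in>A. X i -` {k} \<inter> space M)" by auto
    also have "\<dots> \<in> sigma_sets (space M) (G i)"
      by (intro sigma_sets_UNION) (auto simp: G_def)
    finally show "X i -` A \<inter> space M \<in> sigma_sets (space M) (G i)" .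
  qed
  ultimately show ?thesis
    unfolding indep_vars_def2 using rv by (auto intro: indep_sets_mono_sets)
qed

lemma count_mset_nth: "count (mset xs) c = card {j. j < length xs \<and> xs ! j = c}"
  unfolding count_mset count_list_eq_length_filter length_filter_conv_card by (intro arg_cong[where f=card] Collect_cong) auto

section \<open>Canonical space of a marked Poisson process\<close>

locale marked_poisson =
  fixes lam :: real and P :: "nat pmf"
  assumes lam: "0 < lam" and P0: "pmf P 0 = 0"
begin

abbreviation Mx where "Mx \<equiv> PiM UNIV (\<lambda>_::nat. unif01)"
abbreviation Mv where "Mv \<equiv> PiM UNIV (\<lambda>_::nat. measure_pmf P)"
abbreviation Mk where "Mk \<equiv> measure_pmf (poisson_pmf lam)"

text \<open>The usual construction of a Poisson process of finite intensity: a Poisson number of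
  independent uniform points. Infinitely many positions and marks are drawn in advance, which keeps
  the number of points independent of them.\<close>

definition MP :: "(nat \<times> (nat \<Rightarrow> real) \<times> (nat \<Rightarrow> nat)) measure" where
  "MP = Mk \<Otimes>\<^sub>M (Mx \<Otimes>\<^sub>M Mv)"

definition K :: "nat \<times> (nat \<Rightarrow> real) \<times> (nat \<Rightarrow> nat) \<Rightarrow> nat" where "K \<omega> = fst \<omega>"
definition x :: "nat \<Rightarrow> nat \<times> (nat \<Rightarrow> real) \<times> (nat \<Rightarrow> nat) \<Rightarrow> real" where "x j \<omega> = clip (fst (snd \<omega>) j)"
definition \<nu> :: "nat \<Rightarrow> nat \<times> (nat \<Rightarrow> real) \<times> (nat \<Rightarrow> nat) \<Rightarrow> nat" where "\<nu> j \<omega> = snd (snd \<omega>) j"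

sublocale Mx: product_prob_space "\<lambda>_::nat. unif01" UNIV ..
sublocale Mv: product_prob_space "\<lambda>_::nat. measure_pmf P" UNIV ..
sublocale xv: pair_prob_space Mx Mv ..
sublocale kxv: pair_prob_space Mk "Mx \<Otimes>\<^sub>M Mv" ..
sublocale prob_space MP unfolding MP_def by (rule kxv.prob_space_axioms)

lemma sigma_finite_Mv: "sigma_finite_measure Mv"
  by (intro prob_space_imp_sigma_finite Mv.prob_space_axioms)

lemma sigma_finite_xv: "sigma_finite_measure (Mx \<Otimes>\<^sub>M Mv)"
  by (intro prob_space_imp_sigma_finite xv.prob_space_axioms)

lemma space_MP [simp]: "space MP = UNIV"
  by (simp add: MP_def space_pair_measure space_PiM)

lemma sets_Mx: "sets Mx = sets (PiM UNIV (\<lambda>_. borel))"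
  by (intro sets_PiM_cong) auto

lemma sets_Mv: "sets Mv = sets (PiM UNIV (\<lambda>_. count_space UNIV))"
  by (intro sets_PiM_cong) auto

lemma measurable_K [measurable]: "K \<in> MP \<rightarrow>\<^sub>M count_space UNIV"
proof -
  have "fst \<in> MP \<rightarrow>\<^sub>M Mk" unfolding MP_def by measurable
  then show ?thesis unfolding K_def by simp
qed

lemma measurable_x [measurable]: "x j \<in> borel_measurable MP"
proof -
  have "(\<lambda>\<omega>. fst (snd \<omega>) j) \<in> MP \<rightarrow>\<^sub>M unif01" unfolding MP_def by measurable
  then have "(\<lambda>\<omega>. fst (snd \<omega>) j) \<in> borel_measurable MP"
    using measurable_cong_sets[of MP MP unif01 borel] by simp
  then show ?thesis unfolding x_def by measurable
qed

lemma measurable_\<nu> [measurable]: "\<nu> j \<in> MP \<rightarrow>\<^sub>M count_space UNIV"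
proof -
  have "(\<lambda>\<omega>. snd (snd \<omega>) j) \<in> MP \<rightarrow>\<^sub>M measure_pmf P" unfolding MP_def by measurable
  then show ?thesis unfolding \<nu>_def by simp
qed

lemma event_K: "{\<omega>. K \<omega> \<in> R} \<in> events"
  using measurable_sets[OF measurable_K, of R] by (simp add: vimage_def)

lemma event_x: "A \<in> sets borel \<Longrightarrow> {\<omega>. x j \<omega> \<in> A} \<in> events"
  using measurable_sets[OF measurable_x, of A] by (simp add: vimage_def)

lemma event_\<nu>: "{\<omega>. \<nu> j \<omega> \<in> D} \<in> events"
  using measurable_sets[OF measurable_\<nu>, of D] by (simp add: vimage_def)

lemma x_mem [simp]: "0 \<le> x j \<omega>" "x j \<omega> \<le> 1"
  by (auto simp: x_def)

text \<open>All coordinates are independent, and for sets inside the unit interval clipping does not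
  change the uniform measure. Every probability on this space is reduced to this formula.\<close>

lemma prob_box:
  assumes J: "finite J" and A: "\<And>j. j \<in> J \<Longrightarrow> A j \<in> sets borel" "\<And>j. j \<in> J \<Longrightarrow> A j \<subseteq> {0..1}"
  shows "prob {\<omega>. K \<omega> \<in> R \<and> (\<forall>j\<in>J. x j \<omega> \<in> A j \<and> \<nu> j \<omega> \<in> D j)} =
    measure_pmf.prob (poisson_pmf lam) R * (\<Prod>j\<in>J. measure lborel (A j) * measure_pmf.prob P (D j))"
proof -
  let ?Ax = "{y \<in> space Mx. \<forall>j\<in>J. y j \<in> {y. clip y \<in> A j}}"
  let ?Dv = "{y \<in> space Mv. \<forall>j\<in>J. y j \<in> D j}"
  have cA: "j \<in> J \<Longrightarrow> {y. clip y \<in> A j} \<in> sets unif01" for j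
    using measurable_sets[OF measurable_clip A(1)[of j]] by (simp add: vimage_def)
  have eq: "{\<omega>. K \<omega> \<in> R \<and> (\<forall>j\<in>J. x j \<omega> \<in> A j \<and> \<nu> j \<omega> \<in> D j)} = R \<times> (?Ax \<times> ?Dv)"
    by (auto simp: K_def x_def \<nu>_def space_PiM)
  have "{y \<in> space Mx. y j \<in> {y. clip y \<in> A j}} \<in> sets Mx" if "j \<in> J" for j
  proof -
    have eq: "{y \<in> space Mx. y j \<in> S} = (\<lambda>y. y j) -` S \<inter> space Mx" for S by auto
    have m: "(\<lambda>y. y j) \<in> Mx \<rightarrow>\<^sub>M unif01" by (rule measurable_component_singleton) (rule UNIV_I)
    show ?thesis unfolding eq by (rule measurable_sets[OF m cA[OF that]])
  qed
  then have "?Ax \<in> sets Mx" by (rule sets.sets_Collect_finite_All[OF _ J])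
  moreover have "emeasure Mx ?Ax = (\<Prod>j\<in>J. emeasure unif01 {y. clip y \<in> A j})"
    by (rule Mx.emeasure_PiM_Collect[OF subset_UNIV J cA])
  then have "emeasure Mx ?Ax = (\<Prod>j\<in>J. emeasure lborel (A j))"
    using measure_unif01_clip[OF A] by (simp cong: prod.cong)
  ultimately have Ax: "?Ax \<in> sets Mx" "emeasure Mx ?Ax = (\<Prod>j\<in>J. emeasure lborel (A j))"
    by blast+
  have Dv: "?Dv \<in> sets Mv" "emeasure Mv ?Dv = (\<Prod>j\<in>J. emeasure P (D j))"
    using Mv.emeasure_PiM_Collect[OF subset_UNIV J, of D] J by auto
  have "emeasure MP (R \<times> (?Ax \<times> ?Dv)) = emeasure Mk R * (emeasure Mx ?Ax * emeasure Mv ?Dv)"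
    unfolding MP_def using Ax(1) Dv(1)
    by (subst sigma_finite_measure.emeasure_pair_measure_Times)
       (auto simp: sigma_finite_measure.emeasure_pair_measure_Times sigma_finite_Mv sigma_finite_xv)
  then have "prob (R \<times> (?Ax \<times> ?Dv)) = measure Mk R * (enn2real (emeasure Mx ?Ax) * enn2real (emeasure Mv ?Dv))"
    by (simp add: measure_def enn2real_mult)
  also have "enn2real (emeasure Mx ?Ax) = (\<Prod>j\<in>J. measure lborel (A j))"
    unfolding Ax(2) by (induction J rule: infinite_finite_induct) (auto simp: enn2real_mult measure_def)
  also have "enn2real (emeasure Mv ?Dv) = (\<Prod>j\<in>J. measure P (D j))"
    unfolding Dv(2) by (induction J rule: infinite_finite_induct) (auto simp: enn2real_mult measure_def)
  finally show ?thesis unfolding eq by (simp add: prod.distrib)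
qed

text \<open>\<open>Am\<close> prescribes how many points belong to each class c, with position in
  \<open>A c\<close> and mark in \<open>D c\<close>. Different orders of the classes give disjoint
  events of equal probability, because the \<open>A c\<close> are disjoint. Their number is a
  multinomial coefficient; its numerator cancels the factorial in the Poisson weight, which leaves
  one Poisson-type factor per class.\<close>

lemma prob_marked_cluster_pattern:
  fixes Am :: "'c multiset" and A :: "'c \<Rightarrow> real set" and D :: "'c \<Rightarrow> nat set"
  assumes A: "\<And>c. c \<in># Am \<Longrightarrow> A c \<in> sets borel" "\<And>c. c \<in># Am \<Longrightarrow> A c \<subseteq> {0..1}"
    and dis: "disjoint_family_on A (set_mset Am)"
  defines "E \<equiv> {\<omega>. K \<omega> = size Am \<and> (\<exists>cs\<in>permutations_of_multiset Am. \<forall>j<size Am. x j \<omega> \<in> A (cs ! j) \<and> \<nu> j \<omega> \<in> D (cs ! j))}"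
  shows "prob E = exp (- lam) * (\<Prod>c\<in>set_mset Am. (lam * (measure lborel (A c) * measure P (D c))) ^ count Am c / fact (count Am c))"
    and "E \<in> events"
proof -
  let ?S = "permutations_of_multiset Am"
  let ?E = "\<lambda>cs. {\<omega>. K \<omega> \<in> {size Am} \<and> (\<forall>j\<in>{..<size Am}. x j \<omega> \<in> A (cs ! j) \<and> \<nu> j \<omega> \<in> D (cs ! j))}"
  let ?g = "\<lambda>c. measure lborel (A c) * measure P (D c)"
  have len: "length cs = size Am" if "cs \<in> ?S" for cs
    using that by (rule length_finite_permutations_of_multiset)
  have mem: "cs ! j \<in># Am" if "cs \<in> ?S" "j < size Am" for cs j
    using nth_mem[of j cs] that(2) len[OF that(1)] permutations_of_multisetD[OF that(1)]
    by (metis set_mset_mset)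
  have E: "E = (\<Union>cs\<in>?S. ?E cs)" unfolding E_def by auto
  have ev: "?E cs \<in> events" if "cs \<in> ?S" for cs
  proof -
    have "{\<omega>. x j \<omega> \<in> A (cs ! j)} \<inter> {\<omega>. \<nu> j \<omega> \<in> D (cs ! j)} \<in> events" if "j < size Am" for j
      using A(1)[OF mem[OF \<open>cs \<in> ?S\<close> that]] by (intro sets.Int event_x event_\<nu>)
    then have "{\<omega> \<in> space MP. x j \<omega> \<in> A (cs ! j) \<and> \<nu> j \<omega> \<in> D (cs ! j)} \<in> events" if "j \<in> {..<size Am}" for j
      using that by (simp add: Int_def)
    then have "{\<omega> \<in> space MP. \<forall>j\<in>{..<size Am}. x j \<omega> \<in> A (cs ! j) \<and> \<nu> j \<omega> \<in> D (cs ! j)} \<in> events"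
      by (rule sets.sets_Collect_finite_All) simp_all
    from sets.Int[OF event_K[of "{size Am}"] this] show ?thesis
      by (rule back_subst[of "\<lambda>S. S \<in> events"]) auto
  qed
  show "E \<in> events" unfolding E by (rule sets.finite_UN) (use ev in auto)
  have disj: "disjoint_family_on ?E ?S"
    unfolding disjoint_family_on_def
  proof (intro ballI impI)
    fix cs cs' assume cs: "cs \<in> ?S" "cs' \<in> ?S" "cs \<noteq> cs'"
    have False if w: "\<omega> \<in> ?E cs" "\<omega> \<in> ?E cs'" for \<omega>
    proof -
      have "cs ! j = cs' ! j" if "j < size Am" for j
      proof (rule ccontr)
        assume "cs ! j \<noteq> cs' ! j"
        with dis have "A (cs ! j) \<inter> A (cs' ! j) = {}"
          using mem cs that unfolding disjoint_family_on_def by blast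
        with w that show False by auto
      qed
      then have "cs = cs'" using len[OF cs(1)] len[OF cs(2)] by (intro nth_equalityI) auto
      with cs show False by blast
    qed
    then show "?E cs \<inter> ?E cs' = {}" by blast
  qed
  have one: "prob (?E cs) = lam ^ size Am / fact (size Am) * exp (- lam) * (\<Prod>c\<in>set_mset Am. ?g c ^ count Am c)"
    if cs: "cs \<in> ?S" for cs
  proof -
    have "prob (?E cs) = measure_pmf.prob (poisson_pmf lam) {size Am} * (\<Prod>j<size Am. ?g (cs ! j))"
      using A mem[OF cs] by (intro prob_box) auto
    also have "measure_pmf.prob (poisson_pmf lam) {size Am} = lam ^ size Am / fact (size Am) * exp (- lam)"
      using lam by (simp add: measure_pmf_single)
    also have "(\<Prod>j<size Am. ?g (cs ! j)) = prod_mset (image_mset ?g (mset cs))"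
      unfolding len[OF cs, symmetric] by (induction cs rule: rev_induct) (auto simp: nth_append)
    also have "mset cs = Am" using cs by (simp add: permutations_of_multiset_def)
    finally show ?thesis by (simp only: image_prod_mset_multiplicity)
  qed
  have card: "real (card ?S) = fact (size Am) / (\<Prod>c\<in>set_mset Am. fact (count Am c))"
    using card_permutations_of_multiset[of Am] by (simp add: real_of_nat_div)
  have "prob E = (\<Sum>cs\<in>?S. prob (?E cs))"
    unfolding E using ev disj by (intro finite_measure_finite_Union) auto
  also have "\<dots> = real (card ?S) * (lam ^ size Am / fact (size Am) * exp (- lam) * (\<Prod>c\<in>set_mset Am. ?g c ^ count Am c))"
    using one by simp
  also have "\<dots> = exp (- lam) * (lam ^ size Am * (\<Prod>c\<in>set_mset Am. ?g c ^ count Am c / fact (count Am c)))"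
    unfolding card by (simp add: prod_dividef)
  also have "lam ^ size Am = (\<Prod>c\<in>set_mset Am. lam ^ count Am c)"
    by (simp add: size_multiset_overloaded_eq power_sum)
  finally show "prob E = exp (- lam) * (\<Prod>c\<in>set_mset Am. (lam * ?g c) ^ count Am c / fact (count Am c))"
    by (simp add: prod.distrib[symmetric] power_mult_distrib)
qed

lemma measurable_card_points [measurable]:
  assumes [measurable]: "B \<in> sets borel"
  shows "(\<lambda>\<omega>. card {j. j < K \<omega> \<and> x j \<omega> \<in> B}) \<in> MP \<rightarrow>\<^sub>M count_space UNIV"
proof (rule measurable_compose_countable[OF _ measurable_K])
  fix k
  have "(\<lambda>\<omega>. (\<Sum>j<k. if x j \<omega> \<in> B then 1 else 0 :: nat)) \<in> MP \<rightarrow>\<^sub>M count_space UNIV" by measurable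
  moreover have "card {j. j < k \<and> x j \<omega> \<in> B} = (\<Sum>j<k. if x j \<omega> \<in> B then 1 else 0)" for \<omega>
  proof -
    have "{j. j < k \<and> x j \<omega> \<in> B} = {..<k} \<inter> {j. x j \<omega> \<in> B}" by auto
    then show ?thesis by (simp add: sum.If_cases)
  qed
  ultimately show "(\<lambda>\<omega>. card {j. j < k \<and> x j \<omega> \<in> B}) \<in> MP \<rightarrow>\<^sub>M count_space UNIV" by simp
qed

text \<open>The complement \<open>rest\<close> is added as a further class, encoded by
  \<open>None\<close>, so that the classes partition the unit interval. The event is then the
  disjoint union over the number N of points in \<open>rest\<close>; the exponential series in N
  turns exp(-lam) into the product of the factors exp(-lam |B i|).\<close>

lemma prob_point_counts:
  fixes J :: "'i set" and B :: "'i \<Rightarrow> real set"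
  assumes J: "finite J" and B: "\<And>i. i \<in> J \<Longrightarrow> B i \<in> sets borel" "\<And>i. i \<in> J \<Longrightarrow> B i \<subseteq> {0..1}"
    and dis: "disjoint_family_on B J"
  shows "prob {\<omega>. \<forall>i\<in>J. card {j. j < K \<omega> \<and> x j \<omega> \<in> B i} = k i} =
    (\<Prod>i\<in>J. (lam * measure lborel (B i)) ^ k i / fact (k i) * exp (- (lam * measure lborel (B i))))"
proof -
  define rest where "rest = {0..1} - (\<Union>i\<in>J. B i)"
  define B' where "B' = (\<lambda>c. case c of None \<Rightarrow> rest | Some i \<Rightarrow> B i)"
  define Am where "Am N = (\<Sum>i\<in>J. replicate_mset (k i) (Some i)) + replicate_mset N None" for N
  let ?a = "\<lambda>c. lam * measure lborel (B' c)"
  define Ev where "Ev N = {\<omega>. K \<omega> = size (Am N) \<and> (\<exists>cs\<in>permutations_of_multiset (Am N).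
    \<forall>j<size (Am N). x j \<omega> \<in> B' (cs ! j) \<and> \<nu> j \<omega> \<in> UNIV)}" for N
  let ?E = "{\<omega>. \<forall>i\<in>J. card {j. j < K \<omega> \<and> x j \<omega> \<in> B i} = k i}"
  have rest: "rest \<in> sets borel" "rest \<subseteq> {0..1}"
    unfolding rest_def using J B(1) by (auto intro!: sets.Diff sets.finite_UN)
  have setAm: "set_mset (Am N) \<subseteq> insert None (Some ` J)" for N
    unfolding Am_def using J by (auto simp: set_mset_sum_replicate)
  have cnt: "count (Am N) None = N" "i \<in> J \<Longrightarrow> count (Am N) (Some i) = k i" for N i
    unfolding Am_def using J by (auto simp: count_sum)
  have size: "size (Am N) = sum k J + N" for N unfolding Am_def by (simp add: size_mset_sum)
  have B': "B' c \<in> sets borel" "B' c \<subseteq> {0..1}" if "c \<in> insert None (Some ` J)" for c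
    using that B rest by (elim insertE imageE; simp add: B'_def)+
  have disB': "disjoint_family_on B' (insert None (Some ` J))"
    using dis by (auto simp: disjoint_family_on_def B'_def rest_def)
  note pat = prob_marked_cluster_pattern[OF B'(1)[OF subsetD[OF setAm]] B'(2)[OF subsetD[OF setAm]]
      disjoint_family_on_mono[OF setAm disB']]
  have Ev_meas: "Ev N \<in> events" for N
    unfolding Ev_def by (rule pat(2))
  have "prob (Ev N) = exp (- lam) * (\<Prod>c\<in>set_mset (Am N). ?a c ^ count (Am N) c / fact (count (Am N) c))" for N
    unfolding Ev_def by (subst pat(1)) simp_all
  also have "\<dots> N = exp (- lam) * (\<Prod>c\<in>insert None (Some ` J). ?a c ^ count (Am N) c / fact (count (Am N) c))" for N
    using J setAm by (intro arg_cong2[where f="(*)"] refl prod.mono_neutral_left) (auto simp: not_in_iff)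
  also have "\<dots> N = exp (- lam) * (\<Prod>i\<in>J. (lam * measure lborel (B i)) ^ k i / fact (k i)) * ((lam * measure lborel rest) ^ N / fact N)" for N
    using J by (subst prod.insert) (auto simp: cnt prod.reindex B'_def)
  finally have pEv: "prob (Ev N) = exp (- lam) * (\<Prod>i\<in>J. (lam * measure lborel (B i)) ^ k i / fact (k i)) *
      ((lam * measure lborel rest) ^ N / fact N)" for N .
  have disEv: "disjoint_family Ev"
    by (auto simp: disjoint_family_on_def Ev_def size)
  have UN: "?E = (\<Union>N. Ev N)"
  proof (intro equalityI subsetI)
    fix \<omega> assume w: "\<omega> \<in> ?E"
    \<comment> \<open>\<open>cat y\<close> is the class of the partition that contains y. Listing
      the classes of the points in order yields the witness that puts the outcome into one of the
      events \<open>Ev N\<close>.\<close>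
    define cat where "cat y = (if \<exists>i\<in>J. y \<in> B i then Some (SOME i. i \<in> J \<and> y \<in> B i) else None)" for y
    have cat1: "cat y = Some i \<longleftrightarrow> y \<in> B i" if "i \<in> J" for i y
    proof
      assume "y \<in> B i"
      with that have "\<exists>i. i \<in> J \<and> y \<in> B i" by blast
      from someI_ex[OF this] have "(SOME i. i \<in> J \<and> y \<in> B i) = i"
        using dis that \<open>y \<in> B i\<close> unfolding disjoint_family_on_def by blast
      with that \<open>y \<in> B i\<close> show "cat y = Some i" by (auto simp: cat_def)
    next
      assume "cat y = Some i"
      then have ex: "\<exists>i. i \<in> J \<and> y \<in> B i" and "i = (SOME i. i \<in> J \<and> y \<in> B i)"
        by (auto simp: cat_def split: if_splits)
      with someI_ex[OF ex] show "y \<in> B i" by blast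
    qed
    have cat2: "cat y \<in> insert None (Some ` J)" for y
    proof (cases "cat y")
      case (Some i)
      then have ex: "\<exists>i. i \<in> J \<and> y \<in> B i" and "i = (SOME i. i \<in> J \<and> y \<in> B i)"
        by (auto simp: cat_def split: if_splits)
      with someI_ex[OF ex] Some show ?thesis by blast
    qed auto
    have cat3: "y \<in> B' (cat y)" if "y \<in> {0..1}" for y
    proof (cases "cat y")
      case None
      have "\<forall>i\<in>J. y \<notin> B i"
      proof (intro ballI notI)
        fix i assume "i \<in> J" "y \<in> B i"
        then have "cat y = Some i" using cat1 by blast
        with None show False by simp
      qed
      then show ?thesis using that None by (auto simp: B'_def rest_def)
    next
      case (Some i)
      then have "i \<in> J" using cat2[of y] by auto
      then have "y \<in> B i" using Some cat1 by blast
      then show ?thesis unfolding Some B'_def by simp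
    qed
    let ?cs = "map (\<lambda>j. cat (x j \<omega>)) [0..<K \<omega>]"
    have c1: "count (mset ?cs) (Some i) = k i" if "i \<in> J" for i
    proof -
      have "count (mset ?cs) (Some i) = card {j. j < K \<omega> \<and> cat (x j \<omega>) = Some i}"
        unfolding count_mset_nth by (intro arg_cong[where f=card]) auto
      then show ?thesis using w that cat1[OF that] by simp
    qed
    have "mset ?cs = Am (count (mset ?cs) None)"
    proof (rule multiset_eqI)
      fix c
      show "count (mset ?cs) c = count (Am (count (mset ?cs) None)) c"
      proof (cases "c \<in> insert None (Some ` J)")
        case True then show ?thesis using c1 cnt by auto
      next
        case False
        then have "c \<noteq> cat y" for y using cat2[of y] by blast
        then have "c \<notin># mset ?cs" by auto
        moreover have "c \<notin># Am (count (mset ?cs) None)" using False setAm by blast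
        ultimately
        show ?thesis by (metis not_in_iff)
      qed
    qed
    then obtain N where N: "mset ?cs = Am N" by blast
    then have "K \<omega> = size (Am N)" by (metis length_map length_upt size_mset diff_zero)
    with N have "\<omega> \<in> Ev N"
      unfolding Ev_def using cat3 by (auto simp: permutations_of_multiset_def intro!: exI[of _ ?cs])
    then show "\<omega> \<in> (\<Union>N. Ev N)" by blast
  next
    fix \<omega> assume "\<omega> \<in> (\<Union>N. Ev N)"
    then obtain N cs where w: "K \<omega> = size (Am N)" "mset cs = Am N" "\<And>j. j < size (Am N) \<Longrightarrow> x j \<omega> \<in> B' (cs ! j)"
      by (auto simp: Ev_def permutations_of_multiset_def)
    have len: "length cs = size (Am N)" using w(2) by (metis size_mset)
    show "\<omega> \<in> ?E"
    proof safe
      fix i assume i: "i \<in> J"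
      have "x j \<omega> \<in> B i \<longleftrightarrow> cs ! j = Some i" if "j < size (Am N)" for j
      proof -
        have mem: "cs ! j \<in> insert None (Some ` J)"
          using w(2) setAm that len by (metis nth_mem set_mset_mset subsetD)
        have xB': "x j \<omega> \<in> B' (cs ! j)" by (rule w(3)) fact
        have BS: "B i = B' (Some i)" by (simp add: B'_def)
        show ?thesis
        proof
          assume "x j \<omega> \<in> B i"
          then have "x j \<omega> \<in> B' (cs ! j) \<inter> B' (Some i)" using xB' BS by simp
          then show "cs ! j = Some i"
            using disjoint_family_onD[OF disB' mem, of "Some i"] i by blast
        next
          assume "cs ! j = Some i" then show "x j \<omega> \<in> B i" using xB' BS by simp
        qed
      qed
      then have "card {j. j < K \<omega> \<and> x j \<omega> \<in> B i} = card {j. j < length cs \<and> cs ! j = Some i}"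
        using w(1) len by (intro arg_cong[where f=card]) auto
      also have "\<dots> = count (mset cs) (Some i)"
        by (simp only: count_mset_nth)
      finally show "card {j. j < K \<omega> \<and> x j \<omega> \<in> B i} = k i" using w(2) cnt i by simp
    qed
  qed
  have "(\<lambda>N. prob (Ev N)) sums prob ?E"
    unfolding UN using Ev_meas disEv by (intro finite_measure_UNION) auto
  moreover have "(\<lambda>N. exp (- lam) * (\<Prod>i\<in>J. (lam * measure lborel (B i)) ^ k i / fact (k i)) *
      ((lam * measure lborel rest) ^ N / fact N)) sums
      (exp (- lam) * (\<Prod>i\<in>J. (lam * measure lborel (B i)) ^ k i / fact (k i)) * exp (lam * measure lborel rest))"
    using exp_converges[of "lam * measure lborel rest"] by (intro sums_mult) (simp add: divide_inverse_commute)
  ultimately have eq: "prob ?E = exp (- lam) * (\<Prod>i\<in>J. (lam * measure lborel (B i)) ^ k i / fact (k i)) * exp (lam * measure lborel rest)"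
    unfolding pEv by (rule sums_unique2)
  have fin: "emeasure lborel (B i) \<noteq> \<infinity>" if "i \<in> J" for i
    using emeasure_mono[OF B(2)[OF that], of lborel] by (auto simp: top_unique)
  have "measure lborel (\<Union>i\<in>J. B i) = (\<Sum>i\<in>J. measure lborel (B i))"
    using J B(1) dis fin by (intro measure_finite_Union) auto
  moreover have "measure lborel rest = measure lborel {0..1::real} - measure lborel (\<Union>i\<in>J. B i)"
    unfolding rest_def using J B by (intro measure_Diff) auto
  ultimately have "measure lborel rest = 1 - (\<Sum>i\<in>J. measure lborel (B i))" by simp
  then have "lam * measure lborel rest = lam - (\<Sum>i\<in>J. lam * measure lborel (B i))"
    by (simp add: right_diff_distrib sum_distrib_left)
  then have "exp (- lam) * exp (lam * measure lborel rest) = (\<Prod>i\<in>J. exp (- (lam * measure lborel (B i))))"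
    unfolding exp_sum[OF J, symmetric] exp_add[symmetric] by (simp add: sum_negf)
  then show ?thesis unfolding eq prod.distrib by (simp add: algebra_simps)
qed

definition points :: "nat \<times> (nat \<Rightarrow> real) \<times> (nat \<Rightarrow> nat) \<Rightarrow> real multiset" where
  "points \<omega> = {#x j \<omega>. j \<in># mset_set {..<K \<omega>}#}"

lemma points_eq_marked_points: "points \<omega> = marked_points (replicate (K \<omega>) 1) (\<lambda>j. x j \<omega>)"
proof -
  have "{#x j \<omega>. j \<in># mset_set {..<n}#} = (\<Sum>j<n. {#x j \<omega>#})" for n
    by (induction n) (auto simp: lessThan_Suc)
  then show ?thesis by (simp add: points_def marked_points_def)
qed

lemma size_points_in: "size {#y \<in># points \<omega>. y \<in> B#} = card {j. j < K \<omega> \<and> x j \<omega> \<in> B}"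
proof -
  have "size {#y \<in># points \<omega>. y \<in> B#} = card {j \<in> {..<K \<omega>}. x j \<omega> \<in> B}"
    by (simp add: points_def filter_mset_image_mset filter_mset_mset_set)
  then show ?thesis by simp
qed

lemma stationary_poisson_process_points: "stationary_poisson_process MP lam points"
  unfolding stationary_poisson_process_def size_points_in
proof (intro conjI allI ballI impI)
  have [measurable]: "(\<lambda>\<omega>. replicate (K \<omega>) (1 :: nat)) \<in> MP \<rightarrow>\<^sub>M count_space UNIV"
    by (rule measurable_compose[OF measurable_K]) simp
  have "(\<lambda>\<omega>. marked_points (replicate (K \<omega>) 1) (\<lambda>j. x j \<omega>)) \<in> MP \<rightarrow>\<^sub>M borel_of_topology vague_topology"
    by (intro measurable_marked_points) auto
  then show "points \<in> MP \<rightarrow>\<^sub>M borel_of_topology vague_topology"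
    using points_eq_marked_points by presburger
next
  fix B :: "real set" and m
  assume B: "B \<in> sets borel" "B \<subseteq> {0..1}"
  show "\<P>(\<omega> in MP. card {j. j < K \<omega> \<and> x j \<omega> \<in> B} = m) =
      (lam * measure lborel B) ^ m / fact m * exp (- (lam * measure lborel B))"
    using prob_point_counts[of "{()}" "\<lambda>_. B" "\<lambda>_. m"] B by (simp add: disjoint_family_on_def)
next
  fix r :: nat and B :: "nat \<Rightarrow> real set"
  assume B: "(\<forall>i<r. B i \<in> sets borel \<and> B i \<subseteq> {0..1}) \<and> disjoint_family_on B {..<r}"
  show "indep_vars (\<lambda>_. count_space UNIV) (\<lambda>i \<omega>. card {j. j < K \<omega> \<and> x j \<omega> \<in> B i}) {..<r}"
  proof (rule indep_vars_countableI)
    fix i assume "i \<in> {..<r}"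
    then show "(\<lambda>\<omega>. card {j. j < K \<omega> \<and> x j \<omega> \<in> B i}) \<in> MP \<rightarrow>\<^sub>M count_space UNIV"
      using B by (intro measurable_card_points) auto
  next
    fix J and k :: "nat \<Rightarrow> nat" assume J: "J \<subseteq> {..<r}" "finite J" "J \<noteq> {}"
    have one: "prob {\<omega>. card {j. j < K \<omega> \<and> x j \<omega> \<in> B i} = k i} =
        (lam * measure lborel (B i)) ^ k i / fact (k i) * exp (- (lam * measure lborel (B i)))" if "i \<in> J" for i
      using prob_point_counts[of "{i}" B k] B J that by (auto simp: disjoint_family_on_def)
    have "prob {\<omega>. \<forall>i\<in>J. card {j. j < K \<omega> \<and> x j \<omega> \<in> B i} = k i} =
       (\<Prod>i\<in>J. (lam * measure lborel (B i)) ^ k i / fact (k i) * exp (- (lam * measure lborel (B i))))"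
      using B J disjoint_family_on_mono[OF J(1)] by (intro prob_point_counts) auto
    then show "prob {\<omega> \<in> space MP. \<forall>i\<in>J. card {j. j < K \<omega> \<and> x j \<omega> \<in> B i} = k i} =
        (\<Prod>i\<in>J. prob {\<omega> \<in> space MP. card {j. j < K \<omega> \<and> x j \<omega> \<in> B i} = k i})"
      using one by simp
  qed
qed

lemma prob_marks: 
  assumes "finite J"
  shows "prob {\<omega>. \<forall>j\<in>J. \<nu> j \<omega> \<in> D j} = (\<Prod>j\<in>J. measure_pmf.prob P (D j))"
proof -
  have "prob {\<omega>. K \<omega> \<in> UNIV \<and> (\<forall>j\<in>J. x j \<omega> \<in> {0..1} \<and> \<nu> j \<omega> \<in> D j)} =
    measure_pmf.prob (poisson_pmf lam) UNIV * (\<Prod>j\<in>J. measure lborel {0..1::real} * measure_pmf.prob P (D j))"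
    using assms by (intro prob_box) auto
  then show ?thesis by simp
qed

lemma prob_mark: "prob {\<omega>. \<nu> j \<omega> = i} = pmf P i"
  using prob_marks[of "{j}" "\<lambda>_. {i}"] by (simp add: measure_pmf_single)

lemma indep_vars_marks: "indep_vars (\<lambda>_. count_space UNIV) \<nu> UNIV"
proof (rule indep_vars_countableI)
  fix J :: "nat set" and k :: "nat \<Rightarrow> nat" assume J: "J \<subseteq> UNIV" "finite J" "J \<noteq> {}"
  show "prob {\<omega> \<in> space MP. \<forall>i\<in>J. \<nu> i \<omega> = k i} = (\<Prod>i\<in>J. prob {\<omega> \<in> space MP. \<nu> i \<omega> = k i})"
    using prob_marks[OF J(2), of "\<lambda>j. {k j}"] by (simp add: measure_pmf_single prob_mark)
qed auto

lemma indep_marks_points: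
  "indep_rvs MP (\<Pi>\<^sub>M j\<in>UNIV. count_space UNIV) (\<lambda>\<omega> j. \<nu> j \<omega>)
     (count_space UNIV \<Otimes>\<^sub>M (\<Pi>\<^sub>M j\<in>UNIV. borel)) (\<lambda>\<omega>. (K \<omega>, \<lambda>j. x j \<omega>))"
  unfolding indep_rvs_def
proof (intro conjI)
  let ?Y = "\<lambda>\<omega> j. \<nu> j \<omega>" and ?Z = "\<lambda>\<omega>. (K \<omega>, \<lambda>j. x j \<omega>)"
  let ?A = "PiM UNIV (\<lambda>_::nat. count_space (UNIV :: nat set))"
  let ?B = "count_space (UNIV :: nat set) \<Otimes>\<^sub>M PiM UNIV (\<lambda>_::nat. borel :: real measure)"
  show Y: "?Y \<in> MP \<rightarrow>\<^sub>M ?A"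
    by (rule measurable_PiM_single') auto
  show Z: "?Z \<in> MP \<rightarrow>\<^sub>M ?B"
    by (intro measurable_Pair measurable_K measurable_PiM_single') auto
  \<comment> \<open>For a fixed number k of points the section of the event is a rectangle in
    positions and marks, so its measure factorizes under the integral over k. Taking one of S and T
    to be the whole space then identifies the two factors as the marginals.\<close>
  have fub: "emeasure MP (?Y -` S \<inter> ?Z -` T) =
      (\<integral>\<^sup>+k. emeasure Mx {y. (k, \<lambda>j. clip (y j)) \<in> T} \<partial>Mk) * emeasure Mv S"
    if S: "S \<in> sets ?A" and T: "T \<in> sets ?B" for S T
  proof -
    have S': "S \<in> sets Mv" using S unfolding sets_Mv .
    have T': "{y. (k, \<lambda>j. clip (y j)) \<in> T} \<in> sets Mx" for k
    proof -
      have "(\<lambda>y. y j) \<in> borel_measurable Mx" for j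
        using measurable_cong_sets[OF sets_Mx refl] by (metis UNIV_I measurable_component_singleton)
      then have "(\<lambda>y. clip (y j)) \<in> borel_measurable Mx" for j
        by (rule measurable_compose) measurable
      then have "(\<lambda>y. (k, \<lambda>j. clip (y j))) \<in> Mx \<rightarrow>\<^sub>M ?B"
        by (intro measurable_Pair measurable_PiM_single') auto
      from measurable_sets[OF this T] show ?thesis by (simp add: vimage_def space_PiM)
    qed
    have "?Y -` S \<inter> space MP \<in> sets MP" "?Z -` T \<inter> space MP \<in> sets MP"
      by (rule measurable_sets[OF Y S], rule measurable_sets[OF Z T])
    then have "?Y -` S \<inter> ?Z -` T \<in> sets (Mk \<Otimes>\<^sub>M (Mx \<Otimes>\<^sub>M Mv))"
      unfolding MP_def[symmetric] by auto
    then have "emeasure MP (?Y -` S \<inter> ?Z -` T) =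
        (\<integral>\<^sup>+k. emeasure (Mx \<Otimes>\<^sub>M Mv) (Pair k -` (?Y -` S \<inter> ?Z -` T)) \<partial>Mk)"
      unfolding MP_def by (rule sigma_finite_measure.emeasure_pair_measure_alt[OF sigma_finite_xv])
    also have "(\<lambda>k. Pair k -` (?Y -` S \<inter> ?Z -` T)) = (\<lambda>k. {y. (k, \<lambda>j. clip (y j)) \<in> T} \<times> S)"
      by (auto simp: \<nu>_def K_def x_def)
    also have "(\<integral>\<^sup>+k. emeasure (Mx \<Otimes>\<^sub>M Mv) ({y. (k, \<lambda>j. clip (y j)) \<in> T} \<times> S) \<partial>Mk) =
        (\<integral>\<^sup>+k. emeasure Mx {y. (k, \<lambda>j. clip (y j)) \<in> T} * emeasure Mv S \<partial>Mk)"
      by (intro nn_integral_cong sigma_finite_measure.emeasure_pair_measure_Times[OF sigma_finite_Mv] T' S')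
    finally show ?thesis by (simp add: nn_integral_multc)
  qed
  have one: "emeasure Mx UNIV = 1" "emeasure Mv UNIV = 1"
    using Mx.emeasure_space_1 Mv.emeasure_space_1 by (simp_all add: space_PiM)
  show "indep_set {?Y -` S \<inter> space MP | S. S \<in> sets ?A} {?Z -` S \<inter> space MP | S. S \<in> sets ?B}"
  proof (rule indep_setI; safe?)
    show "?Y -` S \<inter> space MP \<in> events" if "S \<in> sets ?A" for S by (rule measurable_sets[OF Y that])
    show "?Z -` S \<inter> space MP \<in> events" if "S \<in> sets ?B" for S by (rule measurable_sets[OF Z that])
    fix S T assume S: "S \<in> sets ?A" and T: "T \<in> sets ?B"
    have "emeasure MP (?Y -` S) = emeasure Mv S"
      using fub[OF S sets.top] by (simp add: one space_pair_measure space_PiM)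
    moreover have "emeasure MP (?Z -` T) = (\<integral>\<^sup>+k. emeasure Mx {y. (k, \<lambda>j. clip (y j)) \<in> T} \<partial>Mk)"
      using fub[OF sets.top T] by (simp add: one space_PiM)
    ultimately show "prob ((?Y -` S \<inter> space MP) \<inter> (?Z -` T \<inter> space MP)) =
        prob (?Y -` S \<inter> space MP) * prob (?Z -` T \<inter> space MP)"
      using fub[OF S T] by (simp add: measure_def enn2real_mult mult.commute)
  qed
qed

definition N :: "nat \<times> (nat \<Rightarrow> real) \<times> (nat \<Rightarrow> nat) \<Rightarrow> real multiset" where
  "N \<omega> = (\<Sum>j<K \<omega>. replicate_mset (\<nu> j \<omega>) (x j \<omega>))"

lemma compound_poisson_process_N:
  assumes "\<And>i. i \<ge> 1 \<Longrightarrow> \<pi> i = pmf P i"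
  shows "compound_poisson_process MP lam \<pi> N"
  unfolding compound_poisson_process_def
  using stationary_poisson_process_points indep_vars_marks indep_marks_points P0 assms
  by (intro exI[of _ K] exI[of _ x] exI[of _ \<nu>]) (simp add: prob_mark N_def points_def[abs_def])

section \<open>Discretization of the compound Poisson process to m blocks\<close>

definition coarse :: "nat \<Rightarrow> real \<Rightarrow> real" where
  "coarse m y = of_int \<lfloor>real m * y\<rfloor> / real m"

definition block_config :: "nat \<Rightarrow> (nat \<Rightarrow> nat) \<Rightarrow> real multiset" where
  "block_config m C = (\<Sum>a<m. replicate_mset (C a) (real a / real m))"

text \<open>
  The probability of \<open>config_event m C\<close>: every block contains at most one point of the Poisson
  process, and block a carries total mass C a.
\<close>

definition weight :: "nat \<Rightarrow> (nat \<Rightarrow> nat) \<Rightarrow> real" where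
  "weight m C = exp (- lam) * (\<Prod>a<m. if C a = 0 then 1 else lam / real m * pmf P (C a))"

text \<open>The bound L makes the set finite, the bound Q is the one required by
  \<open>vague_uniformly_continuous\<close>. Being extensional, a configuration is determined by its
  values on the m blocks.\<close>

definition configs :: "nat \<Rightarrow> nat \<Rightarrow> nat \<Rightarrow> (nat \<Rightarrow> nat) set" where
  "configs m L Q = {C \<in> {..<m} \<rightarrow>\<^sub>E {..L}. sum C {..<m} \<le> Q}"

definition coarse_N :: "nat \<Rightarrow> nat \<times> (nat \<Rightarrow> real) \<times> (nat \<Rightarrow> nat) \<Rightarrow> real multiset" where
  "coarse_N m \<omega> = marked_points (map (\<lambda>j. \<nu> j \<omega>) [0..<K \<omega>]) (\<lambda>j. coarse m (x j \<omega>))"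

text \<open>Written in the form of \<open>prob_marked_cluster_pattern\<close>, with the occupied
  blocks as classes. The cells are half open, hence disjoint.\<close>

definition config_event :: "nat \<Rightarrow> (nat \<Rightarrow> nat) \<Rightarrow> (nat \<times> (nat \<Rightarrow> real) \<times> (nat \<Rightarrow> nat)) set" where
  "config_event m C = (let S = mset_set {a. a < m \<and> C a \<noteq> 0} in
     {\<omega>. K \<omega> = size S \<and> (\<exists>cs\<in>permutations_of_multiset S. \<forall>j<size S.
        x j \<omega> \<in> {real (cs ! j) / real m..<(real (cs ! j) + 1) / real m} \<and> \<nu> j \<omega> \<in> {C (cs ! j)})})"

lemma coarse_mem: "y \<in> {0..1} \<Longrightarrow> coarse m y \<in> {0..1}"
proof -
  assume y: "y \<in> {0..1}"
  have "of_int \<lfloor>real m * y\<rfloor> \<le> real m * y" "real m * y \<le> real m * 1"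
    using y mult_left_mono[of y 1 "real m"] by simp_all
  then have "of_int \<lfloor>real m * y\<rfloor> \<le> real m" by linarith
  with y show ?thesis by (auto simp: coarse_def divide_simps)
qed

lemma coarse_close:
  assumes "m > 0" shows "\<bar>coarse m y - y\<bar> \<le> 1 / real m"
proof -
  have "of_int \<lfloor>real m * y\<rfloor> \<le> real m * y" "real m * y \<le> of_int \<lfloor>real m * y\<rfloor> + 1" by linarith+
  then have "\<bar>of_int \<lfloor>real m * y\<rfloor> - real m * y\<bar> \<le> 1" by linarith
  then have "\<bar>of_int \<lfloor>real m * y\<rfloor> - real m * y\<bar> / real m \<le> 1 / real m"
    using assms by (intro divide_right_mono) auto
  also have "\<bar>of_int \<lfloor>real m * y\<rfloor> - real m * y\<bar> / real m = \<bar>(of_int \<lfloor>real m * y\<rfloor> - real m * y) / real m\<bar>"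
    using assms by simp
  also have "(of_int \<lfloor>real m * y\<rfloor> - real m * y) / real m = coarse m y - y"
    using assms by (simp add: coarse_def diff_divide_distrib)
  finally show ?thesis .
qed

lemma coarse_eq:
  assumes "m > 0" "y \<in> {real a / real m..<(real a + 1) / real m}"
  shows "coarse m y = real a / real m"
proof -
  have "real a \<le> real m * y" "real m * y < real a + 1"
    using assms by (auto simp: field_simps)
  then have "\<lfloor>real m * y\<rfloor> = int a" by (intro floor_unique) auto
  then show ?thesis by (simp add: coarse_def)
qed

text \<open>Each occupied block is a class with count one and a cell of length 1 / m, so the
  factorials in \<open>prob_marked_cluster_pattern\<close> are all 1; empty blocks contribute the
  factor 1 in \<open>weight\<close>.\<close>

lemma config_event:
  assumes "m > 0"
  shows "prob (config_event m C) = weight m C" "config_event m C \<in> events"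
    and "\<omega> \<in> config_event m C \<Longrightarrow> coarse_N m \<omega> = block_config m C"
proof -
  let ?T = "{a. a < m \<and> C a \<noteq> 0}"
  let ?S = "mset_set ?T"
  let ?A = "\<lambda>a. {real a / real m..<(real a + 1) / real m}"
  have fin: "finite ?T" by auto
  have A1: "?A a \<in> sets borel" for a by simp
  have A2: "?A a \<subseteq> {0..1}" if "a \<in># ?S" for a
  proof -
    have "real a + 1 \<le> real m" using that by (simp add: fin)
    then have "(real a + 1) / real m \<le> 1" using assms by simp
    moreover have "0 \<le> y" if "real a / real m \<le> y" for y
      by (rule order_trans[OF _ that]) simp
    ultimately show ?thesis by auto
  qed
  have inj: "a = b" if "y \<in> ?A a" "y \<in> ?A b" for y a b
    using coarse_eq[OF assms that(1)] coarse_eq[OF assms that(2)] assms by simp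
  have A3: "disjoint_family_on ?A (set_mset ?S)"
    unfolding disjoint_family_on_def
  proof (intro ballI impI)
    fix a b :: nat assume "a \<noteq> b"
    with inj show "?A a \<inter> ?A b = {}" by blast
  qed
  note pat = prob_marked_cluster_pattern[of ?S ?A, OF A1 A2 A3, where D="\<lambda>a. {C a}"]
  have ev: "config_event m C = {\<omega>. K \<omega> = size ?S \<and> (\<exists>cs\<in>permutations_of_multiset ?S. \<forall>j<size ?S.
        x j \<omega> \<in> ?A (cs ! j) \<and> \<nu> j \<omega> \<in> {C (cs ! j)})}"
    by (simp add: config_event_def Let_def)
  show "config_event m C \<in> events" unfolding ev by (rule pat(2))
  have "prob (config_event m C) = exp (- lam) * (\<Prod>a\<in>?T. lam / real m * pmf P (C a))"
  proof -
    have "(lam * (measure lborel (?A a) * measure P {C a})) ^ count ?S a / fact (count ?S a)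
        = lam / real m * pmf P (C a)" if "a \<in> ?T" for a
      using that fin assms by (simp add: measure_pmf_single add_divide_distrib)
    then have "(\<Prod>a\<in>set_mset ?S. (lam * (measure lborel (?A a) * measure P {C a})) ^ count ?S a / fact (count ?S a)) =
        (\<Prod>a\<in>?T. lam / real m * pmf P (C a))"
      using fin by (intro prod.cong) (simp_all only: finite_set_mset_mset_set)
    moreover have "prob (config_event m C) = exp (- lam) * (\<Prod>a\<in>set_mset ?S.
        (lam * (measure lborel (?A a) * measure P {C a})) ^ count ?S a / fact (count ?S a))"
      unfolding ev by (rule pat(1))
    ultimately show ?thesis by (simp only:)
  qed
  also have "(\<Prod>a\<in>?T. lam / real m * pmf P (C a)) = (\<Prod>a<m. if C a = 0 then 1 else lam / real m * pmf P (C a))"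
    by (intro prod.mono_neutral_cong_left) auto
  finally show "prob (config_event m C) = weight m C" by (simp add: weight_def)
  assume "\<omega> \<in> config_event m C"
  then obtain cs where cs: "K \<omega> = size ?S" "mset cs = ?S"
      "\<And>j. j < size ?S \<Longrightarrow> x j \<omega> \<in> ?A (cs ! j)" "\<And>j. j < size ?S \<Longrightarrow> \<nu> j \<omega> = C (cs ! j)"
    unfolding ev permutations_of_multiset_def by blast
  have len: "size ?S = length cs" using cs(2) by (metis size_mset)
  have "coarse_N m \<omega> = (\<Sum>j<length cs. replicate_mset (\<nu> j \<omega>) (coarse m (x j \<omega>)))"
    using cs(1) len by (simp add: coarse_N_def marked_points_def)
  also have "\<dots> = (\<Sum>j<length cs. replicate_mset (C (cs ! j)) (real (cs ! j) / real m))"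
  proof (intro sum.cong refl)
    fix j assume "j \<in> {..<length cs}"
    then have j: "j < size ?S" using len by simp
    show "replicate_mset (\<nu> j \<omega>) (coarse m (x j \<omega>)) = replicate_mset (C (cs ! j)) (real (cs ! j) / real m)"
      using coarse_eq[OF assms cs(3)[OF j]] cs(4)[OF j] by simp
  qed
  also have "\<dots> = (\<Sum>a\<in>#mset cs. replicate_mset (C a) (real a / real m))"
    by (induction cs rule: rev_induct) (auto simp: nth_append)
  also have "\<dots> = (\<Sum>a\<in>?T. replicate_mset (C a) (real a / real m))"
    by (simp add: cs(2) sum_unfold_sum_mset)
  also have "\<dots> = block_config m C"
    unfolding block_config_def by (intro sum.mono_neutral_left) auto
  finally show "coarse_N m \<omega> = block_config m C" .
qed

lemma count_block_config:
  assumes "a < m" shows "count (block_config m C) (real a / real m) = C a"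
proof -
  have "count (block_config m C) (real a / real m) = (\<Sum>b<m. if b = a then C b else 0)"
    unfolding block_config_def count_sum using assms by (intro sum.cong) auto
  then show ?thesis using assms by simp
qed

lemma size_block_config: "size (block_config m C) = sum C {..<m}"
  by (simp add: block_config_def size_mset_sum)

text \<open>The coarsened process determines C through its multiplicities at the points a /
  m.\<close>

lemma disjoint_config_event:
  assumes "m > 0" "B \<subseteq> {..<m} \<rightarrow>\<^sub>E {..L}"
  shows "disjoint_family_on (config_event m) B"
  unfolding disjoint_family_on_def
proof (intro ballI impI)
  fix C C' assume C: "C \<in> B" "C' \<in> B" "C \<noteq> C'"
  have False if "\<omega> \<in> config_event m C" "\<omega> \<in> config_event m C'" for \<omega>
  proof -
    have "block_config m C = block_config m C'"
      using config_event(3)[OF assms(1)] that by metis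
    then have "C a = C' a" if "a < m" for a using count_block_config[OF that] by metis
    then have "C = C'" using C assms(2) by (intro PiE_ext[of C "{..<m}" "\<lambda>_. {..L}" C']) auto
    with C show False by simp
  qed
  then show "config_event m C \<inter> config_event m C' = {}" by blast
qed

lemma N_eq_marked_points: "N \<omega> = marked_points (map (\<lambda>j. \<nu> j \<omega>) [0..<K \<omega>]) (\<lambda>j. x j \<omega>)"
  by (simp add: N_def marked_points_def)

lemma measurable_marks: "(\<lambda>\<omega>. map (\<lambda>j. \<nu> j \<omega>) [0..<K \<omega>]) \<in> MP \<rightarrow>\<^sub>M count_space UNIV"
proof (rule measurable_compose_countable[OF _ measurable_K])
  fix k show "(\<lambda>\<omega>. map (\<lambda>j. \<nu> j \<omega>) [0..<k]) \<in> MP \<rightarrow>\<^sub>M count_space UNIV"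
  proof (induction k)
    case (Suc k)
    have "(\<lambda>\<omega>. (\<lambda>p. fst p @ [snd p]) (map (\<lambda>j. \<nu> j \<omega>) [0..<k], \<nu> k \<omega>)) \<in> MP \<rightarrow>\<^sub>M count_space UNIV"
      using Suc measurable_\<nu>[of k]
      by (intro measurable_compose[OF measurable_Pair[of _ MP "count_space UNIV" _ "count_space UNIV"]])
         (auto simp: pair_measure_countable)
    then show ?case by simp
  qed simp
qed

lemma measurable_N: "N \<in> MP \<rightarrow>\<^sub>M borel_of_topology vague_topology"
proof -
  have "(\<lambda>\<omega>. marked_points (map (\<lambda>j. \<nu> j \<omega>) [0..<K \<omega>]) (\<lambda>j. x j \<omega>)) \<in> MP \<rightarrow>\<^sub>M borel_of_topology vague_topology"
    by (intro measurable_marked_points measurable_marks) auto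
  then show ?thesis using N_eq_marked_points by presburger
qed

lemma measurable_coarse_N: "coarse_N m \<in> MP \<rightarrow>\<^sub>M borel_of_topology vague_topology"
proof -
  have "coarse m \<in> borel_measurable borel" unfolding coarse_def[abs_def] by measurable
  then have "(\<lambda>\<omega>. coarse m (x j \<omega>)) \<in> borel_measurable MP" for j
    by (rule measurable_compose[OF measurable_x])
  then have "(\<lambda>\<omega>. marked_points (map (\<lambda>j. \<nu> j \<omega>) [0..<K \<omega>]) (\<lambda>j. coarse m (x j \<omega>))) \<in> MP \<rightarrow>\<^sub>M borel_of_topology vague_topology"
    using coarse_mem by (intro measurable_marked_points measurable_marks) auto
  then show ?thesis unfolding coarse_N_def[abs_def] .
qed

lemma size_coarse_N: "size (coarse_N m \<omega>) = (\<Sum>j<K \<omega>. \<nu> j \<omega>)"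
  by (simp add: coarse_N_def marked_points_def size_mset_sum)

lemma configs_subset: "configs m L Q \<subseteq> {..<m} \<rightarrow>\<^sub>E {..L}" "finite (configs m L Q)"
proof -
  show "configs m L Q \<subseteq> {..<m} \<rightarrow>\<^sub>E {..L}" by (auto simp: configs_def)
  then show "finite (configs m L Q)" by (rule finite_subset) (simp add: finite_PiE)
qed

lemma point_measures_coarse_N: "coarse_N m \<omega> \<in> point_measures"
  using measurable_space[OF measurable_coarse_N, of \<omega>] by simp

lemma point_measures_N: "N \<omega> \<in> point_measures"
  using measurable_space[OF measurable_N, of \<omega>] by simp

text \<open>On the configuration events the value of F is known; on the rest F is at most 1, which
  costs the missing mass.\<close>

lemma integral_coarse_N_le:
  assumes m: "m > 0" and F: "continuous_map vague_topology euclideanreal F" "\<And>Y. Y \<in> point_measures \<Longrightarrow> F Y \<in> {0..1}"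
  shows "(\<integral>\<omega>. F (coarse_N m \<omega>) \<partial>MP) \<le>
    (\<Sum>C\<in>configs m L Q. weight m C * F (block_config m C)) + (1 - (\<Sum>C\<in>configs m L Q. weight m C))"
proof -
  let ?R = "\<lambda>\<omega>. (\<Sum>C\<in>configs m L Q. indicator (config_event m C) \<omega> * F (block_config m C)) +
      (1 - (\<Sum>C\<in>configs m L Q. indicator (config_event m C) \<omega> :: real))"
  have int: "integrable MP (indicator (config_event m C) :: _ \<Rightarrow> real)" for C
    by (intro integrable_real_indicator config_event m) (simp add: emeasure_eq_measure)
  have F_int: "integrable MP (\<lambda>\<omega>. F (coarse_N m \<omega>))"
  proof (rule integrable_const_bound[of _ 1])
    show "(\<lambda>\<omega>. F (coarse_N m \<omega>)) \<in> borel_measurable MP"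
      by (rule measurable_compose[OF measurable_coarse_N continuous_map_measurable_borel_of_topology[OF F(1)]])
  qed (use F(2)[OF point_measures_coarse_N] in auto)
  have "(\<integral>\<omega>. F (coarse_N m \<omega>) \<partial>MP) \<le> (\<integral>\<omega>. ?R \<omega> \<partial>MP)"
  proof (rule integral_mono[OF F_int])
    show "integrable MP ?R" using int by auto
    fix \<omega>
    show "F (coarse_N m \<omega>) \<le> ?R \<omega>"
    proof (cases "\<exists>C\<in>configs m L Q. \<omega> \<in> config_event m C")
      case True
      then obtain C where C: "C \<in> configs m L Q" "\<omega> \<in> config_event m C" by blast
      have ind: "indicator (config_event m C') \<omega> = (if C' = C then 1 else 0 :: real)" if "C' \<in> configs m L Q" for C'
        using disjoint_config_event[OF m configs_subset(1)[of m L Q]] C that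
        by (auto simp: disjoint_family_on_def indicator_def)
      have "?R \<omega> = F (block_config m C)"
        using C(1) configs_subset(2) by (simp add: ind cong: sum.cong)
           (simp add: if_distrib[of "\<lambda>z. z * _"] sum.delta cong: if_cong)
      then show ?thesis using config_event(3)[OF m C(2)] by simp
    next
      case False
      then have "indicator (config_event m C') \<omega> = (0 :: real)" if "C' \<in> configs m L Q" for C'
        using that by (auto simp: indicator_def)
      then show ?thesis using F(2)[OF point_measures_coarse_N, of m \<omega>] by simp
    qed
  qed
  also have "\<dots> = (\<Sum>C\<in>configs m L Q. weight m C * F (block_config m C)) + (1 - (\<Sum>C\<in>configs m L Q. weight m C))"
    using int config_event(1,2)[OF m] prob_space by simp
  finally show ?thesis .
qed

text \<open>Over all C with values up to L the sum of the products is the product of the sums over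
  single blocks. The configurations removed by the bound Q correspond to disjoint events on which
  the total mass exceeds Q.\<close>

lemma sum_weight_ge:
  assumes m: "m > 0"
  shows "(\<Sum>C\<in>configs m L Q. weight m C) \<ge>
    exp (- lam) * (1 + lam * measure P {1..L} / real m) ^ m - prob {\<omega>. (\<Sum>j<K \<omega>. \<nu> j \<omega>) > Q}"
proof -
  let ?All = "{..<m} \<rightarrow>\<^sub>E {..L}"
  let ?big = "?All - configs m L Q"
  have fin: "finite ?All" by (simp add: finite_PiE)
  have "(\<Sum>C\<in>?All. weight m C) = exp (- lam) * (\<Prod>a<m. \<Sum>c\<le>L. if c = 0 then 1 else lam / real m * pmf P c)"
    unfolding weight_def sum_distrib_left[symmetric] by (subst prod_sum_PiE) auto
  also have "(\<Sum>c\<le>L. if c = 0 then 1 else lam / real m * pmf P c) = 1 + lam * measure P {1..L} / real m"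
  proof -
    have "{..L} = insert 0 {1..L}" by auto
    then have "(\<Sum>c\<le>L. if c = 0 then 1 else lam / real m * pmf P c) = 1 + (\<Sum>c\<in>{1..L}. lam / real m * pmf P c)"
      by (simp add: sum.insert_remove)
    also have "(\<Sum>c\<in>{1..L}. lam / real m * pmf P c) = lam / real m * measure P {1..L}"
      by (simp add: measure_measure_pmf_finite sum_distrib_left)
    finally show ?thesis by simp
  qed
  finally have all: "(\<Sum>C\<in>?All. weight m C) = exp (- lam) * (1 + lam * measure P {1..L} / real m) ^ m" by simp
  have meas: "{\<omega>. (\<Sum>j<K \<omega>. \<nu> j \<omega>) > Q} \<in> events"
  proof -
    have "(\<lambda>\<omega>. sum_list (map (\<lambda>j. \<nu> j \<omega>) [0..<K \<omega>])) \<in> MP \<rightarrow>\<^sub>M count_space UNIV"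
      by (rule measurable_compose[OF measurable_marks]) simp
    from measurable_sets[OF this, of "{Q<..}"] show ?thesis
      by (simp add: vimage_def interv_sum_list_conv_sum_set_nat atLeast0LessThan)
  qed
  have "(\<Sum>C\<in>?big. weight m C) = prob (\<Union>C\<in>?big. config_event m C)"
    using config_event(1,2)[OF m] fin disjoint_config_event[OF m, of ?big L]
    by (subst finite_measure_finite_Union) auto
  also have "\<dots> \<le> prob {\<omega>. (\<Sum>j<K \<omega>. \<nu> j \<omega>) > Q}"
  proof (rule finite_measure_mono[OF _ meas])
    show "(\<Union>C\<in>?big. config_event m C) \<subseteq> {\<omega>. (\<Sum>j<K \<omega>. \<nu> j \<omega>) > Q}"
    proof safe
      fix C \<omega> assume C: "C \<in> ?All" "C \<notin> configs m L Q" "\<omega> \<in> config_event m C"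
      then have "sum C {..<m} > Q" by (auto simp: configs_def)
      then show "Q < (\<Sum>j<K \<omega>. \<nu> j \<omega>)"
        using config_event(3)[OF m C(3)] size_block_config[of m C] size_coarse_N[of m \<omega>] by simp
    qed
  qed
  finally have "(\<Sum>C\<in>?big. weight m C) \<le> prob {\<omega>. (\<Sum>j<K \<omega>. \<nu> j \<omega>) > Q}" .
  moreover have "(\<Sum>C\<in>?All. weight m C) = (\<Sum>C\<in>?big. weight m C) + (\<Sum>C\<in>configs m L Q. weight m C)"
    using fin configs_subset(1) by (rule sum.subset_diff[rotated])
  ultimately show ?thesis using all by linarith
qed

text \<open>For a fixed outcome the multiplicities stay the same and each position moves by at most
  1 / m, so F converges along the outcome; it is bounded by 1, which permits dominated
  convergence.\<close>

lemma coarse_N_converges: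
  assumes F: "continuous_map vague_topology euclideanreal F" "\<And>Y. Y \<in> point_measures \<Longrightarrow> F Y \<in> {0..1}"
  shows "(\<lambda>m. \<integral>\<omega>. F (coarse_N m \<omega>) \<partial>MP) \<longlonglongrightarrow> (\<integral>\<omega>. F (N \<omega>) \<partial>MP)"
proof (rule integral_dominated_convergence[where w="\<lambda>_. 1"])
  note mF = continuous_map_measurable_borel_of_topology[OF F(1)]
  show "(\<lambda>\<omega>. F (N \<omega>)) \<in> borel_measurable MP" by (rule measurable_compose[OF measurable_N mF])
  show "(\<lambda>\<omega>. F (coarse_N m \<omega>)) \<in> borel_measurable MP" for m
    by (rule measurable_compose[OF measurable_coarse_N mF])
  show "AE \<omega> in MP. norm (F (coarse_N m \<omega>)) \<le> 1" for m
    using F(2)[OF point_measures_coarse_N] by auto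
  show "AE \<omega> in MP. (\<lambda>m. F (coarse_N m \<omega>)) \<longlonglongrightarrow> F (N \<omega>)"
  proof (intro AE_I2)
    fix \<omega>
    let ?z = "\<lambda>m j. coarse m (x j \<omega>)"
    have "(\<lambda>m. dist (?z m) (\<lambda>j. x j \<omega>)) \<longlonglongrightarrow> 0"
    proof (rule tendsto_sandwich[of "\<lambda>_. 0" _ _ "\<lambda>m. 2 * (1 / real m)"])
      show "\<forall>\<^sub>F m in sequentially. dist (?z m) (\<lambda>j. x j \<omega>) \<le> 2 * (1 / real m)"
        using eventually_gt_at_top[of 0] by eventually_elim (intro dist_fun_le coarse_close)
      show "(\<lambda>m. 2 * (1 / real m)) \<longlonglongrightarrow> 0" by real_asymp
    qed auto
    then have "?z \<longlonglongrightarrow> (\<lambda>j. x j \<omega>)" using tendsto_dist_iff by blast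
    moreover have "?z m \<in> unit_seqs" for m using coarse_mem[of "x _ \<omega>"] by (auto simp: unit_seqs_def simp del: atLeastAtMost_iff) auto
    moreover have "(\<lambda>j. x j \<omega>) \<in> unit_seqs" by (auto simp: unit_seqs_def)
    ultimately show "(\<lambda>m. F (coarse_N m \<omega>)) \<longlonglongrightarrow> F (N \<omega>)"
      unfolding coarse_N_def N_eq_marked_points
      by (intro continuous_on_tendsto_compose[OF continuous_on_vague_marked_points[OF F(1)]]) auto
  qed
qed auto

lemma tail_total: "(\<lambda>Q. prob {\<omega>. (\<Sum>j<K \<omega>. \<nu> j \<omega>) > Q}) \<longlonglongrightarrow> 0"
proof -
  have "{\<omega>. (\<Sum>j<K \<omega>. \<nu> j \<omega>) > Q} \<in> events" for Q
  proof -
    have "(\<lambda>\<omega>. sum_list (map (\<lambda>j. \<nu> j \<omega>) [0..<K \<omega>])) \<in> MP \<rightarrow>\<^sub>M count_space UNIV"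
      by (rule measurable_compose[OF measurable_marks]) simp
    from measurable_sets[OF this, of "{Q<..}"] show ?thesis
      by (simp add: vimage_def interv_sum_list_conv_sum_set_nat atLeast0LessThan)
  qed
  moreover have "decseq (\<lambda>Q. {\<omega>. (\<Sum>j<K \<omega>. \<nu> j \<omega>) > Q})" by (auto simp: decseq_def)
  moreover have "(\<Inter>Q. {\<omega>. (\<Sum>j<K \<omega>. \<nu> j \<omega>) > Q}) = {}" by auto
  ultimately show ?thesis
    using finite_Lim_measure_decseq[of "\<lambda>Q. {\<omega>. (\<Sum>j<K \<omega>. \<nu> j \<omega>) > Q}"] by (simp add: image_subset_iff)
qed

text \<open>The total weight tends to exp(-lam (1 - P{1..L})) up to the tail of the total mass. The
  first is close to 1 for large L, the second is small for large Q, and neither choice depends on m.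
  A quarter of \<epsilon> each pays for L together with the limit in m, for Q, and for the
  discretization.\<close>

lemma integral_N_le:
  assumes F: "continuous_map vague_topology euclideanreal F" "\<And>Y. Y \<in> point_measures \<Longrightarrow> F Y \<in> {0..1}"
    and "\<epsilon> > 0"
  shows "\<exists>L Q. \<forall>\<^sub>F m in sequentially.
    (\<integral>\<omega>. F (N \<omega>) \<partial>MP) \<le> (\<Sum>C\<in>configs m L Q. weight m C * F (block_config m C)) + \<epsilon>"
proof -
  have "(\<lambda>L. measure P {..L}) \<longlonglongrightarrow> measure P (\<Union>L. {..L})"
    by (intro measure_pmf.finite_Lim_measure_incseq) (auto simp: incseq_def)
  moreover have "(\<Union>L::nat. {..L}) = UNIV" by auto
  moreover have "measure P {..L} = measure P {1..L}" for L
  proof -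
    have "measure P {..L} = measure P ({0} \<union> {1..L})" by (intro arg_cong2[where f=measure]) auto
    also have "\<dots> = measure P {0} + measure P {1..L}" by (intro measure_pmf.finite_measure_Union) auto
    finally show ?thesis using P0 by (simp add: measure_pmf_single)
  qed
  ultimately have "(\<lambda>L. measure P {1..L}) \<longlonglongrightarrow> 1" by simp
  then have "(\<lambda>L. exp (- lam) * exp (lam * measure P {1..L})) \<longlonglongrightarrow> exp (- lam) * exp (lam * 1)"
    by (intro tendsto_intros)
  then have "(\<lambda>L. exp (- lam) * exp (lam * measure P {1..L})) \<longlonglongrightarrow> 1" by (simp add: exp_minus)
  then have "\<forall>\<^sub>F L in sequentially. exp (- lam) * exp (lam * measure P {1..L}) > 1 - \<epsilon> / 4"
    using \<open>\<epsilon> > 0\<close> by (auto simp: order_tendsto_iff)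
  then obtain L where L: "exp (- lam) * exp (lam * measure P {1..L}) > 1 - \<epsilon> / 4"
    by (auto simp: eventually_sequentially)
  have "\<forall>\<^sub>F Q in sequentially. prob {\<omega>. (\<Sum>j<K \<omega>. \<nu> j \<omega>) > Q} < \<epsilon> / 4"
    using order_tendstoD(2)[OF tail_total, of "\<epsilon> / 4"] \<open>\<epsilon> > 0\<close> by simp
  then obtain Q where Q: "prob {\<omega>. (\<Sum>j<K \<omega>. \<nu> j \<omega>) > Q} < \<epsilon> / 4"
    by (auto simp: eventually_sequentially)
  have "(\<lambda>m. exp (- lam) * (1 + lam * measure P {1..L} / real m) ^ m) \<longlonglongrightarrow> exp (- lam) * exp (lam * measure P {1..L})"
    by (intro tendsto_intros tendsto_exp_limit_sequentially)
  then have ev1: "\<forall>\<^sub>F m in sequentially. exp (- lam) * (1 + lam * measure P {1..L} / real m) ^ m > 1 - \<epsilon> / 4"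
    using L by (auto simp: order_tendsto_iff)
  have ev2: "\<forall>\<^sub>F m in sequentially. (\<integral>\<omega>. F (coarse_N m \<omega>) \<partial>MP) > (\<integral>\<omega>. F (N \<omega>) \<partial>MP) - \<epsilon> / 4"
    using coarse_N_converges[OF F] \<open>\<epsilon> > 0\<close> by (auto simp: order_tendsto_iff)
  have "\<forall>\<^sub>F m in sequentially.
    (\<integral>\<omega>. F (N \<omega>) \<partial>MP) \<le> (\<Sum>C\<in>configs m L Q. weight m C * F (block_config m C)) + \<epsilon>"
    using ev1 ev2 eventually_gt_at_top[of 0]
  proof eventually_elim
    case (elim m)
    have "(\<integral>\<omega>. F (coarse_N m \<omega>) \<partial>MP) \<le>
        (\<Sum>C\<in>configs m L Q. weight m C * F (block_config m C)) + (1 - (\<Sum>C\<in>configs m L Q. weight m C))"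
      by (rule integral_coarse_N_le[OF elim(3) F])
    with elim show ?case
      using sum_weight_ge[OF elim(3), of L Q] Q \<open>\<epsilon> > 0\<close> by linarith
  qed
  then show ?thesis by blast
qed

end

section \<open>Mixing and stationarity of exceedance patterns\<close>

text \<open>Over finitely many times only finitely many exceedance patterns exist, so an arbitrary
  predicate Q of the pattern defines a finite union of measurable sets. Counts, existence and
  absence of exceedances are all handled as instances.\<close>

lemma (in sigma_algebra) sets_Collect_pattern:
  assumes "finite T" and P: "\<And>t. t \<in> T \<Longrightarrow> {x \<in> \<Omega>. P t x} \<in> M"
  shows "{x \<in> \<Omega>. Q {t \<in> T. P t x}} \<in> M"
proof -
  have "{x \<in> \<Omega>. P t x = (t \<in> U)} \<in> M" if "t \<in> T" for t U
    using P[OF that] sets_Collect_neg[OF P[OF that]] by (cases "t \<in> U") auto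
  then have "{x \<in> \<Omega>. \<forall>t\<in>T. P t x = (t \<in> U)} \<in> M" for U
    using \<open>finite T\<close> by (intro sets_Collect_finite_All) auto
  then have "(\<Union>U\<in>{U \<in> Pow T. Q U}. {x \<in> \<Omega>. \<forall>t\<in>T. P t x = (t \<in> U)}) \<in> M"
    using \<open>finite T\<close> by (intro finite_UN) auto
  also have "(\<Union>U\<in>{U \<in> Pow T. Q U}. {x \<in> \<Omega>. \<forall>t\<in>T. P t x = (t \<in> U)}) = {x \<in> \<Omega>. Q {t \<in> T. P t x}}"
  proof (intro equalityI subsetI)
    fix x assume "x \<in> (\<Union>U\<in>{U \<in> Pow T. Q U}. {x \<in> \<Omega>. \<forall>t\<in>T. P t x = (t \<in> U)})"
    then obtain U where U: "U \<subseteq> T" "Q U" "x \<in> \<Omega>" "\<forall>t\<in>T. P t x = (t \<in> U)" by auto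
    then have "{t \<in> T. P t x} = U" by auto
    with U show "x \<in> {x \<in> \<Omega>. Q {t \<in> T. P t x}}" by simp
  next
    fix x assume "x \<in> {x \<in> \<Omega>. Q {t \<in> T. P t x}}"
    then show "x \<in> (\<Union>U\<in>{U \<in> Pow T. Q U}. {x \<in> \<Omega>. \<forall>t\<in>T. P t x = (t \<in> U)})"
      by (intro UN_I[of "{t \<in> T. P t x}"]) auto
  qed
  finally show ?thesis .
qed

lemma sigma_algebra_level_sigma: "sigma_algebra (space M) (level_sigma M \<zeta> v a b)"
  unfolding level_sigma_def by (rule sigma_algebra_sigma_sets) auto

lemma level_sigma_mono: "a' \<le> a \<Longrightarrow> b \<le> b' \<Longrightarrow> level_sigma M \<zeta> v a b \<subseteq> level_sigma M \<zeta> v a' b'"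
  unfolding level_sigma_def by (rule sigma_sets_mono') (auto intro: order_trans)

lemma level_sigma_pattern:
  assumes "T \<subseteq> {a..b}"
  shows "{\<omega> \<in> space M. Q {t \<in> T. \<zeta> t \<omega> > v}} \<in> level_sigma M \<zeta> v a b"
proof -
  interpret sigma_algebra "space M" "level_sigma M \<zeta> v a b" by (rule sigma_algebra_level_sigma)
  show ?thesis
  proof (rule sets_Collect_pattern)
    show "finite T" using assms finite_subset by blast
    fix t assume "t \<in> T"
    then have "{\<omega> \<in> space M. \<zeta> t \<omega> \<le> v} \<in> level_sigma M \<zeta> v a b"
      unfolding level_sigma_def using assms by (intro sigma_sets.Basic CollectI exI[of _ t]) auto
    then have "{\<omega> \<in> space M. \<not> \<zeta> t \<omega> \<le> v} \<in> level_sigma M \<zeta> v a b" by (rule sets_Collect_neg)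
    then show "{\<omega> \<in> space M. \<zeta> t \<omega> > v} \<in> level_sigma M \<zeta> v a b" by (simp add: not_le)
  qed
qed

definition exceed :: "(nat \<Rightarrow> 'a \<Rightarrow> real) \<Rightarrow> real \<Rightarrow> nat \<Rightarrow> nat \<Rightarrow> 'a \<Rightarrow> nat" where
  "exceed \<zeta> v a b \<omega> = card {t \<in> {a..b}. \<zeta> t \<omega> > v}"

lemma exceed_split:
  assumes "a \<le> b" "b \<le> c"
  shows "exceed \<zeta> v a c \<omega> = exceed \<zeta> v a b \<omega> + exceed \<zeta> v (Suc b) c \<omega>"
  unfolding exceed_def using assms
  by (subst card_Un_disjoint[symmetric]) (auto intro!: arg_cong[where f=card])

lemma exceed_pos_iff: "exceed \<zeta> v a b \<omega> > 0 \<longleftrightarrow> (\<exists>t\<in>{a..b}. \<zeta> t \<omega> > v)"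
  unfolding exceed_def by (auto simp: card_gt_0_iff)

context prob_space
begin

lemma indep_vars_reindex_inj:
  assumes f: "inj_on f I" and X: "indep_vars N X (f ` I)"
  shows "indep_vars (\<lambda>i. N (f i)) (\<lambda>i. X (f i)) I"
  unfolding indep_vars_def2
proof (intro conjI ballI)
  fix i assume "i \<in> I" then show "random_variable (N (f i)) (X (f i))"
    using X by (auto simp: indep_vars_def2)
next
  let ?F = "\<lambda>i. {X i -` A \<inter> space M |A. A \<in> sets (N i)}"
  have ind: "indep_sets ?F (f ` I)" using X by (simp add: indep_vars_def2)
  show "indep_sets (\<lambda>i. ?F (f i)) I"
  proof (rule indep_setsI)
    fix i assume "i \<in> I" then show "?F (f i) \<subseteq> events" using ind unfolding indep_sets_def by blast
  next
    fix A J assume J: "J \<noteq> {}" "J \<subseteq> I" "finite J" and A: "\<forall>j\<in>J. A j \<in> ?F (f j)"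
    have fJ: "inj_on f J" using f J(2) by (rule inj_on_subset)
    let ?A = "A \<circ> inv_into J f"
    have inv: "inv_into J f (f j) = j" if "j \<in> J" for j using fJ that by simp
    have "prob (\<Inter>j\<in>f ` J. ?A j) = (\<Prod>j\<in>f ` J. prob (?A j))"
      using J A inv by (intro indep_setsD[OF ind]) auto
    then show "prob (\<Inter>j\<in>J. A j) = (\<Prod>j\<in>J. prob (A j))"
      using inv by (simp add: prod.reindex[OF fJ])
  qed
qed

lemma level_sigma_events:
  assumes "\<And>t. \<zeta> t \<in> borel_measurable M"
  shows "level_sigma M \<zeta> v a b \<subseteq> events"
  unfolding level_sigma_def
  by (rule sets.sigma_sets_subset) (use assms in auto)

lemma pattern_event:
  fixes \<zeta> :: "'t \<Rightarrow> 'a \<Rightarrow> real"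
  assumes "\<And>t. t \<in> T \<Longrightarrow> \<zeta> t \<in> borel_measurable M" "finite T"
  shows "{\<omega> \<in> space M. Q {t \<in> T. \<zeta> t \<omega> > v}} \<in> events"
proof (rule sets.sets_Collect_pattern[OF assms(2)])
  fix t assume "t \<in> T"
  then have [measurable]: "\<zeta> t \<in> borel_measurable M" by (rule assms(1))
  show "{\<omega> \<in> space M. \<zeta> t \<omega> > v} \<in> events" by measurable
qed

lemma mixing_coeff_bdd_above:
  "bdd_above {\<bar>prob (A \<inter> B) - prob A * prob B\<bar> | A B j.
      1 \<le> j \<and> j \<le> n - l \<and> A \<in> level_sigma M \<zeta> (u n) 0 j \<and> B \<in> level_sigma M \<zeta> (u n) (j + l) n}"
proof (rule bdd_aboveI[of _ 1])
  fix z assume "z \<in> {\<bar>prob (A \<inter> B) - prob A * prob B\<bar> | A B j.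
      1 \<le> j \<and> j \<le> n - l \<and> A \<in> level_sigma M \<zeta> (u n) 0 j \<and> B \<in> level_sigma M \<zeta> (u n) (j + l) n}"
  then obtain A B where z: "z = \<bar>prob (A \<inter> B) - prob A * prob B\<bar>" by blast
  have "0 \<le> prob (A \<inter> B)" "prob (A \<inter> B) \<le> 1" "0 \<le> prob A * prob B" "prob A * prob B \<le> 1"
    by (auto intro: mult_le_one)
  then show "z \<le> 1" unfolding z by linarith
qed

lemma mixing_coeff_bound:
  assumes "1 \<le> j" "j \<le> n - l" "A \<in> level_sigma M \<zeta> (u n) 0 j" "B \<in> level_sigma M \<zeta> (u n) (j + l) n"
  shows "\<bar>prob (A \<inter> B) - prob A * prob B\<bar> \<le> mixing_coeff M \<zeta> u n l"
  unfolding mixing_coeff_def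
proof (rule cSup_upper[OF _ mixing_coeff_bdd_above])
  show "\<bar>prob (A \<inter> B) - prob A * prob B\<bar> \<in> {\<bar>prob (A \<inter> B) - prob A * prob B\<bar> | A B j.
      1 \<le> j \<and> j \<le> n - l \<and> A \<in> level_sigma M \<zeta> (u n) 0 j \<and> B \<in> level_sigma M \<zeta> (u n) (j + l) n}"
    using assms by (intro CollectI exI[of _ A] exI[of _ B] exI[of _ j]) simp
qed

lemma mixing_coeff_nonneg:
  assumes "l < n" shows "mixing_coeff M \<zeta> u n l \<ge> 0"
proof -
  have "{} \<in> level_sigma M \<zeta> (u n) a b" for a b by (simp add: level_sigma_def sigma_sets.Empty)
  then have "\<bar>prob ({} \<inter> {}) - prob {} * prob {}\<bar> \<le> mixing_coeff M \<zeta> u n l"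
    using assms by (intro mixing_coeff_bound[of 1]) auto
  then show ?thesis by simp
qed

text \<open>The past blocks depend on times up to \<open>m * r - l\<close> and the next one starts
  at \<open>m * r\<close>, so the distance is exactly l and every further block adds one mixing
  coefficient. The intersection with \<open>space M\<close> gives the empty family its
  meaning.\<close>

lemma mixing_blocks:
  assumes \<zeta>: "\<And>t. \<zeta> t \<in> borel_measurable M"
    and l: "1 \<le> l" "l < r" and n: "m * r \<le> n"
    and A: "\<And>i. i < m \<Longrightarrow> A i \<in> level_sigma M \<zeta> (u n) (i * r) (Suc i * r - l)"
  shows "\<bar>prob (space M \<inter> (\<Inter>i<m. A i)) - (\<Prod>i<m. prob (A i))\<bar> \<le> real m * mixing_coeff M \<zeta> u n l"
  using n A
proof (induction m)
  case 0
  then show ?case by (simp add: prob_space)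
next
  case (Suc m)
  let ?\<alpha> = "mixing_coeff M \<zeta> u n l"
  let ?I = "space M \<inter> (\<Inter>i<m. A i)"
  have n': "m * r + r \<le> n" using Suc.prems(1) by simp
  then have ln: "l < n" using l by linarith
  have sub: "A i \<subseteq> space M" if "i < Suc m" for i
    by (rule sets.sets_into_space[OF subsetD[OF level_sigma_events Suc.prems(2)[OF that]]]) (rule \<zeta>)
  have IH: "\<bar>prob ?I - (\<Prod>i<m. prob (A i))\<bar> \<le> real m * ?\<alpha>"
    using Suc.prems n' by (intro Suc.IH) auto
  have eq: "space M \<inter> (\<Inter>i<Suc m. A i) = ?I \<inter> A m" by (auto simp: lessThan_Suc)
  show ?case
  \<comment> \<open>The first block has no past to be separated from; later ones end their past at a
    time at least 1, as \<open>mixing_coeff\<close> demands.\<close>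
  proof (cases "m = 0")
    case True
    have "space M \<inter> (\<Inter>i<Suc m. A i) = A 0" using True sub[of 0] by auto
    then show ?thesis using True mixing_coeff_nonneg[OF ln] by simp
  next
    case False
    then have mr: "m * r \<ge> r" by simp
    interpret L: sigma_algebra "space M" "level_sigma M \<zeta> (u n) 0 (m * r - l)" by (rule sigma_algebra_level_sigma)
    have "A i \<in> level_sigma M \<zeta> (u n) 0 (m * r - l)" if "i < m" for i
    proof -
      have "Suc i * r \<le> m * r" using that by (intro mult_right_mono) auto
      then show ?thesis
        by (intro subsetD[OF level_sigma_mono Suc.prems(2)[of i]] diff_le_mono) (use that in auto)
    qed
    then have "(\<Inter>i\<in>{..<m}. A i) \<in> level_sigma M \<zeta> (u n) 0 (m * r - l)"
      using False by (intro L.finite_INT) auto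
    then have I: "?I \<in> level_sigma M \<zeta> (u n) 0 (m * r - l)"
      by (intro L.Int L.top)
    have "Suc m * r - l \<le> n" using Suc.prems(1) by (rule order_trans[OF diff_le_self])
    moreover have "(m * r - l) + l = m * r" using mr l by linarith
    ultimately have Am: "A m \<in> level_sigma M \<zeta> (u n) ((m * r - l) + l) n"
      using level_sigma_mono[of "(m * r - l) + l" "m * r" "Suc m * r - l" n M \<zeta> "u n"] Suc.prems(2)[of m] n' by auto
    have "1 \<le> m * r - l" "m * r - l \<le> n - l" using mr l n' by linarith+
    then have "\<bar>prob (?I \<inter> A m) - prob ?I * prob (A m)\<bar> \<le> ?\<alpha>"
      by (rule mixing_coeff_bound[where u=u and n=n and \<zeta>=\<zeta>, OF _ _ I Am])
    moreover have "\<bar>prob ?I * prob (A m) - (\<Prod>i<m. prob (A i)) * prob (A m)\<bar> \<le> real m * ?\<alpha>"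
    proof -
      have "\<bar>prob ?I * prob (A m) - (\<Prod>i<m. prob (A i)) * prob (A m)\<bar> = \<bar>prob ?I - (\<Prod>i<m. prob (A i))\<bar> * prob (A m)"
        by (simp add: left_diff_distrib[symmetric] abs_mult)
      also have "\<dots> \<le> \<bar>prob ?I - (\<Prod>i<m. prob (A i))\<bar> * 1" by (intro mult_left_mono) auto
      also have "\<dots> \<le> real m * ?\<alpha>" using IH by simp
      finally show ?thesis .
    qed
    ultimately show ?thesis unfolding eq by (simp add: algebra_simps)
  qed
qed

text \<open>
  Only the exceedance patterns over finite sets of times matter, so stationarity is needed in
  this weak form only; it makes sense for the scenery and for the scenery along the walk.
\<close>

definition pattern_stationary :: "(nat \<Rightarrow> 'a \<Rightarrow> real) \<Rightarrow> bool" where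
  "pattern_stationary \<zeta> \<longleftrightarrow> (\<forall>t. \<zeta> t \<in> borel_measurable M) \<and>
     (\<forall>v h T Q. finite T \<longrightarrow> prob {\<omega> \<in> space M. Q {t \<in> T. \<zeta> (t + h) \<omega> > v}} = prob {\<omega> \<in> space M. Q {t \<in> T. \<zeta> t \<omega> > v}})"

lemma exceed_event:
  assumes "\<And>t. \<zeta> t \<in> borel_measurable M"
  shows "{\<omega> \<in> space M. Q (exceed \<zeta> v a b \<omega>)} \<in> events"
  unfolding exceed_def by (rule pattern_event[where Q="\<lambda>U. Q (card U)"]) (use assms in auto)

lemma exceed_event2:
  assumes "\<And>t. \<zeta> t \<in> borel_measurable M"
  shows "{\<omega> \<in> space M. \<zeta> s \<omega> > v \<and> Q (exceed \<zeta> v a b \<omega>)} \<in> events"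
proof -
  have "{\<omega> \<in> space M. \<zeta> s \<omega> > v} \<inter> {\<omega> \<in> space M. Q (exceed \<zeta> v a b \<omega>)} \<in> events"
    by (intro sets.Int exceed_event assms) (use assms in measurable)
  then show ?thesis by (simp add: Int_def conj_ac cong: conj_cong)
qed

lemma exceed_shift:
  assumes "pattern_stationary \<zeta>"
  shows "prob {\<omega> \<in> space M. Q (exceed \<zeta> v (a + h) (b + h) \<omega>)} = prob {\<omega> \<in> space M. Q (exceed \<zeta> v a b \<omega>)}"
proof -
  have "exceed \<zeta> v (a + h) (b + h) \<omega> = card {t \<in> {a..b}. \<zeta> (t + h) \<omega> > v}" for \<omega>
  proof -
    have "{t \<in> {a + h..b + h}. \<zeta> t \<omega> > v} = (\<lambda>t. t + h) ` {t \<in> {a..b}. \<zeta> (t + h) \<omega> > v}"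
      by (auto simp: image_iff) (metis add_le_cancel_right le_add_diff_inverse2 le_add2 order_trans)
    then show ?thesis unfolding exceed_def by (simp add: card_image)
  qed
  moreover have "prob {\<omega> \<in> space M. Q (card {t \<in> {a..b}. \<zeta> (t + h) \<omega> > v})} = prob {\<omega> \<in> space M. Q (card {t \<in> {a..b}. \<zeta> t \<omega> > v})}"
    using assms[unfolded pattern_stationary_def, THEN conjunct2, rule_format,
      of "{a..b}" "\<lambda>U. Q (card U)" v h] by blast
  ultimately show ?thesis by (simp only: exceed_def[of \<zeta> v a b])
qed

text \<open>Prolong the window by one time on its left. The count reaches j through this time
  exactly if there is an exceedance at it and the new total is j; otherwise the old window, shifted
  by one, already contained j. Stationarity moves it back.\<close>

lemma exceed_telescope:
  assumes st: "pattern_stationary \<zeta>" and j: "j \<ge> 1"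
  shows "prob {\<omega> \<in> space M. exceed \<zeta> v 0 b \<omega> \<ge> j} =
    (\<Sum>t\<le>b. prob {\<omega> \<in> space M. \<zeta> 0 \<omega> > v \<and> exceed \<zeta> v 0 t \<omega> = j})"
proof (induction b)
  have \<zeta>: "\<zeta> t \<in> borel_measurable M" for t using st by (simp add: pattern_stationary_def)
  {
    case 0
    have "exceed \<zeta> v 0 0 \<omega> = (if \<zeta> 0 \<omega> > v then 1 else 0)" for \<omega>
    proof -
      have "{t \<in> {0..0}. \<zeta> t \<omega> > v} = (if \<zeta> 0 \<omega> > v then {0} else {})" by auto
      then show ?thesis by (simp add: exceed_def)
    qed
    then have "{\<omega> \<in> space M. exceed \<zeta> v 0 0 \<omega> \<ge> j} = {\<omega> \<in> space M. \<zeta> 0 \<omega> > v \<and> exceed \<zeta> v 0 0 \<omega> = j}"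
      using j by (auto split: if_splits)
    then show ?case by simp
  next
    case (Suc b)
    have split: "exceed \<zeta> v 0 (Suc b) \<omega> = (if \<zeta> 0 \<omega> > v then 1 else 0) + exceed \<zeta> v (0 + 1) (b + 1) \<omega>" for \<omega>
    proof -
      have "{t \<in> {0..0}. \<zeta> t \<omega> > v} = (if \<zeta> 0 \<omega> > v then {0} else {})" by auto
      then show ?thesis
        using exceed_split[of 0 0 "Suc b" \<zeta> v \<omega>] by (simp add: exceed_def[of _ _ 0 0])
    qed
    let ?A = "{\<omega> \<in> space M. exceed \<zeta> v (0 + 1) (b + 1) \<omega> \<ge> j}"
    let ?B = "{\<omega> \<in> space M. \<zeta> 0 \<omega> > v \<and> exceed \<zeta> v 0 (Suc b) \<omega> = j}"
    have "{\<omega> \<in> space M. exceed \<zeta> v 0 (Suc b) \<omega> \<ge> j} = ?A \<union> ?B"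
      unfolding split using j by (auto split: if_splits)
    moreover have "?A \<inter> ?B = {}" unfolding split by auto
    ultimately have "prob {\<omega> \<in> space M. exceed \<zeta> v 0 (Suc b) \<omega> \<ge> j} = prob ?A + prob ?B"
      using exceed_event[OF \<zeta>] exceed_event2[OF \<zeta>] by (simp add: finite_measure_Union)
    also have "prob ?A = prob {\<omega> \<in> space M. exceed \<zeta> v 0 b \<omega> \<ge> j}"
      by (rule exceed_shift[OF st])
    finally show ?case using Suc.IH by simp
  }
qed

end

section \<open>Random walk in random scenery: joint law and stationarity\<close>

definition step_sum :: "(nat \<Rightarrow> int) \<Rightarrow> nat \<Rightarrow> int" where
  "step_sum z n = (\<Sum>i=1..n. z i)"

abbreviation "SM \<equiv> PiM (UNIV :: int set) (\<lambda>_. borel :: real measure)"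
abbreviation "ZM \<equiv> PiM {1::nat..} (\<lambda>_. count_space (UNIV :: int set))"

locale random_scenery = prob_space M
  for M :: "'a measure" +
  fixes \<xi> :: "int \<Rightarrow> 'a \<Rightarrow> real" and X :: "nat \<Rightarrow> 'a \<Rightarrow> int" and \<rho> :: real
  assumes \<rho>: "0 < \<rho>" "\<rho> < 1" "\<rho> \<noteq> 1 / 2"
    and indep_X: "indep_vars (\<lambda>_. count_space UNIV) X {1..}"
    and prob_X_up: "\<And>i. i \<ge> 1 \<Longrightarrow> prob {\<omega> \<in> space M. X i \<omega> = 1} = \<rho>"
    and prob_X_down: "\<And>i. i \<ge> 1 \<Longrightarrow> prob {\<omega> \<in> space M. X i \<omega> = -1} = 1 - \<rho>"
    and measurable_\<xi>: "\<And>s. \<xi> s \<in> borel_measurable M"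
    and stat: "stationary M \<xi>"
    and indep_\<xi>X: "indep_rvs M SM (\<lambda>\<omega> s. \<xi> s \<omega>) ZM (\<lambda>\<omega>. \<lambda>i\<in>{1..}. X i \<omega>)"
begin

abbreviation Z :: "'a \<Rightarrow> nat \<Rightarrow> int" where "Z \<equiv> \<lambda>\<omega>. \<lambda>i\<in>{1..}. X i \<omega>"
abbreviation W :: "'a \<Rightarrow> int \<Rightarrow> real" where "W \<equiv> \<lambda>\<omega> s. \<xi> s \<omega>"

lemma measurable_X: "i \<ge> 1 \<Longrightarrow> X i \<in> M \<rightarrow>\<^sub>M count_space UNIV"
  using indep_X by (simp add: indep_vars_def)

lemma measurable_W: "W \<in> M \<rightarrow>\<^sub>M SM"
  and measurable_Z: "Z \<in> M \<rightarrow>\<^sub>M ZM"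
  using indep_\<xi>X by (auto simp: indep_rvs_def)

lemma step_sum_Z: "step_sum (Z \<omega>) n = walk X n \<omega>"
  by (simp add: step_sum_def walk_def)

lemma measurable_step_sum: "(\<lambda>z. step_sum z n) \<in> ZM \<rightarrow>\<^sub>M count_space UNIV"
proof (induction n)
  case (Suc n)
  have "(\<lambda>z. z (Suc n)) \<in> ZM \<rightarrow>\<^sub>M count_space UNIV" by (rule measurable_component_singleton) simp
  then have "(\<lambda>z. i + z (Suc n)) \<in> ZM \<rightarrow>\<^sub>M count_space UNIV" for i
    by (rule measurable_compose) simp
  from measurable_compose_countable[OF this Suc]
  have "(\<lambda>z. step_sum z n + z (Suc n)) \<in> ZM \<rightarrow>\<^sub>M count_space UNIV" .
  then show ?case by (simp add: step_sum_def)
qed (simp add: step_sum_def)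

lemma prob_indep:
  assumes "S \<in> sets SM" "E \<in> sets ZM"
  shows "prob {\<omega> \<in> space M. W \<omega> \<in> S \<and> Z \<omega> \<in> E} =
    prob {\<omega> \<in> space M. W \<omega> \<in> S} * prob {\<omega> \<in> space M. Z \<omega> \<in> E}"
proof -
  have "prob ((W -` S \<inter> space M) \<inter> (Z -` E \<inter> space M)) = prob (W -` S \<inter> space M) * prob (Z -` E \<inter> space M)"
    using indep_\<xi>X assms unfolding indep_rvs_def by (intro indep_setD) auto
  then show ?thesis by (simp add: vimage_def Int_def conj_ac)
qed

text \<open>Independence is given on rectangles; the product form of the joint law makes it possible
  to integrate over the scenery for fixed steps of the walk.\<close>

lemma distr_joint: "distr M (SM \<Otimes>\<^sub>M ZM) (\<lambda>\<omega>. (W \<omega>, Z \<omega>)) = distr M SM W \<Otimes>\<^sub>M distr M ZM Z"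
proof (rule pair_measure_eqI[symmetric])
  show "sigma_finite_measure (distr M SM W)" "sigma_finite_measure (distr M ZM Z)"
    by (intro prob_space_imp_sigma_finite prob_space_distr measurable_W measurable_Z)+
  show "sets (distr M SM W \<Otimes>\<^sub>M distr M ZM Z) = sets (distr M (SM \<Otimes>\<^sub>M ZM) (\<lambda>\<omega>. (W \<omega>, Z \<omega>)))"
    by (simp cong: sets_pair_measure_cong)
  fix S E assume "S \<in> sets (distr M SM W)" "E \<in> sets (distr M ZM Z)"
  then have SE: "S \<in> sets SM" "E \<in> sets ZM" by simp_all
  have "emeasure (distr M (SM \<Otimes>\<^sub>M ZM) (\<lambda>\<omega>. (W \<omega>, Z \<omega>))) (S \<times> E) =
      emeasure M ((\<lambda>\<omega>. (W \<omega>, Z \<omega>)) -` (S \<times> E) \<inter> space M)"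
    using SE measurable_Pair[OF measurable_W measurable_Z] by (intro emeasure_distr) auto
  also have "(\<lambda>\<omega>. (W \<omega>, Z \<omega>)) -` (S \<times> E) \<inter> space M = {\<omega> \<in> space M. W \<omega> \<in> S \<and> Z \<omega> \<in> E}" by auto
  also have "emeasure M \<dots> = ennreal (prob {\<omega> \<in> space M. W \<omega> \<in> S} * prob {\<omega> \<in> space M. Z \<omega> \<in> E})"
    using prob_indep[OF SE] by (simp add: emeasure_eq_measure)
  also have "\<dots> = emeasure M (W -` S \<inter> space M) * emeasure M (Z -` E \<inter> space M)"
    by (simp add: emeasure_eq_measure ennreal_mult vimage_def Int_def conj_commute)
  also have "\<dots> = emeasure (distr M SM W) S * emeasure (distr M ZM Z) E"
    using SE measurable_W measurable_Z by (simp add: emeasure_distr)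
  finally show "emeasure (distr M SM W) S * emeasure (distr M ZM Z) E =
      emeasure (distr M (SM \<Otimes>\<^sub>M ZM) (\<lambda>\<omega>. (W \<omega>, Z \<omega>))) (S \<times> E)" by (rule sym)
qed

text \<open>The probabilities of the values 1 and -1 add up to 1, so every set that avoids both is
  null.\<close>

lemma prob_X_in:
  assumes "i \<ge> 1"
  shows "prob (X i -` A \<inter> space M) = \<rho> * indicator A 1 + (1 - \<rho>) * indicator A (-1)"
proof -
  interpret D: prob_space "distr M (count_space UNIV) (X i)"
    by (rule prob_space_distr[OF measurable_X[OF assms]])
  let ?D = "distr M (count_space UNIV) (X i)"
  have D: "measure ?D B = prob (X i -` B \<inter> space M)" for B
    using measurable_X[OF assms] by (simp add: measure_distr)
  have D1: "measure ?D {1} = \<rho>" "measure ?D {-1} = 1 - \<rho>"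
    unfolding D using prob_X_up[OF assms] prob_X_down[OF assms]
    by (simp_all add: vimage_def Int_def conj_commute)
  have "measure ?D ({1} \<union> {-1}) = measure ?D {1} + measure ?D {-1}"
    by (rule D.finite_measure_Union) auto
  then have two: "measure ?D ({1} \<union> {-1}) = 1" using D1 by simp
  have "measure ?D (UNIV - ({1} \<union> {-1})) = 1 - measure ?D ({1} \<union> {-1})"
    using D.prob_compl[of "{1} \<union> {-1}"] by simp
  moreover have "measure ?D (A - ({1} \<union> {-1})) \<le> measure ?D (UNIV - ({1} \<union> {-1}))"
    by (rule D.finite_measure_mono) auto
  ultimately have null: "measure ?D (A - ({1} \<union> {-1})) = 0"
    using two measure_nonneg[of ?D "A - ({1} \<union> {-1})"] by linarith
  have "A = (A \<inter> {1}) \<union> ((A \<inter> {-1}) \<union> (A - ({1} \<union> {-1})))" by auto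
  then have "measure ?D A = measure ?D ((A \<inter> {1}) \<union> ((A \<inter> {-1}) \<union> (A - ({1} \<union> {-1}))))" by (rule arg_cong)
  also have "\<dots> = measure ?D (A \<inter> {1}) + (measure ?D (A \<inter> {-1}) + measure ?D (A - ({1} \<union> {-1})))"
    by (subst D.finite_measure_Union, simp, simp, force, subst D.finite_measure_Union) auto
  finally show ?thesis
    unfolding null D[symmetric] using D1 by (cases "1 \<in> A"; cases "-1 \<in> A") (simp_all add: Int_insert_right)
qed

lemma AE_X: "AE \<omega> in M. \<forall>i\<ge>1. X i \<omega> \<in> {1, -1}"
proof -
  have "AE \<omega> in M. i \<ge> 1 \<longrightarrow> X i \<omega> \<in> {1, -1}" for i
  proof (cases "i \<ge> 1")
    case True
    have "prob (X i -` {1, -1} \<inter> space M) = 1" using prob_X_in[OF True, of "{1, -1}"] by simp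
    then have "AE \<omega> in M. \<omega> \<in> X i -` {1, -1} \<inter> space M"
      using measurable_sets[OF measurable_X[OF True]] by (subst prob_eq_1[symmetric]) auto
    then show ?thesis by eventually_elim auto
  qed auto
  then show ?thesis by (simp add: AE_all_countable)
qed

text \<open>Both laws are products of the one-step laws, which by \<open>prob_X_in\<close> do not
  depend on the index.\<close>

lemma distr_Z_shift: "distr M ZM (\<lambda>\<omega>. \<lambda>i\<in>{1..}. X (i + h) \<omega>) = distr M ZM Z"
proof -
  have rv: "(\<lambda>\<omega>. X (i + h) \<omega>) \<in> M \<rightarrow>\<^sub>M count_space UNIV" if "i \<in> {1..}" for i
    using measurable_X[of "i + h"] that by simp
  have ne: "{1::nat..} \<noteq> {}" by auto
  note law = indep_vars_iff_distr_eq_PiM'[where I="{1::nat..}" and M'="\<lambda>_. count_space (UNIV :: int set)", OF ne]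
  have D: "distr M (count_space UNIV) (X (i + h)) = distr M (count_space UNIV) (X i)" if "i \<in> {1..}" for i
  proof (rule measure_eqI)
    fix A :: "int set"
    show "emeasure (distr M (count_space UNIV) (X (i + h))) A = emeasure (distr M (count_space UNIV) (X i)) A"
      using prob_X_in[of "i + h" A] prob_X_in[of i A] measurable_X[of i] measurable_X[of "i + h"] that
      by (simp add: emeasure_distr emeasure_eq_measure)
  qed simp
  have "indep_vars (\<lambda>_. count_space UNIV) X ((\<lambda>i. i + h) ` {1..})"
    by (rule indep_vars_subset[OF indep_X]) auto
  then have "indep_vars (\<lambda>_. count_space UNIV) (\<lambda>i. X (i + h)) {1..}"
    by (rule indep_vars_reindex_inj[rotated]) simp
  then have "distr M ZM (\<lambda>\<omega>. \<lambda>i\<in>{1..}. X (i + h) \<omega>) = PiM {1..} (\<lambda>i. distr M (count_space UNIV) (X (i + h)))"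
    by (simp only: law[OF rv])
  also have "\<dots> = PiM {1..} (\<lambda>i. distr M (count_space UNIV) (X i))" using D by (intro PiM_cong) auto
  also have "\<dots> = distr M ZM Z"
    using indep_X law[of X, OF measurable_X] by simp
  finally show ?thesis .
qed

lemma prob_step_shift:
  assumes E: "E \<in> sets ZM"
  shows "prob {\<omega> \<in> space M. (\<lambda>i\<in>{1..}. X (i + h) \<omega>) \<in> E} = prob {\<omega> \<in> space M. Z \<omega> \<in> E}"
proof -
  have m: "(\<lambda>\<omega>. \<lambda>i\<in>{1..}. X (i + h) \<omega>) \<in> M \<rightarrow>\<^sub>M ZM"
    using measurable_X by (intro measurable_restrict) auto
  have "measure (distr M ZM (\<lambda>\<omega>. \<lambda>i\<in>{1..}. X (i + h) \<omega>)) E = measure (distr M ZM Z) E"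
    by (simp only: distr_Z_shift)
  then have "prob ((\<lambda>\<omega>. \<lambda>i\<in>{1..}. X (i + h) \<omega>) -` E \<inter> space M) = prob (Z -` E \<inter> space M)"
    by (simp only: measure_distr[OF m E] measure_distr[OF measurable_Z E])
  then show ?thesis by (simp only: vimage_def Int_def mem_Collect_eq conj_commute)
qed

lemma scenery_shift:
  assumes S: "S \<in> sets SM"
  shows "emeasure M {\<omega> \<in> space M. (\<lambda>s. \<xi> (s + c) \<omega>) \<in> S} = emeasure M {\<omega> \<in> space M. W \<omega> \<in> S}"
proof -
  have m: "(\<lambda>\<omega> s. \<xi> (s + c) \<omega>) \<in> M \<rightarrow>\<^sub>M SM"
    using measurable_\<xi> by (intro measurable_PiM_single') auto
  have "emeasure (distr M SM (\<lambda>\<omega> s. \<xi> (s + c) \<omega>)) S = emeasure (distr M SM W) S"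
    using stat unfolding stationary_def by metis
  then have "emeasure M ((\<lambda>\<omega> s. \<xi> (s + c) \<omega>) -` S \<inter> space M) = emeasure M (W -` S \<inter> space M)"
    by (simp only: emeasure_distr[OF m S] emeasure_distr[OF measurable_W S])
  then show ?thesis by (simp only: vimage_def Int_def mem_Collect_eq conj_commute)
qed

lemma scenery_pattern_sets:
  assumes "finite T" shows "{s \<in> space SM. Q {t \<in> T. s (f t) > v}} \<in> sets SM"
  by (rule sets.sets_Collect_pattern[OF assms]) measurable

lemma measurable_scenery_walk: "scenery_walk \<xi> X i \<in> borel_measurable M"
proof -
  have "(\<lambda>\<omega>. step_sum (Z \<omega>) i) \<in> M \<rightarrow>\<^sub>M count_space UNIV"
    by (rule measurable_compose[OF measurable_Z measurable_step_sum])
  then have "(\<lambda>\<omega>. \<xi> (step_sum (Z \<omega>) i) \<omega>) \<in> borel_measurable M"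
    by (rule measurable_compose_countable[OF measurable_\<xi>])
  then show ?thesis unfolding step_sum_Z by (simp add: scenery_walk_def[abs_def])
qed

text \<open>For fixed steps z, what the walk sees after time h is what a walk with the shifted steps
  sees in the scenery translated by \<open>step_sum z h\<close>. The translation disappears by
  stationarity of the scenery, and the shift of the steps disappears after integration because their
  law is invariant.\<close>

lemma pattern_stationary_scenery_walk: "pattern_stationary (scenery_walk \<xi> X)"
  unfolding pattern_stationary_def
proof (intro conjI allI impI measurable_scenery_walk)
  fix v h and T :: "nat set" and Q assume T: "finite T"
  define E where "E h' = {p \<in> space (SM \<Otimes>\<^sub>M ZM). Q {t \<in> T. fst p (step_sum (snd p) (t + h')) > v}}" for h'
  define S0 where "S0 z = {s \<in> space SM. Q {t \<in> T. s (step_sum z t) > v}}" for z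
  define th where "th z = (\<lambda>i\<in>{1..}. z (i + h))" for z :: "nat \<Rightarrow> int"
  define \<phi> where "\<phi> z = emeasure M {\<omega> \<in> space M. W \<omega> \<in> S0 z}" for z
  have E: "E h' \<in> sets (SM \<Otimes>\<^sub>M ZM)" for h'
    unfolding E_def
  proof (rule sets.sets_Collect_pattern[OF T])
    fix t assume "t \<in> T"
    have "(\<lambda>p. (\<lambda>j p. fst p j) (step_sum (snd p) (t + h')) p) \<in> borel_measurable (SM \<Otimes>\<^sub>M ZM)"
    proof (rule measurable_compose_countable)
      show "(\<lambda>p. fst p j) \<in> borel_measurable (SM \<Otimes>\<^sub>M ZM)" for j by measurable
      show "(\<lambda>p. step_sum (snd p) (t + h')) \<in> (SM \<Otimes>\<^sub>M ZM) \<rightarrow>\<^sub>M count_space UNIV"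
        by (rule measurable_compose[OF measurable_snd measurable_step_sum])
    qed
    then show "{p \<in> space (SM \<Otimes>\<^sub>M ZM). fst p (step_sum (snd p) (t + h')) > v} \<in> sets (SM \<Otimes>\<^sub>M ZM)"
      by measurable
  qed
  interpret pw: pair_sigma_finite "distr M SM W" "distr M ZM Z"
    by (intro pair_sigma_finite.intro prob_space_imp_sigma_finite prob_space_distr measurable_W measurable_Z)
  have E': "E h' \<in> sets (distr M SM W \<Otimes>\<^sub>M distr M ZM Z)" for h'
    using E by (simp cong: sets_pair_measure_cong)
  have main: "emeasure M {\<omega> \<in> space M. Q {t \<in> T. scenery_walk \<xi> X (t + h') \<omega> > v}} =
      (\<integral>\<^sup>+z. emeasure (distr M SM W) ((\<lambda>s. (s, z)) -` E h') \<partial>distr M ZM Z)" for h'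
  proof -
    have "{\<omega> \<in> space M. Q {t \<in> T. scenery_walk \<xi> X (t + h') \<omega> > v}} = (\<lambda>\<omega>. (W \<omega>, Z \<omega>)) -` E h' \<inter> space M"
      using measurable_space[OF measurable_W] measurable_space[OF measurable_Z]
      by (auto simp: E_def scenery_walk_def step_sum_Z[symmetric] space_pair_measure)
    then have "emeasure M {\<omega> \<in> space M. Q {t \<in> T. scenery_walk \<xi> X (t + h') \<omega> > v}} =
        emeasure (distr M (SM \<Otimes>\<^sub>M ZM) (\<lambda>\<omega>. (W \<omega>, Z \<omega>))) (E h')"
      using emeasure_distr[OF measurable_Pair[OF measurable_W measurable_Z] E] by (rule trans[OF arg_cong sym])
    then show ?thesis unfolding distr_joint pw.emeasure_pair_measure_alt2[OF E'] .
  qed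
  have S0: "S0 z \<in> sets SM" for z unfolding S0_def by (rule scenery_pattern_sets[OF T])
  have sec: "emeasure (distr M SM W) ((\<lambda>s. (s, z)) -` E h') = \<phi> (\<lambda>i\<in>{1..}. z (i + h'))" if z: "z \<in> space ZM" for z h'
  proof -
    have step: "step_sum z (t + h') = step_sum (\<lambda>i\<in>{1..}. z (i + h')) t + step_sum z h'" for t
      unfolding step_sum_def by (induction t) (auto simp: add.commute add.left_commute)
    have sec: "(\<lambda>s. (s, z)) -` E h' = {s \<in> space SM. Q {t \<in> T. s (step_sum z (t + h')) > v}}"
      using z by (auto simp: E_def space_pair_measure)
    have "emeasure (distr M SM W) ((\<lambda>s. (s, z)) -` E h') = emeasure M {\<omega> \<in> space M. W \<omega> \<in> {s \<in> space SM. Q {t \<in> T. s (step_sum z (t + h')) > v}}}"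
      unfolding sec emeasure_distr[OF measurable_W
          scenery_pattern_sets[where T=T and Q=Q and f="\<lambda>t. step_sum z (t + h')" and v=v, OF T]]
      by (rule arg_cong2[where f=emeasure]) auto
    also have "{\<omega> \<in> space M. W \<omega> \<in> {s \<in> space SM. Q {t \<in> T. s (step_sum z (t + h')) > v}}} =
        {\<omega> \<in> space M. (\<lambda>s. \<xi> (s + step_sum z h') \<omega>) \<in> S0 (\<lambda>i\<in>{1..}. z (i + h'))}"
      unfolding S0_def step by (simp add: space_PiM)
    also have "emeasure M \<dots> = \<phi> (\<lambda>i\<in>{1..}. z (i + h'))"
      unfolding \<phi>_def by (rule scenery_shift[OF S0])
    finally show ?thesis .
  qed
  \<comment> \<open>\<open>\<phi>\<close> agrees with the section function of the measurable set
    \<open>E 0\<close>: a point of the product space is extensional, so shifting it by 0 gives it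
    back.\<close>
  have mphi: "\<phi> \<in> borel_measurable ZM"
  proof -
    have "(\<lambda>z. emeasure (distr M SM W) ((\<lambda>s. (s, z)) -` E 0)) \<in> borel_measurable ZM"
      using pw.measurable_emeasure_Pair2[OF E'[of 0]] by simp
    moreover have "\<phi> z = emeasure (distr M SM W) ((\<lambda>s. (s, z)) -` E 0)" if "z \<in> space ZM" for z
    proof -
      have "(\<lambda>i\<in>{1..}. z (i + 0)) = z" using that by (auto simp: space_PiM PiE_def extensional_def)
      then show ?thesis using sec[OF that, of 0] by simp
    qed
    ultimately show ?thesis by (subst measurable_cong) simp_all
  qed
  have int: "emeasure M {\<omega> \<in> space M. Q {t \<in> T. scenery_walk \<xi> X (t + h') \<omega> > v}} = (\<integral>\<^sup>+z. \<phi> z \<partial>distr M ZM Z)" for h'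
  proof -
    have mth: "(\<lambda>z. \<lambda>i\<in>{1..}. z (i + h')) \<in> ZM \<rightarrow>\<^sub>M ZM"
      by (intro measurable_restrict measurable_component_singleton) auto
    have "(\<integral>\<^sup>+z. emeasure (distr M SM W) ((\<lambda>s. (s, z)) -` E h') \<partial>distr M ZM Z) = (\<integral>\<^sup>+z. \<phi> (\<lambda>i\<in>{1..}. z (i + h')) \<partial>distr M ZM Z)"
      by (intro nn_integral_cong sec) simp
    also have "\<dots> = (\<integral>\<^sup>+\<omega>. \<phi> (\<lambda>i\<in>{1..}. Z \<omega> (i + h')) \<partial>M)"
      using measurable_compose[OF mth mphi]
      by (intro nn_integral_distr measurable_Z) (simp only: measurable_distr_eq1)
    also have "\<dots> = (\<integral>\<^sup>+\<omega>. \<phi> (\<lambda>i\<in>{1..}. X (i + h') \<omega>) \<partial>M)"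
      by (intro nn_integral_cong arg_cong[where f=\<phi>]) auto
    also have "\<dots> = (\<integral>\<^sup>+z. \<phi> z \<partial>distr M ZM (\<lambda>\<omega>. \<lambda>i\<in>{1..}. X (i + h') \<omega>))"
      using mphi
      by (intro nn_integral_distr[symmetric] measurable_restrict measurable_X; simp only: measurable_distr_eq1) auto
    finally show ?thesis unfolding main distr_Z_shift .
  qed
  show "prob {\<omega> \<in> space M. Q {t \<in> T. scenery_walk \<xi> X (t + h) \<omega> > v}} =
      prob {\<omega> \<in> space M. Q {t \<in> T. scenery_walk \<xi> X t \<omega> > v}}"
    using int[of h] int[of 0] by (simp add: measure_def)
qed

lemma prob_scenery_pattern_shift:
  assumes "finite T"
  shows "prob {\<omega> \<in> space M. Q {t \<in> T. \<xi> (f t + c) \<omega> > v}} = prob {\<omega> \<in> space M. Q {t \<in> T. \<xi> (f t) \<omega> > v}}"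
  using scenery_shift[OF scenery_pattern_sets[OF assms, where Q=Q and f=f and v=v], of c]
  by (simp add: space_PiM measure_def)

lemma pattern_stationary_scenery: "pattern_stationary (\<lambda>s. \<xi> (d * int s))"
  unfolding pattern_stationary_def
  using measurable_\<xi> prob_scenery_pattern_shift[where f="\<lambda>t. d * int t" and c="d * int _"]
  by (auto simp: algebra_simps)

end

section \<open>Exceedances along the transient walk\<close>

lemma exceed_first: "exceed \<zeta> v 0 t \<omega> = (if \<zeta> 0 \<omega> > v then 1 else 0) + exceed \<zeta> v 1 t \<omega>"
proof -
  have "{t \<in> {0..0}. \<zeta> t \<omega> > v} = (if \<zeta> 0 \<omega> > v then {0} else {})" by auto
  then have "exceed \<zeta> v 0 0 \<omega> = (if \<zeta> 0 \<omega> > v then 1 else 0)" by (simp add: exceed_def)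
  then show ?thesis using exceed_split[of 0 0 t \<zeta> v \<omega>] by simp
qed

lemma exceed_single_iff:
  "\<zeta> 0 \<omega> > v \<and> exceed \<zeta> v 0 t \<omega> = 1 \<longleftrightarrow> \<zeta> 0 \<omega> > v \<and> (\<forall>s\<in>{1..t}. \<zeta> s \<omega> \<le> v)"
proof (cases "\<zeta> 0 \<omega> > v")
  case True
  then have "exceed \<zeta> v 0 t \<omega> = 1 \<longleftrightarrow> \<not> exceed \<zeta> v 1 t \<omega> > 0" using exceed_first[of \<zeta> v t \<omega>] by simp
  also have "\<dots> \<longleftrightarrow> (\<forall>s\<in>{1..t}. \<zeta> s \<omega> \<le> v)" unfolding exceed_pos_iff not_less[symmetric] by blast
  finally show ?thesis by blast
qed simp

text \<open>If every exceedance at a site up to (j - 1) k had a successor at distance less than k, a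
  chain of j jumps started at 0 would produce j + 1 exceedances in {0..j k}.\<close>

lemma gap_in_sparse_pattern:
  fixes e :: "nat \<Rightarrow> bool"
  assumes e0: "e 0" and jk: "j \<ge> 1" and sparse: "card {s \<in> {0..j * k}. e s} \<le> j"
  shows "\<exists>i. i + k \<le> j * k \<and> e i \<and> (\<forall>s\<in>{1..<k}. \<not> e (i + s))"
proof (rule ccontr)
  assume "\<not> ?thesis"
  then have step: "\<exists>s\<in>{1..<k}. e (i + s)" if "i + k \<le> j * k" "e i" for i using that by blast
  have "\<exists>i\<le>a * k. e i \<and> card {s \<in> {0..i}. e s} \<ge> a + 1" if "a \<le> j" for a
    using that
  proof (induction a)
    case 0
    have "{s \<in> {0..0}. e s} = {0}" using e0 by auto
    then show ?case using e0 by (intro exI[of _ 0]) simp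
  next
    case (Suc a)
    then obtain i where i: "i \<le> a * k" "e i" "card {s \<in> {0..i}. e s} \<ge> a + 1" by auto
    have "Suc a * k \<le> j * k" using Suc.prems by (intro mult_right_mono) auto
    then have "i + k \<le> j * k" using i(1) by simp
    then obtain s where s: "s \<in> {1..<k}" "e (i + s)" using step i(2) by blast
    have "card (insert (i + s) {s \<in> {0..i}. e s}) \<le> card {s' \<in> {0..i + s}. e s'}"
      using s by (intro card_mono) auto
    moreover have "card (insert (i + s) {s \<in> {0..i}. e s}) = Suc (card {s \<in> {0..i}. e s})"
      using s by (subst card_insert_disjoint) auto
    ultimately have "card {s' \<in> {0..i + s}. e s'} \<ge> Suc a + 1" using i(3) by simp
    then show ?case using s i(1) by (intro exI[of _ "i + s"]) auto
  qed
  from this[of j] obtain i where i: "i \<le> j * k" "card {s \<in> {0..i}. e s} \<ge> j + 1" by auto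
  have "card {s \<in> {0..i}. e s} \<le> card {s \<in> {0..j * k}. e s}" using i(1) by (intro card_mono) auto
  with i(2) sparse show False by simp
qed

section \<open>Last exceedances and gaps in a stationary sequence\<close>

context prob_space
begin

lemma abs_prob_diff_le:
  assumes "A \<in> events" "B \<in> events" "C \<in> events" "A - B \<subseteq> C" "B - A \<subseteq> C"
  shows "\<bar>prob A - prob B\<bar> \<le> prob C"
proof -
  have "prob A \<le> prob (B \<union> C)" "prob B \<le> prob (A \<union> C)"
    using assms by (auto intro!: finite_measure_mono)
  moreover have "prob (B \<union> C) \<le> prob B + prob C" "prob (A \<union> C) \<le> prob A + prob C"
    using assms by (auto intro!: measure_Un_le)
  ultimately show ?thesis by linarith
qed

lemma abs_prob_Collect_diff_le:
  assumes "{\<omega> \<in> space M. P \<omega>} \<in> events" "{\<omega> \<in> space M. P' \<omega>} \<in> events" "C \<in> events"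
    and "\<And>\<omega>. \<omega> \<in> space M \<Longrightarrow> \<omega> \<notin> C \<Longrightarrow> P \<omega> = P' \<omega>"
  shows "\<bar>prob {\<omega> \<in> space M. P \<omega>} - prob {\<omega> \<in> space M. P' \<omega>}\<bar> \<le> prob C"
  using assms(4) by (intro abs_prob_diff_le assms(1-3)) blast+

lemma pattern_stationary_measurable: "pattern_stationary \<zeta> \<Longrightarrow> \<zeta> t \<in> borel_measurable M"
  by (simp add: pattern_stationary_def)

lemma pattern_stationaryD:
  "pattern_stationary \<zeta> \<Longrightarrow> finite T \<Longrightarrow>
    prob {\<omega> \<in> space M. Q {t \<in> T. \<zeta> (t + h) \<omega> > v}} = prob {\<omega> \<in> space M. Q {t \<in> T. \<zeta> t \<omega> > v}}"
  by (simp add: pattern_stationary_def)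

lemma pattern_stationary_single:
  assumes "pattern_stationary \<zeta>"
  shows "prob {\<omega> \<in> space M. \<zeta> t \<omega> > v} = prob {\<omega> \<in> space M. \<zeta> 0 \<omega> > v}"
  using pattern_stationaryD[where \<zeta>=\<zeta> and T="{0}" and Q="\<lambda>U. 0 \<in> U" and h=t and v=v, OF assms] by simp

text \<open>The two patterns can differ only if the value at some time of T lies between the levels.
  Since exceedances of the higher level are exceedances of the lower one, each such event has as
  probability the difference of the tails, and a union bound over T remains.\<close>

lemma pattern_level_change:
  assumes st: "pattern_stationary \<zeta>" and T: "finite T"
  shows "\<bar>prob {\<omega> \<in> space M. Q {t \<in> T. \<zeta> t \<omega> > v}} - prob {\<omega> \<in> space M. Q {t \<in> T. \<zeta> t \<omega> > v'}}\<bar>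
    \<le> real (card T) * \<bar>prob {\<omega> \<in> space M. \<zeta> 0 \<omega> > v} - prob {\<omega> \<in> space M. \<zeta> 0 \<omega> > v'}\<bar>"
proof -
  have *: "\<bar>prob {\<omega> \<in> space M. Q {t \<in> T. \<zeta> t \<omega> > v}} - prob {\<omega> \<in> space M. Q {t \<in> T. \<zeta> t \<omega> > v'}}\<bar>
    \<le> real (card T) * \<bar>prob {\<omega> \<in> space M. \<zeta> 0 \<omega> > v} - prob {\<omega> \<in> space M. \<zeta> 0 \<omega> > v'}\<bar>"
    if vv: "v \<le> v'" for v v'
  proof -
    note [measurable] = pattern_stationary_measurable[OF st]
    let ?d = "\<lambda>t. {\<omega> \<in> space M. \<zeta> t \<omega> > v} - {\<omega> \<in> space M. \<zeta> t \<omega> > v'}"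
    have ev: "{\<omega> \<in> space M. Q {t \<in> T. \<zeta> t \<omega> > w}} \<in> events" for w
      by (rule pattern_event[where T=T and Q=Q and \<zeta>=\<zeta>, OF _ T]) (rule pattern_stationary_measurable[OF st])
    have d: "prob (?d t) = prob {\<omega> \<in> space M. \<zeta> 0 \<omega> > v} - prob {\<omega> \<in> space M. \<zeta> 0 \<omega> > v'}" for t
    proof -
      have "prob (?d t) = prob {\<omega> \<in> space M. \<zeta> t \<omega> > v} - prob {\<omega> \<in> space M. \<zeta> t \<omega> > v'}"
        using vv by (subst finite_measure_Diff) auto
      then show ?thesis unfolding pattern_stationary_single[where t=t, OF st] .
    qed
    have "\<bar>prob {\<omega> \<in> space M. Q {t \<in> T. \<zeta> t \<omega> > v}} - prob {\<omega> \<in> space M. Q {t \<in> T. \<zeta> t \<omega> > v'}}\<bar>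
        \<le> prob (\<Union>t\<in>T. ?d t)"
    proof (rule abs_prob_Collect_diff_le[OF ev ev])
      show "(\<Union>t\<in>T. ?d t) \<in> events" using T by (intro sets.finite_UN) auto
      fix \<omega> assume "\<omega> \<in> space M" "\<omega> \<notin> (\<Union>t\<in>T. ?d t)"
      then have "{t \<in> T. \<zeta> t \<omega> > v} = {t \<in> T. \<zeta> t \<omega> > v'}"
        using vv by (auto intro: order.strict_trans1)
      then show "Q {t \<in> T. \<zeta> t \<omega> > v} = Q {t \<in> T. \<zeta> t \<omega> > v'}" by (rule arg_cong)
    qed
    also have "\<dots> \<le> (\<Sum>t\<in>T. prob (?d t))"
      using T by (intro finite_measure_subadditive_finite) auto
    also have "\<dots> = real (card T) * (prob {\<omega> \<in> space M. \<zeta> 0 \<omega> > v} - prob {\<omega> \<in> space M. \<zeta> 0 \<omega> > v'})"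
      by (simp only: d sum_constant)
    also have "\<dots> \<le> real (card T) * \<bar>prob {\<omega> \<in> space M. \<zeta> 0 \<omega> > v} - prob {\<omega> \<in> space M. \<zeta> 0 \<omega> > v'}\<bar>"
      by (intro mult_left_mono) auto
    finally show ?thesis .
  qed
  show ?thesis
  proof (cases "v \<le> v'")
    case True then show ?thesis by (rule *)
  next
    case False
    then show ?thesis using *[of v' v] by (simp add: abs_minus_commute)
  qed
qed

text \<open>By \<open>sum_last_prob\<close> these are the increments, in the window length, of the
  probability that the window contains an exceedance. Through this identity the extremal index gives
  information on them.\<close>

definition last_prob :: "(nat \<Rightarrow> 'a \<Rightarrow> real) \<Rightarrow> real \<Rightarrow> nat \<Rightarrow> real" where
  "last_prob \<zeta> v t = prob {\<omega> \<in> space M. \<zeta> 0 \<omega> > v \<and> (\<forall>s\<in>{1..t}. \<zeta> s \<omega> \<le> v)}"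

lemma last_event:
  assumes "pattern_stationary \<zeta>"
  shows "{\<omega> \<in> space M. \<zeta> 0 \<omega> > v \<and> (\<forall>s\<in>{1..t}. \<zeta> s \<omega> \<le> v)} \<in> events"
  using pattern_stationary_measurable[OF assms] by measurable

lemma last_prob_antimono:
  assumes "pattern_stationary \<zeta>" "t \<le> t'"
  shows "last_prob \<zeta> v t' \<le> last_prob \<zeta> v t"
  unfolding last_prob_def using assms(2)
  by (intro finite_measure_mono last_event[OF assms(1)]) auto

lemma sum_last_prob:
  assumes st: "pattern_stationary \<zeta>"
  shows "prob {\<omega> \<in> space M. \<exists>s\<in>{0..b}. \<zeta> s \<omega> > v} = (\<Sum>t\<le>b. last_prob \<zeta> v t)"
proof -
  have "prob {\<omega> \<in> space M. exceed \<zeta> v 0 b \<omega> \<ge> 1} = (\<Sum>t\<le>b. last_prob \<zeta> v t)"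
    unfolding exceed_telescope[OF st order_refl] exceed_single_iff last_prob_def ..
  moreover have "exceed \<zeta> v 0 b \<omega> \<ge> 1 \<longleftrightarrow> (\<exists>s\<in>{0..b}. \<zeta> s \<omega> > v)" for \<omega>
    unfolding exceed_pos_iff[symmetric] by linarith
  ultimately show ?thesis by (simp only:)
qed

text \<open>The event of \<open>D_cond\<close>, with a general window t in place of
  \<open>n div s n\<close>.\<close>

definition gap_prob :: "(nat \<Rightarrow> 'a \<Rightarrow> real) \<Rightarrow> real \<Rightarrow> nat \<Rightarrow> nat \<Rightarrow> real" where
  "gap_prob \<zeta> v k t = prob {\<omega> \<in> space M. \<zeta> 0 \<omega> > v \<and> (\<forall>s\<in>{1..<k}. \<zeta> s \<omega> \<le> v) \<and> (\<exists>s\<in>{k..t}. \<zeta> s \<omega> > v)}"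

text \<open>A difference of nested events. As the values of \<open>last_prob\<close> are monotone
  and can be estimated by other means, gaps become controllable for windows longer than those of
  \<open>D_cond\<close>.\<close>

lemma gap_prob_eq:
  assumes st: "pattern_stationary \<zeta>" and k: "k \<ge> 1" "k \<le> Suc t"
  shows "gap_prob \<zeta> v k t = last_prob \<zeta> v (k - 1) - last_prob \<zeta> v t"
proof -
  have "{1..<k} = {1..k - 1}" "{1..t} = {1..k - 1} \<union> {k..t}" using k by auto
  then have eq: "{\<omega> \<in> space M. \<zeta> 0 \<omega> > v \<and> (\<forall>s\<in>{1..<k}. \<zeta> s \<omega> \<le> v) \<and> (\<exists>s\<in>{k..t}. \<zeta> s \<omega> > v)} =
    {\<omega> \<in> space M. \<zeta> 0 \<omega> > v \<and> (\<forall>s\<in>{1..k - 1}. \<zeta> s \<omega> \<le> v)} - {\<omega> \<in> space M. \<zeta> 0 \<omega> > v \<and> (\<forall>s\<in>{1..t}. \<zeta> s \<omega> \<le> v)}"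
    by (auto simp: not_le ball_Un)
  show ?thesis
    unfolding gap_prob_def last_prob_def eq
    by (rule finite_measure_Diff[OF last_event[OF st] last_event[OF st]]) (use k in auto)
qed

lemma gap_prob_shift:
  assumes st: "pattern_stationary \<zeta>"
  shows "prob {\<omega> \<in> space M. \<zeta> i \<omega> > v \<and> (\<forall>s\<in>{1..<k}. \<zeta> (i + s) \<omega> \<le> v) \<and> (\<exists>s\<in>{k..t}. \<zeta> (i + s) \<omega> > v)} = gap_prob \<zeta> v k t"
proof -
  let ?Q = "\<lambda>U. 0 \<in> U \<and> (\<forall>s\<in>{1..<k}. s \<notin> U) \<and> (\<exists>s\<in>{k..t}. s \<in> U)"
  have "?Q {s \<in> {0..k + t}. \<zeta> (s + i) \<omega> > v} \<longleftrightarrow> \<zeta> i \<omega> > v \<and> (\<forall>s\<in>{1..<k}. \<zeta> (i + s) \<omega> \<le> v) \<and> (\<exists>s\<in>{k..t}. \<zeta> (i + s) \<omega> > v)" for i \<omega>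
    by (auto simp: add.commute not_less)
  note eq = this this[of 0, simplified]
  show ?thesis
    using pattern_stationaryD[where \<zeta>=\<zeta> and T="{0..k + t}" and Q="?Q" and h=i and v=v, OF st]
    unfolding eq gap_prob_def by (simp add: not_less)
qed

end

section \<open>The drifting walk and the scenery it discovers\<close>

context random_scenery
begin

text \<open>The sign of the drift. \<open>R\<close> and \<open>\<eta>\<close> are the walk and the
  scenery seen in this direction, so that all later arguments deal with a drift to the
  right.\<close>

definition dir :: int where "dir = (if \<rho> > 1 / 2 then 1 else -1)"

lemma dir_cases: "dir = 1 \<or> dir = -1" by (simp add: dir_def)
lemma dir_sq [simp]: "dir * (dir * a) = a" using dir_cases by auto

definition R :: "nat \<Rightarrow> 'a \<Rightarrow> int" where "R n \<omega> = dir * walk X n \<omega>"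
definition \<eta> :: "nat \<Rightarrow> 'a \<Rightarrow> real" where "\<eta> s = \<xi> (dir * int s)"
abbreviation \<zeta> where "\<zeta> \<equiv> scenery_walk \<xi> X"

lemma pattern_stationary_\<eta>: "pattern_stationary \<eta>"
  using pattern_stationary_scenery[of dir] by (simp add: \<eta>_def[abs_def])

lemma \<zeta>_eq_\<eta>: "R i \<omega> = int s \<Longrightarrow> \<zeta> i \<omega> = \<eta> s \<omega>"
  by (metis R_def \<eta>_def dir_sq scenery_walk_def)

lemma \<zeta>_0: "\<zeta> 0 = \<xi> 0" and \<eta>_0: "\<eta> 0 = \<xi> 0"
  by (auto simp: scenery_walk_def walk_def \<eta>_def)

text \<open>
  The conditions on the scenery look to the right, whereas the walk may drift to the left.
  Summed over t, both sides are the probability of an exceedance in a window of the same length.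
\<close>

lemma last_prob_\<eta>: "last_prob \<eta> v t = last_prob (\<lambda>s. \<xi> (int s)) v t"
proof -
  have st: "pattern_stationary (\<lambda>s. \<xi> (int s))" using pattern_stationary_scenery[of 1] by simp
  have "prob {\<omega> \<in> space M. \<exists>s\<in>{0..b}. \<eta> s \<omega> > v} = prob {\<omega> \<in> space M. \<exists>s\<in>{0..b}. \<xi> (int s) \<omega> > v}" for b
  proof (cases "dir = 1")
    case True then show ?thesis by (simp add: \<eta>_def)
  next
    case False
    then have d: "dir = -1" using dir_cases by auto
    have "prob {\<omega> \<in> space M. {s \<in> {0..b}. \<xi> (- int s + int b) \<omega> > v} \<noteq> {}} = prob {\<omega> \<in> space M. {s \<in> {0..b}. \<xi> (- int s) \<omega> > v} \<noteq> {}}"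
      by (rule prob_scenery_pattern_shift[where Q="\<lambda>U. U \<noteq> {}" and f="\<lambda>s. - int s"]) simp
    moreover have "(\<exists>s\<in>{0..b}. \<xi> (- int s + int b) \<omega> > v) \<longleftrightarrow> (\<exists>s\<in>{0..b}. \<xi> (int s) \<omega> > v)" for \<omega>
    proof
      assume "\<exists>s\<in>{0..b}. \<xi> (- int s + int b) \<omega> > v"
      then obtain s where "s \<le> b" "\<xi> (- int s + int b) \<omega> > v" by auto
      then show "\<exists>s\<in>{0..b}. \<xi> (int s) \<omega> > v" by (intro bexI[of _ "b - s"]) (auto simp: of_nat_diff)
    next
      assume "\<exists>s\<in>{0..b}. \<xi> (int s) \<omega> > v"
      then obtain s where "s \<le> b" "\<xi> (int s) \<omega> > v" by auto
      then show "\<exists>s\<in>{0..b}. \<xi> (- int s + int b) \<omega> > v" by (intro bexI[of _ "b - s"]) (auto simp: of_nat_diff)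
    qed
    ultimately show ?thesis by (simp add: \<eta>_def d Bex_def)
  qed
  then have sums: "(\<Sum>t\<le>b. last_prob \<eta> v t) = (\<Sum>t\<le>b. last_prob (\<lambda>s. \<xi> (int s)) v t)" for b
    using sum_last_prob[OF pattern_stationary_\<eta>, of b v] sum_last_prob[OF st, of b v] by simp
  show ?thesis
  proof (cases t)
    case 0 then show ?thesis using sums[of 0] by simp
  next
    case (Suc t') then show ?thesis using sums[of t'] sums[of t] by simp
  qed
qed

text \<open>A set of step sequences, so that its probability separates from events of the scenery.
  Steps of size one, which hold only almost surely, are built in to make the walk pass through every
  site.\<close>

definition good_steps :: "nat \<Rightarrow> nat \<Rightarrow> (nat \<Rightarrow> int) set" where
  "good_steps L T = {z \<in> space ZM. (\<forall>i\<ge>1. z i \<in> {1, -1}) \<and> (\<forall>i\<ge>T. dir * step_sum z i \<ge> int L)}"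

definition good :: "nat \<Rightarrow> nat \<Rightarrow> 'a set" where
  "good L T = {\<omega> \<in> space M. Z \<omega> \<in> good_steps L T}"

lemma good_iff: "\<omega> \<in> good L T \<longleftrightarrow> \<omega> \<in> space M \<and> (\<forall>i\<ge>1. X i \<omega> \<in> {1, -1}) \<and> (\<forall>i\<ge>T. R i \<omega> \<ge> int L)"
  unfolding good_def good_steps_def R_def mem_Collect_eq step_sum_Z
  using measurable_space[OF measurable_Z, of \<omega>] by auto

lemma good_steps_sets: "good_steps L T \<in> sets ZM"
proof -
  have 1: "{z \<in> space ZM. dir * step_sum z i \<ge> int L} \<in> sets ZM" for i
    using measurable_sets[OF measurable_step_sum[of i], of "{y. dir * y \<ge> int L}"]
    by (simp add: vimage_def Int_def conj_commute)
  have 2: "{z \<in> space ZM. i \<ge> 1 \<longrightarrow> z i \<in> {1, -1}} \<in> sets ZM" for i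
  proof (cases "i \<ge> 1")
    case True
    then have "(\<lambda>z. z i) \<in> ZM \<rightarrow>\<^sub>M count_space UNIV" by (intro measurable_component_singleton) simp
    from measurable_sets[OF this, of "{1, -1}"] True show ?thesis
      by (simp add: vimage_def Int_def conj_commute)
  qed simp
  show ?thesis
    unfolding good_steps_def
    by (intro sets.sets_Collect_conj sets.sets_Collect_countable_All sets.sets_Collect_imp sets.sets_Collect_const 1 2)
qed

lemma Z_event: "E \<in> sets ZM \<Longrightarrow> {\<omega> \<in> space M. Z \<omega> \<in> E} \<in> events"
  using measurable_sets[OF measurable_Z] by (simp only: vimage_def Int_def mem_Collect_eq conj_commute)

lemma good_event: "good L T \<in> events"
  unfolding good_def by (rule Z_event[OF good_steps_sets])

lemma expectation_X:
  assumes "i \<ge> 1" shows "expectation (\<lambda>\<omega>. real_of_int (dir * X i \<omega>)) = \<bar>2 * \<rho> - 1\<bar>"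
proof -
  have ev: "{\<omega> \<in> space M. X i \<omega> = 1} \<in> events"
    using measurable_sets[OF measurable_X[OF assms], of "{1}"] by (simp add: vimage_def Int_def conj_commute)
  have [measurable]: "X i \<in> M \<rightarrow>\<^sub>M count_space UNIV" by (rule measurable_X[OF assms])
  have "expectation (\<lambda>\<omega>. real_of_int (dir * X i \<omega>)) =
      expectation (\<lambda>\<omega>. real_of_int dir * (2 * indicator {\<omega> \<in> space M. X i \<omega> = 1} \<omega> - 1))"
  proof (rule integral_cong_AE)
    show "AE \<omega> in M. real_of_int (dir * X i \<omega>) = real_of_int dir * (2 * indicator {\<omega> \<in> space M. X i \<omega> = 1} \<omega> - 1)"
      using AE_X AE_space by eventually_elim (use assms in \<open>auto simp: indicator_def\<close>)
  qed (use ev in measurable)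
  also have "\<dots> = real_of_int dir * (2 * \<rho> - 1)"
    using ev prob_X_up[OF assms] prob_space by (simp add: integrable_real_indicator emeasure_eq_measure)
  also have "\<dots> = \<bar>2 * \<rho> - 1\<bar>" using \<rho> by (auto simp: dir_def)
  finally show ?thesis .
qed

text \<open>Hoeffding's inequality with half of the mean as deviation. The steps lie in [-1, 1], so
  the squared ranges add up to 4 n, whence the exponent with the constant 1 / 8.\<close>

lemma prob_slow:
  assumes n: "n \<ge> 1"
  shows "prob {\<omega> \<in> space M. real_of_int (R n \<omega>) \<le> real n * \<bar>2 * \<rho> - 1\<bar> / 2} \<le> exp (- (\<bar>2 * \<rho> - 1\<bar>\<^sup>2 / 8)) ^ n"
proof -
  let ?\<mu> = "\<bar>2 * \<rho> - 1\<bar>"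
  have iv: "indep_vars (\<lambda>_. borel) (\<lambda>i \<omega>. real_of_int (dir * X i \<omega>)) {1..n}"
    by (rule indep_vars_compose2[OF indep_vars_subset[OF indep_X]]) auto
  interpret H: Hoeffding_ineq M "{1..n}" "\<lambda>i \<omega>. real_of_int (dir * X i \<omega>)" "\<lambda>_. -1" "\<lambda>_. 1" "real n * ?\<mu>"
  proof unfold_locales
    show "AE \<omega> in M. real_of_int (dir * X i \<omega>) \<in> {- 1..1}" if "i \<in> {1..n}" for i
      using AE_X by eventually_elim (use that dir_cases in force)
    show "real n * ?\<mu> \<equiv> \<Sum>i = 1..n. expectation (\<lambda>\<omega>. real_of_int (dir * X i \<omega>))"
      by (rule eq_reflection) (simp add: expectation_X del: of_int_mult)
  qed (use iv in auto)
  have "prob {\<omega> \<in> space M. (\<Sum>i = 1..n. real_of_int (dir * X i \<omega>)) \<le> real n * ?\<mu> - real n * ?\<mu> / 2}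
      \<le> exp (- 2 * (real n * ?\<mu> / 2)\<^sup>2 / (\<Sum>i = 1..n. (1 - - 1)\<^sup>2))"
    using n by (intro H.Hoeffding_ineq_le) auto
  also have "(\<Sum>i = 1..n. (1 - - 1 :: real)\<^sup>2) = 4 * real n" by simp
  also have "- 2 * (real n * ?\<mu> / 2)\<^sup>2 / (4 * real n) = real n * - (?\<mu>\<^sup>2 / 8)"
    using n by (simp add: power2_eq_square field_simps)
  also have "exp \<dots> = exp (- (?\<mu>\<^sup>2 / 8)) ^ n" by (rule exp_of_nat_mult)
  also have "{\<omega> \<in> space M. (\<Sum>i = 1..n. real_of_int (dir * X i \<omega>)) \<le> real n * ?\<mu> - real n * ?\<mu> / 2} =
      {\<omega> \<in> space M. real_of_int (R n \<omega>) \<le> real n * ?\<mu> / 2}"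
    by (simp add: R_def walk_def sum_distrib_left)
  finally show ?thesis .
qed

lemma measurable_R: "R n \<in> M \<rightarrow>\<^sub>M count_space UNIV"
proof -
  have "(\<lambda>\<omega>. step_sum (Z \<omega>) n) \<in> M \<rightarrow>\<^sub>M count_space UNIV"
    by (rule measurable_compose[OF measurable_Z measurable_step_sum])
  then have "(\<lambda>\<omega>. dir * step_sum (Z \<omega>) n) \<in> M \<rightarrow>\<^sub>M count_space UNIV"
    by (rule measurable_compose) simp
  then show ?thesis unfolding step_sum_Z by (simp add: R_def[abs_def])
qed

text \<open>The bounds of \<open>prob_slow\<close> are summable; by the Borel-Cantelli lemma the
  walk eventually stays above half of its mean, which grows linearly.\<close>

lemma AE_drift: "AE \<omega> in M. \<forall>L. \<forall>\<^sub>F n in sequentially. R n \<omega> \<ge> int L"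
proof -
  let ?\<mu> = "\<bar>2 * \<rho> - 1\<bar>"
  have mu: "?\<mu> > 0" using \<rho> by auto
  let ?A = "\<lambda>n. {\<omega> \<in> space M. real_of_int (R n \<omega>) \<le> real n * ?\<mu> / 2}"
  have "summable (\<lambda>n. exp (- (?\<mu>\<^sup>2 / 8)) ^ n)" using mu by (intro summable_geometric) auto
  then have "summable (\<lambda>n. prob (?A n))"
    by (rule summable_comparison_test[rotated]) (use prob_slow in \<open>auto intro!: exI[of _ 1]\<close>)
  moreover have "?A n \<in> events" for n
    using measurable_sets[OF measurable_R[of n], of "{y. real_of_int y \<le> real n * ?\<mu> / 2}"]
    by (simp only: vimage_def Int_def mem_Collect_eq conj_commute sets_UNIV space_count_space sets_count_space Pow_UNIV UNIV_I)
  ultimately have "AE \<omega> in M. \<forall>\<^sub>F n in sequentially. \<omega> \<in> space M - ?A n"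
    by (intro borel_cantelli_AE1) (auto simp: emeasure_eq_measure)
  then show ?thesis
  proof eventually_elim
    case (elim \<omega>)
    show ?case
    proof
      fix L
      have "filterlim (\<lambda>n. real n * ?\<mu> / 2) at_top sequentially" using mu by real_asymp
      then have "\<forall>\<^sub>F n in sequentially. real n * ?\<mu> / 2 \<ge> real L" by (simp add: filterlim_at_top)
      with elim show "\<forall>\<^sub>F n in sequentially. R n \<omega> \<ge> int L"
      proof eventually_elim
        case (elim n)
        then have "real_of_int (R n \<omega>) > real L" by auto
        then show ?case by linarith
      qed
    qed
  qed
qed

lemma good_limit: "(\<lambda>T. prob (good L T)) \<longlonglongrightarrow> 1"
proof -
  have "incseq (good L)" by (auto simp: incseq_def good_iff)
  then have "(\<lambda>T. prob (good L T)) \<longlonglongrightarrow> prob (\<Union>T. good L T)"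
    using good_event by (intro finite_Lim_measure_incseq) auto
  moreover have "prob (\<Union>T. good L T) = 1"
  proof -
    have "AE \<omega> in M. \<omega> \<in> (\<Union>T. good L T)"
      using AE_X AE_drift AE_space
      by eventually_elim (auto simp: good_iff eventually_sequentially)
    then show ?thesis using good_event by (subst prob_eq_1) auto
  qed
  ultimately show ?thesis by simp
qed

lemma good_exists:
  assumes "\<epsilon> > 0" shows "\<exists>T. prob (space M - good L T) < \<epsilon>"
proof -
  have "\<forall>\<^sub>F T in sequentially. prob (good L T) > 1 - \<epsilon>"
    using good_limit assms by (intro order_tendstoD(1)) auto
  then obtain T where "prob (good L T) > 1 - \<epsilon>" by (auto simp: eventually_sequentially)
  then show ?thesis using prob_compl[OF good_event, of L T] by (intro exI[of _ T]) linarith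
qed

lemma R_0 [simp]: "R 0 \<omega> = 0" by (simp add: R_def walk_def)

lemma R_Suc: "R (Suc i) \<omega> = R i \<omega> + dir * X (Suc i) \<omega>"
  by (simp add: R_def walk_def algebra_simps)

lemma good_step: "\<omega> \<in> good L T \<Longrightarrow> \<bar>R (i + 1) \<omega> - R i \<omega>\<bar> \<le> 1"
  using dir_cases by (auto simp: good_iff R_Suc abs_mult dest!: spec[of _ "Suc i"])

lemma good_upper: "\<omega> \<in> good L T \<Longrightarrow> R i \<omega> \<le> int i"
proof (induction i)
  case (Suc i) then show ?case using good_step[of \<omega> L T i] by auto
qed simp

text \<open>Discrete intermediate value theorem: with steps of size one the walk skips no site on
  its way from 0 to its position at time T.\<close>

lemma good_visits:
  assumes "\<omega> \<in> good L T" "s \<le> L" shows "\<exists>i\<le>T. R i \<omega> = int s"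
proof (rule nat0_intermed_int_val)
  show "\<forall>i<T. \<bar>R (i + 1) \<omega> - R i \<omega>\<bar> \<le> 1" using good_step[OF assms(1)] by auto
  show "R 0 \<omega> \<le> int s" by simp
  show "int s \<le> R T \<omega>" using assms by (auto simp: good_iff)
qed

definition escape_steps :: "(nat \<Rightarrow> int) set" where
  "escape_steps = {z \<in> space ZM. \<forall>i\<ge>1. step_sum z i \<noteq> 0}"

definition escape :: "'a set" where "escape = {\<omega> \<in> space M. \<forall>i\<ge>1. walk X i \<omega> \<noteq> 0}"

lemma escape_eq: "escape = {\<omega> \<in> space M. Z \<omega> \<in> escape_steps}"
  unfolding escape_def escape_steps_def mem_Collect_eq step_sum_Z
  using measurable_space[OF measurable_Z] by blast

lemma escape_steps_sets: "escape_steps \<in> sets ZM"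
proof -
  have 1: "{z \<in> space ZM. step_sum z i \<noteq> 0} \<in> sets ZM" for i
    using measurable_sets[OF measurable_step_sum[of i], of "- {0}"]
    by (simp add: vimage_def Int_def conj_commute)
  show ?thesis
    unfolding escape_steps_def
    by (intro sets.sets_Collect_countable_All sets.sets_Collect_imp sets.sets_Collect_const 1)
qed

lemma escape_event: "escape \<in> events"
  unfolding escape_eq by (rule Z_event[OF escape_steps_sets])

text \<open>
  The walk returns to 0 only finitely often, and after its last visit at time t the shifted walk
  never returns; so these events, all of probability \<open>prob escape\<close>, cover the space.
\<close>

lemma prob_escape_pos: "prob escape > 0"
proof (rule ccontr)
  assume "\<not> prob escape > 0"
  then have q0: "prob escape = 0" using measure_nonneg[of M escape] by linarith
  let ?Zt = "\<lambda>t \<omega>. \<lambda>i\<in>{1..}. X (i + t) \<omega>"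
  let ?E = "\<lambda>t. {\<omega> \<in> space M. ?Zt t \<omega> \<in> escape_steps}"
  have "prob (?E t) = 0" for t
    using prob_step_shift[OF escape_steps_sets, of t] q0 unfolding escape_eq by simp
  moreover have "?E t \<in> events" for t
  proof -
    have "?Zt t \<in> M \<rightarrow>\<^sub>M ZM" using measurable_X by (intro measurable_restrict) auto
    from measurable_sets[OF this escape_steps_sets] show ?thesis
      by (simp only: vimage_def Int_def mem_Collect_eq conj_commute)
  qed
  ultimately have "AE \<omega> in M. \<omega> \<notin> ?E t" for t
    by (subst prob_eq_0[symmetric]) auto
  then have "AE \<omega> in M. \<forall>t. \<omega> \<notin> ?E t" by (simp add: AE_all_countable)
  moreover have "AE \<omega> in M. \<exists>t. \<omega> \<in> ?E t"
    using AE_drift AE_space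
  proof eventually_elim
    case (elim \<omega>)
    then obtain n0 where n0: "\<And>n. n \<ge> n0 \<Longrightarrow> R n \<omega> \<ge> int 1" unfolding eventually_sequentially by meson
    let ?V = "{n. walk X n \<omega> = 0}"
    have "n < n0" if "walk X n \<omega> = 0" for n
      using n0[of n] that by (cases "n < n0") (auto simp: R_def)
    then have fin: "finite ?V" by (intro finite_subset[of ?V "{..<n0}"]) auto
    have "0 \<in> ?V" by (simp add: walk_def)
    then have V: "?V \<noteq> {}" by blast
    have shift: "step_sum (?Zt t \<omega>) i = walk X (i + t) \<omega> - walk X t \<omega>" for t i
    proof (induction i)
      case (Suc i)
      then show ?case by (simp add: step_sum_def walk_def)
    qed (simp add: step_sum_def)
    have "?Zt (Max ?V) \<omega> \<in> escape_steps"
    proof -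
      have "step_sum (?Zt (Max ?V) \<omega>) i \<noteq> 0" if "i \<ge> 1" for i
      proof
        assume "step_sum (?Zt (Max ?V) \<omega>) i = 0"
        then have "walk X (i + Max ?V) \<omega> = 0" using Max_in[OF fin V] unfolding shift by simp
        then have "i + Max ?V \<le> Max ?V" using fin by (intro Max_ge) auto
        with that show False by simp
      qed
      then show ?thesis by (auto simp: escape_steps_def space_PiM)
    qed
    with elim show ?case by blast
  qed
  ultimately have "AE \<omega> in M. False" by eventually_elim blast
  then show False by simp
qed

lemma prob_scenery_steps:
  assumes T: "finite T" and E: "E \<in> sets ZM"
  shows "prob {\<omega> \<in> space M. Q {s \<in> T. \<eta> s \<omega> > v} \<and> Z \<omega> \<in> E} =
    prob {\<omega> \<in> space M. Q {s \<in> T. \<eta> s \<omega> > v}} * prob {\<omega> \<in> space M. Z \<omega> \<in> E}"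
proof -
  let ?S = "{w \<in> space SM. Q {s \<in> T. w (dir * int s) > v}}"
  have "?S \<in> sets SM" by (rule scenery_pattern_sets[OF T])
  from prob_indep[OF this E] show ?thesis by (simp add: space_PiM \<eta>_def)
qed

lemma scenery_steps_event:
  assumes T: "finite T" and E: "E \<in> sets ZM"
  shows "{\<omega> \<in> space M. Q {s \<in> T. \<eta> s \<omega> > v} \<and> Z \<omega> \<in> E} \<in> events"
proof (rule sets.sets_Collect_conj)
  show "{\<omega> \<in> space M. Q {s \<in> T. \<eta> s \<omega> > v}} \<in> events"
    by (rule pattern_event[where T=T and Q=Q and \<zeta>=\<eta>, OF _ T])
       (rule pattern_stationary_measurable[OF pattern_stationary_\<eta>])
qed (rule Z_event[OF E])

text \<open>
  If the walk stays above L = j k from time T on, it has visited all sites from 0 to L by then. At most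
  j exceedances on these sites leave an exceedance followed by a gap of length k, so that a later
  exceedance of the walk yields one of the scenery beyond the gap.
\<close>

lemma late_exceedance_bound:
  assumes j: "j \<ge> 1" and k: "k \<ge> 1" and t: "T \<le> t1" "t1 \<le> t2"
  shows "prob {\<omega> \<in> space M. \<zeta> 0 \<omega> > v \<and> exceed \<zeta> v 0 t1 \<omega> \<le> j \<and> exceed \<zeta> v (Suc t1) t2 \<omega> > 0}
    \<le> real (Suc (j * k)) * gap_prob \<eta> v k t2 + prob {\<omega> \<in> space M. \<xi> 0 \<omega> > v} * prob (space M - good (j * k) T)"
proof -
  let ?L = "j * k"
  let ?A = "{\<omega> \<in> space M. \<zeta> 0 \<omega> > v \<and> exceed \<zeta> v 0 t1 \<omega> \<le> j \<and> exceed \<zeta> v (Suc t1) t2 \<omega> > 0}"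
  let ?G = "\<lambda>i. {\<omega> \<in> space M. \<eta> i \<omega> > v \<and> (\<forall>s\<in>{1..<k}. \<eta> (i + s) \<omega> \<le> v) \<and> (\<exists>s\<in>{k..t2}. \<eta> (i + s) \<omega> > v)}"
  let ?B = "{\<omega> \<in> space M. {s \<in> {0}. \<eta> s \<omega> > v} \<noteq> {} \<and> Z \<omega> \<in> space ZM - good_steps ?L T}"
  note [measurable] = pattern_stationary_measurable[OF pattern_stationary_\<eta>]
  have G: "?G i \<in> events" for i by measurable
  have B: "?B \<in> events"
    by (rule scenery_steps_event[where T="{0}" and Q="\<lambda>U. U \<noteq> {}"]) (use good_steps_sets in auto)
  have UN: "(\<Union>i\<in>{..?L}. ?G i) \<in> events" by (rule sets.finite_UN[OF finite_atMost G])
  have "?A \<subseteq> (\<Union>i\<in>{..?L}. ?G i) \<union> ?B"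
  proof
    fix \<omega> assume w: "\<omega> \<in> ?A"
    then have sp: "\<omega> \<in> space M" by simp
    show "\<omega> \<in> (\<Union>i\<in>{..?L}. ?G i) \<union> ?B"
    proof (cases "\<omega> \<in> good ?L T")
      case False
      then show ?thesis
        using w measurable_space[OF measurable_Z sp] by (auto simp: good_def \<zeta>_0 \<eta>_0)
    next
      case True
      have "\<exists>i\<le>t1. R i \<omega> = int s" if "s \<le> ?L" for s
        using good_visits[OF True that] t(1) order_trans by blast
      then obtain f where f: "\<And>s. s \<le> ?L \<Longrightarrow> f s \<le> t1" "\<And>s. s \<le> ?L \<Longrightarrow> R (f s) \<omega> = int s" by metis
      \<comment> \<open>Different sites are visited at different times, so the exceedances on the
        sites up to \<open>?L\<close> number at most those seen by the walk until t1.\<close>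
      have "card {s \<in> {0..?L}. \<eta> s \<omega> > v} \<le> card {i \<in> {0..t1}. \<zeta> i \<omega> > v}"
      proof (rule card_inj_on_le)
        show "inj_on f {s \<in> {0..?L}. \<eta> s \<omega> > v}"
          by (rule inj_onI) (metis (no_types, lifting) atLeastAtMost_iff f(2) mem_Collect_eq of_nat_eq_iff)
        show "f ` {s \<in> {0..?L}. \<eta> s \<omega> > v} \<subseteq> {i \<in> {0..t1}. \<zeta> i \<omega> > v}"
          using f \<zeta>_eq_\<eta>[OF f(2)] by auto
      qed auto
      then have sparse: "card {s \<in> {0..?L}. \<eta> s \<omega> > v} \<le> j" using w by (simp add: exceed_def)
      obtain i where i: "i + k \<le> ?L" "\<eta> i \<omega> > v" "\<forall>s\<in>{1..<k}. \<not> \<eta> (i + s) \<omega> > v"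
        using gap_in_sparse_pattern[of "\<lambda>s. \<eta> s \<omega> > v" j k, OF _ j sparse] w by (auto simp: \<zeta>_0 \<eta>_0)
      obtain t' where t': "t1 < t'" "t' \<le> t2" "\<zeta> t' \<omega> > v"
        using w exceed_pos_iff[of \<zeta> v "Suc t1" t2 \<omega>] by (auto simp: Suc_le_eq)
      \<comment> \<open>After T the walk is at or beyond \<open>?L\<close>, and with unit speed it
        has not passed t'. As i + k \<le> \<open>?L\<close>, the offset of its site from i is at
        least k and at most t2, the range in the gap event.\<close>
      have Rt: "int ?L \<le> R t' \<omega>" "R t' \<omega> \<le> int t'"
        using True t t' good_upper[OF True, of t'] by (auto simp: good_iff)
      then obtain y where y: "R t' \<omega> = int y" by (metis nonneg_int_cases of_nat_0_le_iff order_trans)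
      have "?L \<le> y" "y \<le> t'" using Rt unfolding y of_nat_le_iff .
      then have yb: "?L \<le> y" "y \<le> t2" using t' by auto
      have "\<eta> y \<omega> > v" using t'(3) \<zeta>_eq_\<eta>[OF y] by simp
      then have Gi: "\<omega> \<in> ?G i"
        using sp i yb by (auto simp: not_less intro!: bexI[of _ "y - i"])
      have "i \<in> {..?L}" using i(1) by simp
      from UnI1[OF UN_I[where B="?G", OF this Gi]] show ?thesis .
    qed
  qed
  then have "prob ?A \<le> prob ((\<Union>i\<in>{..?L}. ?G i) \<union> ?B)"
    by (rule finite_measure_mono[OF _ sets.Un[OF UN B]])
  also have "\<dots> \<le> prob (\<Union>i\<in>{..?L}. ?G i) + prob ?B"
    by (rule measure_Un_le[OF UN B])
  also have "prob (\<Union>i\<in>{..?L}. ?G i) \<le> (\<Sum>i\<in>{..?L}. prob (?G i))"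
    by (rule finite_measure_subadditive_finite[OF finite_atMost image_subsetI[OF G]])
  also have "(\<Sum>i\<in>{..?L}. prob (?G i)) = real (Suc ?L) * gap_prob \<eta> v k t2"
    unfolding gap_prob_shift[OF pattern_stationary_\<eta>] by simp
  \<comment> \<open>A badly behaved walk is independent of the scenery, so it costs only a small
    fraction of the probability of an exceedance at 0. This factor of order 1 / n is essential
    because the bound is later multiplied by n.\<close>
  also have "prob ?B = prob {\<omega> \<in> space M. {s \<in> {0}. \<eta> s \<omega> > v} \<noteq> {}} * prob {\<omega> \<in> space M. Z \<omega> \<in> space ZM - good_steps ?L T}"
    using good_steps_sets by (intro prob_scenery_steps[where Q="\<lambda>U. U \<noteq> {}"]) auto
  also have "{\<omega> \<in> space M. {s \<in> {0}. \<eta> s \<omega> > v} \<noteq> {}} = {\<omega> \<in> space M. \<xi> 0 \<omega> > v}" by (auto simp: \<eta>_0)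
  also have "{\<omega> \<in> space M. Z \<omega> \<in> space ZM - good_steps ?L T} = space M - good ?L T"
    using measurable_space[OF measurable_Z] by (auto simp: good_def)
  finally show ?thesis by simp
qed

text \<open>Up to time t the walk sees only the exceedance at its start. For the lower bound, a good
  walk that never returns to 0 meets only sites in {1..t}, so it is enough that these are below the
  level. For the upper bound, a good walk has met all sites in {1..L} by time T, and it cannot
  return to 0, before t because of the exceedance there and after T because it stays at or above L
  \<ge> 1. Independence of steps and scenery gives the products.\<close>

lemma single_exceedance_bounds:
  assumes L: "L \<ge> 1" and t: "T \<le> t"
  shows "last_prob \<eta> v t * (prob escape - prob (space M - good L T)) \<le> prob {\<omega> \<in> space M. \<zeta> 0 \<omega> > v \<and> exceed \<zeta> v 0 t \<omega> = 1}" (is ?lower)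
    and "prob {\<omega> \<in> space M. \<zeta> 0 \<omega> > v \<and> exceed \<zeta> v 0 t \<omega> = 1} \<le>
      last_prob \<eta> v L * prob escape + prob {\<omega> \<in> space M. \<xi> 0 \<omega> > v} * prob (space M - good L T)" (is ?upper)
proof -
  let ?A = "{\<omega> \<in> space M. \<zeta> 0 \<omega> > v \<and> exceed \<zeta> v 0 t \<omega> = 1}"
  let ?Q = "\<lambda>U. 0 \<in> U \<and> (\<forall>s\<in>{1::nat..}. s \<notin> U)"
  let ?B = "{\<omega> \<in> space M. {s \<in> {0}. \<eta> s \<omega> > v} \<noteq> {} \<and> Z \<omega> \<in> space ZM - good_steps L T}"
  have A: "?A \<in> events" by (rule exceed_event2) (rule measurable_scenery_walk)
  have Qeq: "?Q {s \<in> {0..b}. \<eta> s \<omega> > v} \<longleftrightarrow> \<eta> 0 \<omega> > v \<and> (\<forall>s\<in>{1..b}. \<eta> s \<omega> \<le> v)" for b \<omega>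
    by (auto simp: not_less)
  have lp: "prob {\<omega> \<in> space M. ?Q {s \<in> {0..b}. \<eta> s \<omega> > v}} = last_prob \<eta> v b" for b
    unfolding Qeq last_prob_def ..
  have single: "\<omega> \<in> ?A \<longleftrightarrow> \<omega> \<in> space M \<and> \<zeta> 0 \<omega> > v \<and> (\<forall>i\<in>{1..t}. \<zeta> i \<omega> \<le> v)" for \<omega>
    using exceed_single_iff[of v \<zeta> \<omega> t] by blast
  have eg: "escape_steps \<inter> good_steps L T \<in> sets ZM"
    using escape_steps_sets good_steps_sets by (rule sets.Int)
  have egM: "{\<omega> \<in> space M. Z \<omega> \<in> escape_steps \<inter> good_steps L T} = escape \<inter> good L T"
    unfolding escape_eq good_def by auto
  have "prob escape \<le> prob ((escape \<inter> good L T) \<union> (space M - good L T))"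
    using escape_event good_event sets.sets_into_space[OF escape_event] by (intro finite_measure_mono) auto
  also have "\<dots> \<le> prob (escape \<inter> good L T) + prob (space M - good L T)"
    using escape_event good_event by (intro measure_Un_le) auto
  finally have "last_prob \<eta> v t * (prob escape - prob (space M - good L T)) \<le> last_prob \<eta> v t * prob (escape \<inter> good L T)"
    by (intro mult_left_mono) (auto simp: last_prob_def)
  also have "\<dots> = prob {\<omega> \<in> space M. ?Q {s \<in> {0..t}. \<eta> s \<omega> > v} \<and> Z \<omega> \<in> escape_steps \<inter> good_steps L T}"
    using prob_scenery_steps[OF _ eg, of "{0..t}" ?Q v] lp[of t] egM by simp
  also have "\<dots> \<le> prob ?A"
  proof (rule finite_measure_mono[OF _ A], rule subsetI)
    fix \<omega> assume w: "\<omega> \<in> {\<omega> \<in> space M. ?Q {s \<in> {0..t}. \<eta> s \<omega> > v} \<and> Z \<omega> \<in> escape_steps \<inter> good_steps L T}"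
    then have sp: "\<omega> \<in> space M" and esc: "\<omega> \<in> escape" and gd: "\<omega> \<in> good L T"
      and q: "\<eta> 0 \<omega> > v" "\<And>s. s \<in> {1..t} \<Longrightarrow> \<eta> s \<omega> \<le> v"
      unfolding Qeq using egM by auto
    have "\<zeta> i \<omega> \<le> v" if i: "i \<in> {1..t}" for i
    proof -
      \<comment> \<open>From a position at or below 0 the walk would have to hit 0 again on its way
        up to L, which is excluded by \<open>escape\<close>.\<close>
      have "R i \<omega> > 0"
      proof (rule ccontr)
        assume "\<not> R i \<omega> > 0"
        define m where "m = max i T"
        have "\<exists>a\<ge>i. a \<le> m \<and> R a \<omega> = 0"
        proof (rule nat_intermed_int_val)
          show "\<forall>a. i \<le> a \<and> a < m \<longrightarrow> \<bar>R (Suc a) \<omega> - R a \<omega>\<bar> \<le> 1" using good_step[OF gd] by auto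
          show "0 \<le> R m \<omega>" using gd L by (auto simp: good_iff m_def intro: order_trans[of 0 "int L"])
        qed (use \<open>\<not> R i \<omega> > 0\<close> in \<open>auto simp: m_def\<close>)
        then obtain a where "a \<ge> i" "R a \<omega> = 0" by blast
        then show False using esc i dir_cases by (auto simp: escape_def R_def)
      qed
      then obtain y where y: "R i \<omega> = int y" "y \<ge> 1" by (metis Suc_leI One_nat_def zero_less_imp_eq_int)
      have "y \<le> t" using good_upper[OF gd, of i] y i by auto
      then show ?thesis using \<zeta>_eq_\<eta>[OF y(1)] q(2)[of y] y(2) by simp
    qed
    then show "\<omega> \<in> ?A" unfolding single using sp q(1) by (simp add: \<zeta>_0 \<eta>_0)
  qed
  finally show ?lower .
  have sub: "?A \<subseteq> {\<omega> \<in> space M. ?Q {s \<in> {0..L}. \<eta> s \<omega> > v} \<and> Z \<omega> \<in> escape_steps} \<union> ?B"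
  proof
    fix \<omega> assume w: "\<omega> \<in> ?A"
    then have sp: "\<omega> \<in> space M" and z0: "\<zeta> 0 \<omega> > v" and z: "\<And>i. i \<in> {1..t} \<Longrightarrow> \<zeta> i \<omega> \<le> v"
      unfolding single by auto
    show "\<omega> \<in> {\<omega> \<in> space M. ?Q {s \<in> {0..L}. \<eta> s \<omega> > v} \<and> Z \<omega> \<in> escape_steps} \<union> ?B"
    proof (cases "\<omega> \<in> good L T")
      case False
      then show ?thesis
        using z0 sp measurable_space[OF measurable_Z sp] by (auto simp: good_def \<zeta>_0 \<eta>_0)
    next
      case True
      have "walk X i \<omega> \<noteq> 0" if "i \<ge> 1" for i
      proof (cases "i \<le> t")
        case True
        then have "\<zeta> i \<omega> \<le> v" using z that by simp
        then show ?thesis using z0 by (auto simp: scenery_walk_def walk_def)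
      next
        case False
        then have "R i \<omega> \<ge> int L" using \<open>\<omega> \<in> good L T\<close> t by (auto simp: good_iff)
        then show ?thesis using L by (auto simp: R_def)
      qed
      then have "\<omega> \<in> escape" using sp by (simp add: escape_def)
      moreover have "\<eta> s \<omega> \<le> v" if s: "s \<in> {1..L}" for s
      proof -
        obtain i where i: "i \<le> T" "R i \<omega> = int s" using good_visits[OF True, of s] s by auto
        have "i \<noteq> 0" using i s by (cases "i = 0") auto
        then show ?thesis using \<zeta>_eq_\<eta>[OF i(2)] z[of i] i t by auto
      qed
      ultimately show ?thesis unfolding Qeq escape_eq using z0 sp by (auto simp: \<zeta>_0 \<eta>_0)
    qed
  qed
  have E1: "{\<omega> \<in> space M. ?Q {s \<in> {0..L}. \<eta> s \<omega> > v} \<and> Z \<omega> \<in> escape_steps} \<in> events"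
    by (rule scenery_steps_event[where T="{0..L}" and Q="?Q", OF _ escape_steps_sets]) simp
  have B: "?B \<in> events"
    by (rule scenery_steps_event[where T="{0}" and Q="\<lambda>U. U \<noteq> {}"]) (use good_steps_sets in auto)
  have "prob ?A \<le> prob ({\<omega> \<in> space M. ?Q {s \<in> {0..L}. \<eta> s \<omega> > v} \<and> Z \<omega> \<in> escape_steps} \<union> ?B)"
    by (intro finite_measure_mono[OF sub sets.Un[OF E1 B]])
  also have "\<dots> \<le> prob {\<omega> \<in> space M. ?Q {s \<in> {0..L}. \<eta> s \<omega> > v} \<and> Z \<omega> \<in> escape_steps} + prob ?B"
    by (rule measure_Un_le[OF E1 B])
  also have "prob {\<omega> \<in> space M. ?Q {s \<in> {0..L}. \<eta> s \<omega> > v} \<and> Z \<omega> \<in> escape_steps} = last_prob \<eta> v L * prob escape"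
    using prob_scenery_steps[OF _ escape_steps_sets, of "{0..L}" ?Q v] lp[of L] escape_eq by simp
  also have "prob ?B = prob {\<omega> \<in> space M. {s \<in> {0}. \<eta> s \<omega> > v} \<noteq> {}} * prob {\<omega> \<in> space M. Z \<omega> \<in> space ZM - good_steps L T}"
    using good_steps_sets by (intro prob_scenery_steps[where Q="\<lambda>U. U \<noteq> {}"]) auto
  also have "{\<omega> \<in> space M. {s \<in> {0}. \<eta> s \<omega> > v} \<noteq> {}} = {\<omega> \<in> space M. \<xi> 0 \<omega> > v}" by (auto simp: \<eta>_0)
  also have "{\<omega> \<in> space M. Z \<omega> \<in> space ZM - good_steps L T} = space M - good L T"
    using measurable_space[OF measurable_Z] by (auto simp: good_def)
  finally show ?upper by simp
qed

end

section \<open>Asymptotics of the exceedance probabilities\<close>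

lemma range_max_le_iff: "range_max \<zeta> i j \<omega> \<le> ereal v \<longleftrightarrow> (\<forall>t\<in>{i..j}. \<zeta> t \<omega> \<le> v)"
  by (simp add: range_max_def SUP_le_iff)

lemma less_range_max_iff: "ereal v < range_max \<zeta> i j \<omega> \<longleftrightarrow> (\<exists>t\<in>{i..j}. v < \<zeta> t \<omega>)"
  by (simp add: range_max_def less_SUP_iff)

lemma nat_floor_mult_at_top:
  fixes \<delta> :: real assumes "\<delta> > 0"
  shows "filterlim (\<lambda>n. nat \<lfloor>\<delta> * real n\<rfloor>) at_top sequentially"
  unfolding filterlim_at_top
proof
  fix Y :: nat
  show "\<forall>\<^sub>F n in sequentially. Y \<le> nat \<lfloor>\<delta> * real n\<rfloor>"
    using eventually_ge_at_top[of "nat \<lceil>real Y / \<delta>\<rceil>"]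
  proof eventually_elim
    case (elim n)
    then have "real Y / \<delta> \<le> real n" by linarith
    then have "real Y \<le> \<delta> * real n" using assms by (simp add: field_simps)
    then show ?case by (rule le_nat_floor)
  qed
qed

lemma nat_floor_mult_ratio:
  fixes \<delta> :: real assumes "\<delta> \<ge> 0"
  shows "(\<lambda>n. real (nat \<lfloor>\<delta> * real n\<rfloor>) / real n) \<longlonglongrightarrow> \<delta>"
proof (rule tendsto_sandwich[of "\<lambda>n. \<delta> - 1 / real n" _ _ "\<lambda>_. \<delta>"])
  have b: "\<delta> * real n - 1 \<le> real (nat \<lfloor>\<delta> * real n\<rfloor>)" "real (nat \<lfloor>\<delta> * real n\<rfloor>) \<le> \<delta> * real n" for n
  proof -
    have "0 \<le> \<delta> * real n" using assms by simp
    then show "\<delta> * real n - 1 \<le> real (nat \<lfloor>\<delta> * real n\<rfloor>)" "real (nat \<lfloor>\<delta> * real n\<rfloor>) \<le> \<delta> * real n"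
      by linarith+
  qed
  show "\<forall>\<^sub>F n in sequentially. \<delta> - 1 / real n \<le> real (nat \<lfloor>\<delta> * real n\<rfloor>) / real n"
    using eventually_gt_at_top[of 0]
  proof eventually_elim
    case (elim n)
    have "(\<delta> * real n - 1) / real n \<le> real (nat \<lfloor>\<delta> * real n\<rfloor>) / real n"
      by (rule divide_right_mono[OF b(1)]) simp
    then show ?case using elim by (simp add: diff_divide_distrib)
  qed
  show "\<forall>\<^sub>F n in sequentially. real (nat \<lfloor>\<delta> * real n\<rfloor>) / real n \<le> \<delta>"
    using eventually_gt_at_top[of 0]
  proof eventually_elim
    case (elim n)
    have "real (nat \<lfloor>\<delta> * real n\<rfloor>) / real n \<le> \<delta> * real n / real n"
      by (rule divide_right_mono[OF b(2)]) simp
    then show ?case using elim by simp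
  qed
  show "(\<lambda>n. \<delta> - 1 / real n) \<longlonglongrightarrow> \<delta>" by real_asymp
qed simp

section \<open>Extremal index and last exceedances in the scenery\<close>

locale scenery_thresholds = random_scenery M \<xi> X \<rho>
  for M :: "'a measure" and \<xi> X \<rho> +
  fixes u :: "real \<Rightarrow> nat \<Rightarrow> real" and k :: nat and \<sigma> :: real
  assumes lim_u: "\<And>\<tau>. \<tau> > 0 \<Longrightarrow> (\<lambda>n. real n * prob {\<omega> \<in> space M. \<xi> 0 \<omega> > u \<tau> n}) \<longlonglongrightarrow> \<tau>"
    and k: "k \<ge> 1"
    and D: "\<And>\<tau>. \<tau> > 0 \<Longrightarrow> D_cond k M (\<lambda>s. \<xi> (int s)) (u \<tau>)"
    and \<sigma>: "0 < \<sigma>"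
    and ext: "has_extremal_index M (\<lambda>s. \<xi> (int s)) u \<sigma>"
begin

abbreviation S :: "nat \<Rightarrow> 'a \<Rightarrow> real" where "S \<equiv> \<lambda>s. \<xi> (int s)"

definition h :: "real \<Rightarrow> real" where "h v = prob {\<omega> \<in> space M. \<xi> 0 \<omega> > v}"

lemma lim_h: "\<tau> > 0 \<Longrightarrow> (\<lambda>n. real n * h (u \<tau> n)) \<longlonglongrightarrow> \<tau>"
  unfolding h_def by (rule lim_u)

lemma h_nonneg [simp]: "0 \<le> h v" by (simp add: h_def)

lemma st_S: "pattern_stationary S"
  using pattern_stationary_scenery[of 1] by simp

text \<open>With m the integer part of \<delta> n, both levels produce an expected number of
  exceedances tending to \<delta> \<tau> in the m + 1 times of {0..m}. Hence one may pass from one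
  threshold sequence to another along a proportional index.\<close>

lemma lim_level_change:
  assumes \<tau>: "\<tau> > 0" and \<delta>: "\<delta> > 0"
  shows "(\<lambda>n. real (Suc (nat \<lfloor>\<delta> * real n\<rfloor>)) * \<bar>h (u \<tau> n) - h (u (\<delta> * \<tau>) (nat \<lfloor>\<delta> * real n\<rfloor>))\<bar>) \<longlonglongrightarrow> 0"
proof -
  let ?m = "\<lambda>n. nat \<lfloor>\<delta> * real n\<rfloor>"
  have mt: "filterlim ?m at_top sequentially" by (rule nat_floor_mult_at_top[OF \<delta>])
  have "(\<lambda>n. real (?m n) / real n + 1 / real n) \<longlonglongrightarrow> \<delta> + 0"
    by (intro tendsto_add nat_floor_mult_ratio lim_1_over_n) (use \<delta> in simp)
  from tendsto_mult[OF this lim_h[OF \<tau>]]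
  have A: "(\<lambda>n. (real (?m n) / real n + 1 / real n) * (real n * h (u \<tau> n))) \<longlonglongrightarrow> \<delta> * \<tau>" by simp
  have A': "(\<lambda>n. real (Suc (?m n)) * h (u \<tau> n)) \<longlonglongrightarrow> \<delta> * \<tau>"
    by (rule Lim_transform_eventually[OF A], use eventually_gt_at_top[of 0] in eventually_elim)
       (simp add: field_simps)
  have "(\<lambda>m. real m * h (u (\<delta> * \<tau>) m) + 1 / real m * (real m * h (u (\<delta> * \<tau>) m))) \<longlonglongrightarrow> \<delta> * \<tau> + 0 * (\<delta> * \<tau>)"
    by (intro tendsto_add tendsto_mult lim_1_over_n lim_h) (use \<tau> \<delta> in simp_all)
  then have "(\<lambda>m. real (Suc m) * h (u (\<delta> * \<tau>) m)) \<longlonglongrightarrow> \<delta> * \<tau> + 0 * (\<delta> * \<tau>)"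
    by (rule Lim_transform_eventually, use eventually_gt_at_top[of 0] in eventually_elim)
       (simp add: field_simps)
  then have B: "(\<lambda>m. real (Suc m) * h (u (\<delta> * \<tau>) m)) \<longlonglongrightarrow> \<delta> * \<tau>" by simp
  have "(\<lambda>n. real (Suc (?m n)) * h (u \<tau> n) - real (Suc (?m n)) * h (u (\<delta> * \<tau>) (?m n))) \<longlonglongrightarrow> \<delta> * \<tau> - \<delta> * \<tau>"
    by (intro tendsto_diff A' filterlim_compose[OF B mt])
  then have "(\<lambda>n. \<bar>real (Suc (?m n)) * h (u \<tau> n) - real (Suc (?m n)) * h (u (\<delta> * \<tau>) (?m n))\<bar>) \<longlonglongrightarrow> 0"
    by (simp add: tendsto_rabs_zero)
  then show ?thesis by (simp only: right_diff_distrib[symmetric] abs_mult abs_of_nat)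
qed

lemma lim_max: 
  assumes "\<tau> > 0"
  shows "(\<lambda>n. prob {\<omega> \<in> space M. \<forall>t\<in>{0..n}. S t \<omega> \<le> u \<tau> n}) \<longlonglongrightarrow> exp (- \<sigma> * \<tau>)"
  using ext assms unfolding has_extremal_index_def range_max_le_iff by blast

lemma S_events: "{\<omega> \<in> space M. \<forall>t\<in>{a..b}. S t \<omega> \<le> v} \<in> events" "{\<omega> \<in> space M. \<exists>t\<in>{a..b}. S t \<omega> > v} \<in> events"
  using measurable_\<xi> by measurable

lemma prob_max_compl: "prob {\<omega> \<in> space M. \<exists>t\<in>{a..b}. S t \<omega> > v} = 1 - prob {\<omega> \<in> space M. \<forall>t\<in>{a..b}. S t \<omega> \<le> v}"
proof -
  have "{\<omega> \<in> space M. \<exists>t\<in>{a..b}. S t \<omega> > v} = space M - {\<omega> \<in> space M. \<forall>t\<in>{a..b}. S t \<omega> \<le> v}" by (auto simp: not_le)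
  then show ?thesis using prob_compl[OF S_events(1)] by simp
qed

text \<open>In a window of length m, about \<delta> n, the level \<open>u \<tau> n\<close> acts like
  \<open>u (\<delta> * \<tau>) m\<close>, for which the extremal index gives the limit.\<close>

lemma lim_max_scaled:
  assumes \<tau>: "\<tau> > 0" and \<delta>: "\<delta> > 0"
  shows "(\<lambda>n. prob {\<omega> \<in> space M. \<exists>t\<in>{0..nat \<lfloor>\<delta> * real n\<rfloor>}. S t \<omega> > u \<tau> n}) \<longlonglongrightarrow> 1 - exp (- \<sigma> * (\<delta> * \<tau>))"
proof -
  let ?m = "\<lambda>n. nat \<lfloor>\<delta> * real n\<rfloor>"
  let ?A = "\<lambda>n. prob {\<omega> \<in> space M. \<exists>t\<in>{0..?m n}. S t \<omega> > u \<tau> n}"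
  let ?B = "\<lambda>m. prob {\<omega> \<in> space M. \<exists>t\<in>{0..m}. S t \<omega> > u (\<delta> * \<tau>) m}"
  have "?B \<longlonglongrightarrow> 1 - exp (- \<sigma> * (\<delta> * \<tau>))"
    unfolding prob_max_compl using \<tau> \<delta> by (intro tendsto_diff tendsto_const lim_max) simp
  then have B: "(\<lambda>n. ?B (?m n)) \<longlonglongrightarrow> 1 - exp (- \<sigma> * (\<delta> * \<tau>))"
    by (rule filterlim_compose[OF _ nat_floor_mult_at_top[OF \<delta>]])
  have le: "norm (?A n - ?B (?m n)) \<le> real (Suc (?m n)) * \<bar>h (u \<tau> n) - h (u (\<delta> * \<tau>) (?m n))\<bar>" for n
    using pattern_level_change[where \<zeta>=S and T="{0..?m n}" and Q="\<lambda>U. U \<noteq> {}" and v="u \<tau> n" and v'="u (\<delta> * \<tau>) (?m n)", OF st_S]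
    by (simp add: h_def Bex_def)
  have "(\<lambda>n. ?A n - ?B (?m n)) \<longlonglongrightarrow> 0"
    by (rule Lim_null_comparison[OF always_eventually lim_level_change[OF \<tau> \<delta>]]) (use le in blast)
  from tendsto_add[OF this B] show ?thesis by simp
qed

text \<open>Among m nearly independent blocks each is free of exceedances with probability 1 minus a
  sum of at least r - l values of \<open>last_prob\<close>, all at least the one at r; then 1 - x
  \<le> exp(-x). Since the left side has a known positive limit, this bounds
  \<open>last_prob\<close> at r from above.\<close>

lemma last_prob_block_bound:
  assumes l: "1 \<le> l" "l < r" "m * r \<le> n"
  shows "prob {\<omega> \<in> space M. \<forall>t\<in>{0..n}. S t \<omega> \<le> w n} - real m * mixing_coeff M S w n l \<le>
    exp (- (real m * (real r - real l) * last_prob S (w n) r))"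
proof -
  let ?v = "w n"
  let ?A = "\<lambda>i. {\<omega> \<in> space M. exceed S ?v (i * r) (Suc i * r - l) \<omega> = 0}"
  let ?p = "prob {\<omega> \<in> space M. exceed S ?v 0 (r - l) \<omega> = 0}"
  have z: "exceed S ?v a b \<omega> = 0 \<longleftrightarrow> (\<forall>t\<in>{a..b}. S t \<omega> \<le> ?v)" for a b \<omega>
    using exceed_pos_iff[of S ?v a b \<omega>] by (auto simp: not_less[symmetric])
  have "\<bar>prob (space M \<inter> (\<Inter>i<m. ?A i)) - (\<Prod>i<m. prob (?A i))\<bar> \<le> real m * mixing_coeff M S w n l"
  proof (rule mixing_blocks)
    fix i show "?A i \<in> level_sigma M S (w n) (i * r) (Suc i * r - l)"
      unfolding exceed_def by (rule level_sigma_pattern[where Q="\<lambda>U. card U = 0"]) simp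
  qed (use l measurable_\<xi> in auto)
  moreover have "prob {\<omega> \<in> space M. \<forall>t\<in>{0..n}. S t \<omega> \<le> ?v} \<le> prob (space M \<inter> (\<Inter>i<m. ?A i))"
  proof (rule finite_measure_mono)
    show "{\<omega> \<in> space M. \<forall>t\<in>{0..n}. S t \<omega> \<le> ?v} \<subseteq> space M \<inter> (\<Inter>i<m. ?A i)"
    proof (intro subsetI IntI INT_I)
      fix \<omega> i assume w: "\<omega> \<in> {\<omega> \<in> space M. \<forall>t\<in>{0..n}. S t \<omega> \<le> ?v}" and i: "i \<in> {..<m}"
      have "Suc i * r \<le> m * r" using i by (intro mult_right_mono) auto
      then have "t \<le> n" if "t \<le> Suc i * r - l" for t using l(3) that by linarith
      with w show "\<omega> \<in> ?A i" by (auto simp: z)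
    qed simp
    have "(\<Inter>i\<in>{..<m}. ?A i) \<inter> space M \<in> events"
      by (cases "m = 0") (auto intro!: sets.Int sets.finite_INT exceed_event measurable_\<xi>)
    then show "space M \<inter> (\<Inter>i<m. ?A i) \<in> events" by (simp add: Int_commute)
  qed
  moreover have "prob (?A i) = ?p" for i
  proof -
    have "Suc i * r - l = (r - l) + i * r" using l by simp
    then show ?thesis using exceed_shift[where \<zeta>=S and a=0 and b="r - l" and h="i * r" and v="?v" and Q="\<lambda>c. c = 0", OF st_S] by simp
  qed
  moreover have "?p ^ m \<le> exp (- (real m * (real r - real l) * last_prob S ?v r))"
  proof -
    have "?p = 1 - (\<Sum>t\<le>r - l. last_prob S ?v t)"
      unfolding z sum_last_prob[OF st_S, symmetric] prob_max_compl by simp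
    moreover have "(\<Sum>t\<le>r - l. last_prob S ?v t) \<ge> (\<Sum>t\<le>r - l. last_prob S ?v r)"
      by (intro sum_mono last_prob_antimono[OF st_S]) auto
    moreover have "(\<Sum>t\<le>r - l. last_prob S ?v r) = (real r - real l + 1) * last_prob S ?v r"
      using l by (simp add: of_nat_diff)
    moreover have "0 \<le> last_prob S ?v r" by (simp add: last_prob_def)
    ultimately have "?p \<le> 1 - (real r - real l) * last_prob S ?v r" by (simp add: algebra_simps)
    also have "\<dots> \<le> exp (- ((real r - real l) * last_prob S ?v r))"
      using exp_ge_add_one_self[of "- ((real r - real l) * last_prob S ?v r)"] by simp
    finally have "?p ^ m \<le> exp (- ((real r - real l) * last_prob S ?v r)) ^ m" by (intro power_mono) auto
    also have "\<dots> = exp (real m * - ((real r - real l) * last_prob S ?v r))" by (rule exp_of_nat_mult[symmetric])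
    finally show ?thesis by (simp add: mult.assoc)
  qed
  ultimately show ?thesis by simp
qed

text \<open>With \<open>s n\<close> blocks of length \<open>n div s n\<close> the mixing error and
  the proportion of time lost to the gaps both vanish. Taking logarithms bounds n times
  \<open>last_prob\<close> at the block length by \<sigma> \<tau> + o(1), and \<open>D_cond\<close>
  carries the bound over to k - 1.\<close>

lemma last_prob_upper:
  assumes \<tau>: "\<tau> > 0"
  shows "\<exists>b. b \<longlonglongrightarrow> \<sigma> * \<tau> \<and> (\<forall>\<^sub>F n in sequentially. real n * last_prob S (u \<tau> n) (k - 1) \<le> b n)"
proof -
  from D[OF \<tau>] obtain s l where
    l: "\<forall>\<^sub>F n in sequentially. 1 \<le> l n \<and> l n \<le> n - 1" and
    s: "filterlim s at_top sequentially" and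
    a: "(\<lambda>n. real (s n) * mixing_coeff M S (u \<tau>) n (l n)) \<longlonglongrightarrow> 0" and
    sl: "(\<lambda>n. real (s n) * real (l n) / real n) \<longlonglongrightarrow> 0" and
    g: "(\<lambda>n. real n * \<P>(\<omega> in M. S 0 \<omega> > u \<tau> n \<and> ereal (u \<tau> n) \<ge> range_max S 1 (k - 1) \<omega> \<and>
                                range_max S k (n div s n) \<omega> > ereal (u \<tau> n))) \<longlonglongrightarrow> 0"
    unfolding D_cond_def by blast
  let ?r = "\<lambda>n. n div s n"
  let ?\<alpha> = "\<lambda>n. mixing_coeff M S (u \<tau>) n (l n)"
  let ?P = "\<lambda>n. prob {\<omega> \<in> space M. \<forall>t\<in>{0..n}. S t \<omega> \<le> u \<tau> n}"
  let ?c = "\<lambda>n. real (s n) * (real (?r n) - real (l n)) / real n"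
  have k1: "{1..<k} = {1..k - 1}" using k by auto
  have g': "(\<lambda>n. real n * gap_prob S (u \<tau> n) k (?r n)) \<longlonglongrightarrow> 0"
    using g unfolding gap_prob_def range_max_le_iff less_range_max_iff k1 by simp
  \<comment> \<open>The constant k + 2 provides two things at once: as \<open>l n\<close> \<ge> 1,
    both (\<open>l n\<close> + 1) \<open>s n\<close> \<le> 2 \<open>s n\<close> \<open>l n\<close>
    and k \<open>s n\<close> \<le> k \<open>s n\<close> \<open>l n\<close> are at most n, so the
    block length exceeds \<open>l n\<close> and is at least k.\<close>
  have "\<forall>\<^sub>F n in sequentially. real (s n) * real (l n) / real n < 1 / real (k + 2)"
    using sl by (rule order_tendstoD) simp
  moreover have "\<forall>\<^sub>F n in sequentially. s n \<ge> 1" using s by (simp add: filterlim_at_top)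
  ultimately have sizes: "\<forall>\<^sub>F n in sequentially. n > 0 \<and> s n \<ge> 1 \<and> 1 \<le> l n \<and> l n < ?r n \<and> k \<le> Suc (?r n)"
    using l eventually_gt_at_top[of 0]
  proof eventually_elim
    case (elim n)
    then have "real (k + 2) * (real (s n) * real (l n)) < real n" by (simp add: field_simps)
    then have "real ((k + 2) * (s n * l n)) < real n" by (simp only: of_nat_mult)
    then have kn: "(k + 2) * (s n * l n) < n" by (simp only: of_nat_less_iff)
    have ssl: "s n * 1 \<le> s n * l n" using elim by (intro mult_left_mono) auto
    have "(l n + 1) * s n = s n * l n + s n * 1" by (simp add: algebra_simps)
    also have "\<dots> \<le> 2 * (s n * l n)" using ssl by linarith
    also have "\<dots> \<le> (k + 2) * (s n * l n)" by (intro mult_right_mono) auto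
    also have "\<dots> \<le> n" using kn by simp
    finally have 1: "l n + 1 \<le> ?r n" using elim by (simp add: less_eq_div_iff_mult_less_eq)
    have "k * s n \<le> k * (s n * l n)" using ssl by (intro mult_left_mono) auto
    also have "\<dots> \<le> (k + 2) * (s n * l n)" by (intro mult_right_mono) auto
    also have "\<dots> \<le> n" using kn by simp
    finally have "k \<le> ?r n" using elim by (simp add: less_eq_div_iff_mult_less_eq)
    with 1 elim show ?case by simp
  qed
  \<comment> \<open>The proportion of time covered by the blocks. The gaps lose \<open>s n\<close>
    \<open>l n\<close>, and the rounding of n / \<open>s n\<close> loses at most \<open>s n\<close>,
    which is no larger.\<close>
  have c: "?c \<longlonglongrightarrow> 1"
  proof (rule tendsto_sandwich[of "\<lambda>n. 1 - 2 * (real (s n) * real (l n) / real n)" _ _ "\<lambda>_. 1"])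
    have "(\<lambda>n. 1 - 2 * (real (s n) * real (l n) / real n)) \<longlonglongrightarrow> 1 - 2 * 0" by (intro tendsto_intros sl)
    then show "(\<lambda>n. 1 - 2 * (real (s n) * real (l n) / real n)) \<longlonglongrightarrow> 1" by simp
    have bd: "\<forall>\<^sub>F n in sequentially. real n - 2 * (real (s n) * real (l n)) \<le> real (s n) * (real (?r n) - real (l n))
        \<and> real (s n) * (real (?r n) - real (l n)) \<le> real n \<and> n > 0"
      using sizes
    proof eventually_elim
      case (elim n)
      have "s n * ?r n + n mod s n = n" by simp
      then have e: "real (s n) * real (?r n) + real (n mod s n) = real n" by (metis of_nat_add of_nat_mult)
      have "real (n mod s n) \<le> real (s n) * 1" using elim by simp
      also have "\<dots> \<le> real (s n) * real (l n)" using elim by (intro mult_left_mono) auto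
      finally have "real (n mod s n) \<le> real (s n) * real (l n)" .
      moreover have "0 \<le> real (s n) * real (l n)" by simp
      ultimately show ?case
        unfolding right_diff_distrib using e conjunct1[OF elim] by (intro conjI) linarith+
    qed
    show "\<forall>\<^sub>F n in sequentially. 1 - 2 * (real (s n) * real (l n) / real n) \<le> ?c n"
      using bd
    proof eventually_elim
      case (elim n)
      then have "(real n - 2 * (real (s n) * real (l n))) / real n \<le> ?c n"
        by (intro divide_right_mono) auto
      then show ?case using elim by (simp add: diff_divide_distrib)
    qed
    show "\<forall>\<^sub>F n in sequentially. ?c n \<le> 1"
      using bd
    proof eventually_elim
      case (elim n)
      then have "?c n \<le> real n / real n" by (intro divide_right_mono) auto
      then show ?case using elim by simp
    qed
  qed simp
  have P: "(\<lambda>n. ?P n - real (s n) * ?\<alpha> n) \<longlonglongrightarrow> exp (- \<sigma> * \<tau>) - 0"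
    by (intro tendsto_diff lim_max \<tau> a)
  then have P': "(\<lambda>n. ?P n - real (s n) * ?\<alpha> n) \<longlonglongrightarrow> exp (- \<sigma> * \<tau>)" by simp
  let ?b = "\<lambda>n. - ln (?P n - real (s n) * ?\<alpha> n) / ?c n + real n * gap_prob S (u \<tau> n) k (?r n)"
  have "?b \<longlonglongrightarrow> - ln (exp (- \<sigma> * \<tau>)) / 1 + 0"
    by (intro tendsto_add tendsto_divide tendsto_minus tendsto_ln P' c g') auto
  then have "?b \<longlonglongrightarrow> \<sigma> * \<tau>" by simp
  moreover have "\<forall>\<^sub>F n in sequentially. real n * last_prob S (u \<tau> n) (k - 1) \<le> ?b n"
  proof -
    have "\<forall>\<^sub>F n in sequentially. ?c n > 0" using c by (rule order_tendstoD) simp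
    moreover have "\<forall>\<^sub>F n in sequentially. ?P n - real (s n) * ?\<alpha> n > 0" using P' by (rule order_tendstoD) simp
    ultimately show ?thesis using sizes
    proof eventually_elim
      case (elim n)
      have "s n * ?r n \<le> n" by simp
      then have "?P n - real (s n) * ?\<alpha> n \<le> exp (- (real (s n) * (real (?r n) - real (l n)) * last_prob S (u \<tau> n) (?r n)))"
        using elim by (intro last_prob_block_bound) auto
      then have "ln (?P n - real (s n) * ?\<alpha> n) \<le> - (real (s n) * (real (?r n) - real (l n)) * last_prob S (u \<tau> n) (?r n))"
        using iffD2[OF ln_le_cancel_iff[OF elim(2) exp_gt_zero]] by (simp only: ln_exp)
      then have "?c n * (real n * last_prob S (u \<tau> n) (?r n)) \<le> - ln (?P n - real (s n) * ?\<alpha> n)"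
        using elim by (simp add: mult.assoc)
      then have "real n * last_prob S (u \<tau> n) (?r n) \<le> - ln (?P n - real (s n) * ?\<alpha> n) / ?c n"
        using elim(1) by (simp only: pos_le_divide_eq mult.commute)
      moreover have "gap_prob S (u \<tau> n) k (?r n) = last_prob S (u \<tau> n) (k - 1) - last_prob S (u \<tau> n) (?r n)"
        by (rule gap_prob_eq[OF st_S k]) (use elim in simp)
      ultimately show ?case by (simp add: right_diff_distrib)
    qed
  qed
  ultimately show ?thesis by blast
qed

text \<open>Compare the windows \<delta> n and 2 \<delta> n: the increase of the probability of an
  exceedance is a sum of about \<delta> n values of \<open>last_prob\<close>, none larger than the
  one at \<delta> n. The resulting bound is a difference quotient, which tends to \<sigma> \<tau> as
  \<delta> tends to 0.\<close>

lemma last_prob_lower: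
  assumes \<tau>: "\<tau> > 0" and \<delta>: "\<delta> > 0"
  shows "\<exists>b. b \<longlonglongrightarrow> (exp (- \<sigma> * (\<delta> * \<tau>)) - exp (- \<sigma> * (2 * \<delta> * \<tau>))) / \<delta> \<and>
    (\<forall>\<^sub>F n in sequentially. b n \<le> real n * last_prob S (u \<tau> n) (nat \<lfloor>\<delta> * real n\<rfloor>))"
proof -
  let ?d = "\<lambda>n. nat \<lfloor>\<delta> * real n\<rfloor>" and ?e = "\<lambda>n. nat \<lfloor>2 * \<delta> * real n\<rfloor>"
  let ?Q = "\<lambda>n d. prob {\<omega> \<in> space M. \<exists>t\<in>{0..d}. S t \<omega> > u \<tau> n}"
  let ?b = "\<lambda>n. (?Q n (?e n) - ?Q n (?d n)) / (real (?d n) / real n + 1 / real n)"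
  have "?b \<longlonglongrightarrow> ((1 - exp (- \<sigma> * (2 * \<delta> * \<tau>))) - (1 - exp (- \<sigma> * (\<delta> * \<tau>)))) / (\<delta> + 0)"
    using \<tau> \<delta> by (intro tendsto_divide tendsto_diff tendsto_add lim_max_scaled nat_floor_mult_ratio lim_1_over_n) auto
  then have "?b \<longlonglongrightarrow> (exp (- \<sigma> * (\<delta> * \<tau>)) - exp (- \<sigma> * (2 * \<delta> * \<tau>))) / \<delta>" by simp
  moreover have "\<forall>\<^sub>F n in sequentially. ?b n \<le> real n * last_prob S (u \<tau> n) (?d n)"
    using eventually_gt_at_top[of 0]
  proof eventually_elim
    case (elim n)
    let ?l = "last_prob S (u \<tau> n)"
    have nn: "0 \<le> \<delta> * real n" using \<delta> by simp
    \<comment> \<open>Rounding may make the second half of the window one longer than the first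
      part, which explains the denominator of \<open>?b\<close>.\<close>
    then have de: "?d n \<le> ?e n" "?e n \<le> Suc (2 * ?d n)" by linarith+
    have "{..?e n} = {..?d n} \<union> {Suc (?d n)..?e n}" using de by auto
    then have "(\<Sum>t\<le>?e n. ?l t) = (\<Sum>t\<le>?d n. ?l t) + (\<Sum>t = Suc (?d n)..?e n. ?l t)"
      by (simp only:) (subst sum.union_disjoint; auto)
    then have "?Q n (?e n) - ?Q n (?d n) = (\<Sum>t = Suc (?d n)..?e n. ?l t)"
      unfolding sum_last_prob[OF st_S] by simp
    also have "\<dots> \<le> (\<Sum>t = Suc (?d n)..?e n. ?l (?d n))"
      by (intro sum_mono last_prob_antimono[OF st_S]) auto
    also have "\<dots> = real (?e n - ?d n) * ?l (?d n)" using de by simp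
    also have "\<dots> \<le> (real (?d n) + 1) * ?l (?d n)"
      using de by (intro mult_right_mono) (auto simp: last_prob_def)
    finally have main: "?Q n (?e n) - ?Q n (?d n) \<le> (real (?d n) + 1) * ?l (?d n)" .
    have "?b n = real n * (?Q n (?e n) - ?Q n (?d n)) / (real (?d n) + 1)"
      using elim by (simp add: add_divide_distrib[symmetric])
    also have "\<dots> \<le> real n * ((real (?d n) + 1) * ?l (?d n)) / (real (?d n) + 1)"
      using main by (intro divide_right_mono mult_left_mono) auto
    also have "\<dots> = real n * ?l (?d n)" by simp
    finally show ?case .
  qed
  ultimately show ?thesis by blast
qed

text \<open>Monotonicity in t spreads the upper bound at k - 1 and the lower bound at \<delta> n to
  all t in between.\<close>

lemma last_prob_asymptotics:
  assumes \<tau>: "\<tau> > 0" and \<epsilon>: "\<epsilon> > 0"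
  shows "\<exists>\<delta>>0. \<forall>\<^sub>F n in sequentially. real n * last_prob \<eta> (u \<tau> n) (k - 1) \<le> \<sigma> * \<tau> + \<epsilon> \<and>
     (\<forall>t. real t \<le> \<delta> * real n \<longrightarrow> real n * last_prob \<eta> (u \<tau> n) t \<ge> \<sigma> * \<tau> - \<epsilon>)"
proof -
  let ?a = "\<sigma> * \<tau>"
  have a: "?a > 0" using \<sigma> \<tau> by simp
  have "((\<lambda>\<delta>. (exp (- (?a * \<delta>)) - exp (- (2 * ?a * \<delta>))) / \<delta>) \<longlongrightarrow> ?a) (at_right 0)"
    using a by real_asymp
  then have "\<forall>\<^sub>F \<delta> in at_right 0. (exp (- (?a * \<delta>)) - exp (- (2 * ?a * \<delta>))) / \<delta> > ?a - \<epsilon>"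
    using \<epsilon> by (intro order_tendstoD) auto
  moreover have "\<forall>\<^sub>F \<delta> in at_right (0 :: real). \<delta> > 0" by (rule eventually_at_right_less)
  ultimately have "\<forall>\<^sub>F \<delta> in at_right 0. \<delta> > 0 \<and> (exp (- (?a * \<delta>)) - exp (- (2 * ?a * \<delta>))) / \<delta> > ?a - \<epsilon>"
    by eventually_elim simp
  then obtain \<delta> where \<delta>: "\<delta> > 0" "(exp (- (?a * \<delta>)) - exp (- (2 * ?a * \<delta>))) / \<delta> > ?a - \<epsilon>"
    using eventually_happens'[OF trivial_limit_at_right_real[of 0]] by blast
  obtain b1 where b1: "b1 \<longlonglongrightarrow> (exp (- \<sigma> * (\<delta> * \<tau>)) - exp (- \<sigma> * (2 * \<delta> * \<tau>))) / \<delta>"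
    "\<forall>\<^sub>F n in sequentially. b1 n \<le> real n * last_prob S (u \<tau> n) (nat \<lfloor>\<delta> * real n\<rfloor>)"
    using last_prob_lower[OF \<tau> \<delta>(1)] by blast
  have b1': "\<forall>\<^sub>F n in sequentially. b1 n > ?a - \<epsilon>"
    using \<delta>(2) by (intro order_tendstoD(1)[OF b1(1)]) (simp add: algebra_simps)
  obtain b2 where b2: "b2 \<longlonglongrightarrow> ?a" "\<forall>\<^sub>F n in sequentially. real n * last_prob S (u \<tau> n) (k - 1) \<le> b2 n"
    using last_prob_upper[OF \<tau>] by blast
  have b2': "\<forall>\<^sub>F n in sequentially. b2 n < ?a + \<epsilon>" using \<epsilon> by (intro order_tendstoD(2)[OF b2(1)]) simp
  have "\<forall>\<^sub>F n in sequentially. real n * last_prob \<eta> (u \<tau> n) (k - 1) \<le> ?a + \<epsilon> \<and>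
     (\<forall>t. real t \<le> \<delta> * real n \<longrightarrow> real n * last_prob \<eta> (u \<tau> n) t \<ge> ?a - \<epsilon>)"
    using b1' b2(2) b2' b1(2)
  proof eventually_elim
    case (elim n)
    have "real n * last_prob S (u \<tau> n) t \<ge> ?a - \<epsilon>" if "real t \<le> \<delta> * real n" for t
    proof -
      have "t \<le> nat \<lfloor>\<delta> * real n\<rfloor>" using that by (rule le_nat_floor)
      then have "real n * last_prob S (u \<tau> n) (nat \<lfloor>\<delta> * real n\<rfloor>) \<le> real n * last_prob S (u \<tau> n) t"
        by (intro mult_left_mono last_prob_antimono[OF st_S]) auto
      then show ?thesis using elim by linarith
    qed
    then show ?case unfolding last_prob_\<eta> using elim by auto
  qed
  with \<delta>(1) show ?thesis by blast
qed

text \<open>The numerator of the conditional probability in the definition of the cluster sizes, for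
  a general window t; it is also the summand of \<open>exceed_telescope\<close>.\<close>

definition visits :: "real \<Rightarrow> nat \<Rightarrow> nat \<Rightarrow> real" where
  "visits v t j = prob {\<omega> \<in> space M. \<zeta> 0 \<omega> > v \<and> exceed \<zeta> v 0 t \<omega> = j}"

text \<open>Prolonging the window changes whether the count is j only if a later exceedance occurs
  after at most j earlier ones: a count of j is lost, or a smaller count may grow to j. This is the
  event of \<open>late_exceedance_bound\<close>.\<close>

lemma visits_diff_le:
  assumes j: "j \<ge> 1" and t: "T \<le> t1" "t1 \<le> t2" and kt: "k \<le> Suc t2"
  shows "\<bar>visits v t1 j - visits v t2 j\<bar> \<le>
    real (Suc (j * k)) * (last_prob \<eta> v (k - 1) - last_prob \<eta> v t2) + h v * prob (space M - good (j * k) T)"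
proof -
  let ?C = "{\<omega> \<in> space M. \<zeta> 0 \<omega> > v \<and> exceed \<zeta> v 0 t1 \<omega> \<le> j \<and> exceed \<zeta> v (Suc t1) t2 \<omega> > 0}"
  have m: "\<zeta> t \<in> borel_measurable M" for t by (rule measurable_scenery_walk)
  have ev: "{\<omega> \<in> space M. \<zeta> 0 \<omega> > v \<and> exceed \<zeta> v 0 t \<omega> = j} \<in> events" for t
    by (rule exceed_event2[where Q="\<lambda>c. c = j"]) (rule m)
  have "\<bar>visits v t1 j - visits v t2 j\<bar> \<le> prob ?C"
    unfolding visits_def
  proof (rule abs_prob_Collect_diff_le[OF ev ev])
    have C: "?C = {\<omega> \<in> space M. \<zeta> 0 \<omega> > v \<and> exceed \<zeta> v 0 t1 \<omega> \<le> j} \<inter> {\<omega> \<in> space M. exceed \<zeta> v (Suc t1) t2 \<omega> > 0}"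
      by auto
    show "?C \<in> events"
      unfolding C by (rule sets.Int[OF exceed_event2[where Q="\<lambda>c. c \<le> j"] exceed_event[where Q="\<lambda>c. c > 0"]]) (rule m)+
    fix \<omega> assume w: "\<omega> \<in> space M" "\<omega> \<notin> ?C"
    have sp: "exceed \<zeta> v 0 t2 \<omega> = exceed \<zeta> v 0 t1 \<omega> + exceed \<zeta> v (Suc t1) t2 \<omega>"
      using t by (intro exceed_split) auto
    show "(\<zeta> 0 \<omega> > v \<and> exceed \<zeta> v 0 t1 \<omega> = j) = (\<zeta> 0 \<omega> > v \<and> exceed \<zeta> v 0 t2 \<omega> = j)"
      using w unfolding sp by auto
  qed
  also have "\<dots> \<le> real (Suc (j * k)) * gap_prob \<eta> v k t2 + prob {\<omega> \<in> space M. \<xi> 0 \<omega> > v} * prob (space M - good (j * k) T)"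
    by (rule late_exceedance_bound[OF j k t])
  finally show ?thesis
    unfolding gap_prob_eq[OF pattern_stationary_\<eta> k kt] h_def .
qed

text \<open>The gap term is small for all windows up to \<delta> n by
  \<open>last_prob_asymptotics\<close>, the term of the walk once T is large. Neither T0 nor
  \<delta> depends on n, and a larger T is always allowed.\<close>

lemma visits_window:
  assumes \<tau>: "\<tau> > 0" and \<epsilon>: "\<epsilon> > 0" and j: "j \<ge> 1"
  shows "\<exists>T0 \<delta>. \<delta> > 0 \<and> (\<forall>T\<ge>T0. \<forall>\<^sub>F n in sequentially. \<forall>t. T \<le> t \<longrightarrow> real t \<le> \<delta> * real n \<longrightarrow>
    \<bar>real n * visits (u \<tau> n) T j - real n * visits (u \<tau> n) t j\<bar> \<le> \<epsilon>)"
proof -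
  let ?L = "j * k"
  \<comment> \<open>The difference of the two values of \<open>last_prob\<close> is within 2
    \<epsilon>1 and is multiplied by the number j k + 1 of sites; the walk contributes (\<tau> + 1)
    \<epsilon>2. Each part amounts to \<epsilon> / 2.\<close>
  define \<epsilon>1 where "\<epsilon>1 = \<epsilon> / (4 * real (Suc ?L))"
  define \<epsilon>2 where "\<epsilon>2 = \<epsilon> / (2 * (\<tau> + 1))"
  have "0 < real (Suc ?L)" by (rule of_nat_0_less_iff[THEN iffD2]) simp
  then have e: "\<epsilon>1 > 0" "\<epsilon>2 > 0"
    unfolding \<epsilon>1_def \<epsilon>2_def using \<epsilon> \<tau> by (intro divide_pos_pos mult_pos_pos; simp del: of_nat_Suc)+
  obtain T1 where T1: "prob (space M - good ?L T1) < \<epsilon>2" using good_exists[OF e(2)] by blast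
  obtain \<delta> where \<delta>: "\<delta> > 0" "\<forall>\<^sub>F n in sequentially. real n * last_prob \<eta> (u \<tau> n) (k - 1) \<le> \<sigma> * \<tau> + \<epsilon>1 \<and>
     (\<forall>t. real t \<le> \<delta> * real n \<longrightarrow> real n * last_prob \<eta> (u \<tau> n) t \<ge> \<sigma> * \<tau> - \<epsilon>1)"
    using last_prob_asymptotics[OF \<tau> e(1)] by blast
  have hb: "\<forall>\<^sub>F n in sequentially. real n * h (u \<tau> n) < \<tau> + 1" by (rule order_tendstoD[OF lim_h[OF \<tau>]]) simp
  have "\<forall>\<^sub>F n in sequentially. \<forall>t. T \<le> t \<longrightarrow> real t \<le> \<delta> * real n \<longrightarrow>
      \<bar>real n * visits (u \<tau> n) T j - real n * visits (u \<tau> n) t j\<bar> \<le> \<epsilon>" if T: "T \<ge> max T1 k" for T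
    using \<delta>(2) hb
  proof eventually_elim
    case (elim n)
    show ?case
    proof (intro allI impI)
      fix t assume t: "T \<le> t" "real t \<le> \<delta> * real n"
      let ?v = "u \<tau> n"
      have "\<bar>real n * visits ?v T j - real n * visits ?v t j\<bar> = real n * \<bar>visits ?v T j - visits ?v t j\<bar>"
        by (simp add: right_diff_distrib[symmetric] abs_mult)
      also have "\<dots> \<le> real n * (real (Suc ?L) * (last_prob \<eta> ?v (k - 1) - last_prob \<eta> ?v t) + h ?v * prob (space M - good ?L T1))"
        using T t by (intro mult_left_mono visits_diff_le[OF j]) auto
      also have "\<dots> = real (Suc ?L) * (real n * last_prob \<eta> ?v (k - 1) - real n * last_prob \<eta> ?v t) + (real n * h ?v) * prob (space M - good ?L T1)"
        by (simp add: algebra_simps)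
      also have "\<dots> \<le> real (Suc ?L) * (2 * \<epsilon>1) + (\<tau> + 1) * \<epsilon>2"
      proof (intro add_mono mult_left_mono mult_mono)
        show "real n * last_prob \<eta> ?v (k - 1) - real n * last_prob \<eta> ?v t \<le> 2 * \<epsilon>1"
          using elim(1) t(2) by (auto dest!: spec[of _ t])
      qed (use elim(2) T1 \<tau> in auto)
      also have "\<dots> = \<epsilon>" using \<tau> by (simp add: \<epsilon>1_def \<epsilon>2_def field_simps del: of_nat_Suc)
      finally show "\<bar>real n * visits ?v T j - real n * visits ?v t j\<bar> \<le> \<epsilon>" .
    qed
  qed
  with \<delta>(1) show ?thesis by (intro exI[of _ "max T1 k"] exI[of _ \<delta>]) blast
qed

text \<open>
  The levels \<open>u \<tau> n\<close> and \<open>u (\<delta> * \<tau>) (\<delta> * n)\<close> have the same tail probability up to o(1/n). This is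
  why convergence of the cluster sizes for one value of \<open>\<tau>\<close> suffices.
\<close>

lemma visits_level_change:
  assumes \<tau>: "\<tau> > 0" and \<delta>: "\<delta> > 0"
  shows "(\<lambda>n. \<delta> * (real n * visits (u \<tau> n) T j) -
    real (nat \<lfloor>\<delta> * real n\<rfloor>) * visits (u (\<delta> * \<tau>) (nat \<lfloor>\<delta> * real n\<rfloor>)) T j) \<longlonglongrightarrow> 0"
proof -
  let ?m = "\<lambda>n. nat \<lfloor>\<delta> * real n\<rfloor>"
  let ?v = "\<lambda>n. u \<tau> n" and ?w = "\<lambda>n. u (\<delta> * \<tau>) (?m n)"
  have pat: "visits v T j = prob {\<omega> \<in> space M. 0 \<in> {t \<in> {0..T}. \<zeta> t \<omega> > v} \<and> card {t \<in> {0..T}. \<zeta> t \<omega> > v} = j}" for v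
    unfolding visits_def exceed_def by (intro arg_cong[where f=prob]) auto
  have "\<bar>visits v T j - visits w T j\<bar> \<le> real (Suc T) * \<bar>h v - h w\<bar>" for v w
    using pattern_level_change[where \<zeta>=\<zeta> and T="{0..T}" and Q="\<lambda>U. 0 \<in> U \<and> card U = j" and v=v and v'=w, OF pattern_stationary_scenery_walk]
    unfolding pat h_def \<zeta>_0 by simp
  then have nle: "norm (real (Suc (?m n)) * (visits (?v n) T j - visits (?w n) T j)) \<le>
      real (Suc T) * (real (Suc (?m n)) * \<bar>h (?v n) - h (?w n)\<bar>)" for n
  proof -
    have "real (Suc (?m n)) * \<bar>visits (?v n) T j - visits (?w n) T j\<bar> \<le> real (Suc (?m n)) * (real (Suc T) * \<bar>h (?v n) - h (?w n)\<bar>)"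
      by (rule mult_left_mono) (fact, simp)
    then show ?thesis by (simp add: abs_mult mult.assoc mult.left_commute)
  qed
  have nz: "(\<lambda>n. real (Suc T) * (real (Suc (?m n)) * \<bar>h (?v n) - h (?w n)\<bar>)) \<longlonglongrightarrow> 0"
    using tendsto_mult_left[OF lim_level_change[OF \<tau> \<delta>], of "real (Suc T)"] by simp
  have A: "(\<lambda>n. real (Suc (?m n)) * (visits (?v n) T j - visits (?w n) T j)) \<longlonglongrightarrow> 0"
    by (rule Lim_null_comparison[OF always_eventually[OF allI[OF nle]] nz])
  have vz: "(\<lambda>n. 2 * visits (?v n) T j) \<longlonglongrightarrow> 0" and wz: "(\<lambda>n. visits (?w n) T j) \<longlonglongrightarrow> 0"
  proof -
    have le: "visits v T j \<le> h v" for v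
      unfolding visits_def h_def \<zeta>_0 using measurable_\<xi>[of 0] by (intro finite_measure_mono) auto
    have hz: "(\<lambda>n. h (u \<tau>' n)) \<longlonglongrightarrow> 0" if "\<tau>' > 0" for \<tau>'
    proof -
      have "(\<lambda>n. 1 / real n * (real n * h (u \<tau>' n))) \<longlonglongrightarrow> 0 * \<tau>'" by (intro tendsto_mult lim_1_over_n lim_h that)
      then have "(\<lambda>n. 1 / real n * (real n * h (u \<tau>' n))) \<longlonglongrightarrow> 0" by simp
      then show ?thesis
        by (rule Lim_transform_eventually, use eventually_gt_at_top[of 0] in eventually_elim) simp
    qed
    have z: "(\<lambda>n. visits (u \<tau>' n) T j) \<longlonglongrightarrow> 0" if "\<tau>' > 0" for \<tau>'
      by (rule Lim_null_comparison[OF always_eventually hz[OF that]]) (use le in \<open>simp add: visits_def\<close>)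
    show "(\<lambda>n. 2 * visits (?v n) T j) \<longlonglongrightarrow> 0" using tendsto_mult_left[OF z[OF \<tau>], of 2] by simp
    have "(\<lambda>m. visits (u (\<delta> * \<tau>) m) T j) \<longlonglongrightarrow> 0" by (rule z) (use \<tau> \<delta> in simp)
    then show "(\<lambda>n. visits (?w n) T j) \<longlonglongrightarrow> 0"
      by (rule filterlim_compose[OF _ nat_floor_mult_at_top[OF \<delta>]])
  qed
  have B: "(\<lambda>n. (\<delta> * real n - real (Suc (?m n))) * visits (?v n) T j) \<longlonglongrightarrow> 0"
  proof (rule Lim_null_comparison[OF always_eventually vz], rule allI)
    fix n
    have "0 \<le> \<delta> * real n" using \<delta> by simp
    then have "\<bar>\<delta> * real n - real (Suc (?m n))\<bar> \<le> 2" by linarith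
    then show "norm ((\<delta> * real n - real (Suc (?m n))) * visits (?v n) T j) \<le> 2 * visits (?v n) T j"
      by (simp add: abs_mult visits_def mult_right_mono del: of_nat_Suc)
  qed
  \<comment> \<open>An exact decomposition of the claim: the change of level, the rounding of
    \<delta> n to an integer plus one, which is at most 2, and the one surplus term.\<close>
  have "(\<lambda>n. real (Suc (?m n)) * (visits (?v n) T j - visits (?w n) T j) +
      (\<delta> * real n - real (Suc (?m n))) * visits (?v n) T j + visits (?w n) T j) \<longlonglongrightarrow> 0 + 0 + 0"
    by (intro tendsto_add A B wz)
  then show ?thesis by (simp add: algebra_simps)
qed

end

lemma card_exceedances:
  assumes "n > 0" shows "card (exceedances \<zeta> v n m \<omega>) = exceed \<zeta> v 0 m \<omega>"
proof -
  have "exceedances \<zeta> v n m \<omega> = (\<lambda>i. real i / real n) ` {t \<in> {0..m}. \<zeta> t \<omega> > v}"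
    by (auto simp: exceedances_def)
  moreover have "inj_on (\<lambda>i. real i / real n) A" for A using assms by (auto simp: inj_on_def)
  ultimately show ?thesis by (simp add: card_image exceed_def)
qed

section \<open>Limits of the cluster sizes and of the block probabilities\<close>

locale exceedance_clusters = scenery_thresholds M \<xi> X \<rho> u k \<sigma>
  for M :: "'a measure" and \<xi> X \<rho> u k \<sigma> +
  fixes kn :: "nat \<Rightarrow> nat" and p :: "nat \<Rightarrow> real" and \<tau>\<^sub>0 :: real
  assumes kn_top: "filterlim kn at_top sequentially"
    and kn_small: "(\<lambda>n. real (kn n)) \<in> o(\<lambda>n. real n)"
    and \<tau>\<^sub>0: "\<tau>\<^sub>0 > 0"
    and lim_p: "\<And>j. j \<ge> 1 \<Longrightarrow>
           (\<lambda>n. \<P>(\<omega> in M. card (exceedances \<zeta> (u \<tau>\<^sub>0 n) n (kn n) \<omega>) = j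
                   \<bar> \<xi> 0 \<omega> > u \<tau>\<^sub>0 n)) \<longlonglongrightarrow> p j"
    and Delta: "\<And>\<tau>. \<tau> > 0 \<Longrightarrow> Delta_cond M \<zeta> (u \<tau>)"
begin

lemma visits_le_h: "visits v T j \<le> h v"
  unfolding visits_def h_def \<zeta>_0 using measurable_\<xi>[of 0] by (intro finite_measure_mono) auto

lemma visits_nonneg [simp]: "0 \<le> visits v T j"
  by (simp add: visits_def)

lemma cond_prob_visits:
  assumes "n > 0"
  shows "\<P>(\<omega> in M. card (exceedances \<zeta> v n m \<omega>) = j \<bar> \<xi> 0 \<omega> > v) = visits v m j / h v"
  unfolding cond_prob_def card_exceedances[OF assms] visits_def h_def \<zeta>_0 by (simp add: conj_commute)

lemma lim_visits_kn:
  assumes "j \<ge> 1"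
  shows "(\<lambda>n. real n * visits (u \<tau>\<^sub>0 n) (kn n) j) \<longlonglongrightarrow> \<tau>\<^sub>0 * p j"
proof -
  have "(\<lambda>n. real n * h (u \<tau>\<^sub>0 n) * \<P>(\<omega> in M. card (exceedances \<zeta> (u \<tau>\<^sub>0 n) n (kn n) \<omega>) = j \<bar> \<xi> 0 \<omega> > u \<tau>\<^sub>0 n)) \<longlonglongrightarrow> \<tau>\<^sub>0 * p j"
    by (intro tendsto_mult lim_h \<tau>\<^sub>0 lim_p assms)
  moreover have "\<forall>\<^sub>F n in sequentially. real n * h (u \<tau>\<^sub>0 n) > 0"
    using lim_h[OF \<tau>\<^sub>0] \<tau>\<^sub>0 by (rule order_tendstoD)
  then have "\<forall>\<^sub>F n in sequentially. real n * h (u \<tau>\<^sub>0 n) * \<P>(\<omega> in M. card (exceedances \<zeta> (u \<tau>\<^sub>0 n) n (kn n) \<omega>) = j \<bar> \<xi> 0 \<omega> > u \<tau>\<^sub>0 n)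
      = real n * visits (u \<tau>\<^sub>0 n) (kn n) j"
    using eventually_gt_at_top[of 0]
    by eventually_elim (auto simp: cond_prob_visits)
  ultimately show ?thesis by (rule Lim_transform_eventually)
qed

lemma kn_eventually:
  assumes "\<delta> > 0" shows "\<forall>\<^sub>F n in sequentially. T \<le> kn n \<and> real (kn n) \<le> \<delta> * real n"
proof -
  have "\<forall>\<^sub>F n in sequentially. T \<le> kn n" using kn_top by (simp add: filterlim_at_top)
  moreover have "\<forall>\<^sub>F n in sequentially. norm (real (kn n)) \<le> \<delta> * norm (real n)"
    by (rule landau_o.smallD[OF kn_small assms])
  ultimately show ?thesis by eventually_elim auto
qed

text \<open>\<open>kn n\<close> eventually lies between T and \<delta> n, so it can be exchanged for
  T. A window of fixed length is wanted because the error of a change of level is proportional to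
  the length.\<close>

lemma visits_fixed_window_\<tau>\<^sub>0:
  assumes \<epsilon>: "\<epsilon> > 0" and j: "j \<ge> 1"
  shows "\<exists>T0. \<forall>T\<ge>T0. \<forall>\<^sub>F n in sequentially. \<bar>real n * visits (u \<tau>\<^sub>0 n) T j - \<tau>\<^sub>0 * p j\<bar> \<le> \<epsilon>"
proof -
  have e2: "\<epsilon> / 2 > 0" using \<epsilon> by simp
  obtain T0 \<delta> where \<delta>: "\<delta> > 0" and w: "\<And>T. T \<ge> T0 \<Longrightarrow> \<forall>\<^sub>F n in sequentially. \<forall>t. T \<le> t \<longrightarrow> real t \<le> \<delta> * real n \<longrightarrow>
    \<bar>real n * visits (u \<tau>\<^sub>0 n) T j - real n * visits (u \<tau>\<^sub>0 n) t j\<bar> \<le> \<epsilon> / 2"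
    using visits_window[OF \<tau>\<^sub>0 e2 j] by blast
  have "\<forall>\<^sub>F n in sequentially. \<bar>real n * visits (u \<tau>\<^sub>0 n) T j - \<tau>\<^sub>0 * p j\<bar> \<le> \<epsilon>" if "T \<ge> T0" for T
  proof -
    have "\<forall>\<^sub>F n in sequentially. dist (real n * visits (u \<tau>\<^sub>0 n) (kn n) j) (\<tau>\<^sub>0 * p j) < \<epsilon> / 2"
      by (rule tendstoD[OF lim_visits_kn[OF j] e2])
    with w[OF that] kn_eventually[OF \<delta>, of T] show ?thesis
    proof eventually_elim
      case (elim n)
      then have "\<bar>real n * visits (u \<tau>\<^sub>0 n) T j - real n * visits (u \<tau>\<^sub>0 n) (kn n) j\<bar> \<le> \<epsilon> / 2" by blast
      with elim(3) show ?case unfolding dist_real_def by linarith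
    qed
  qed
  then show ?thesis by blast
qed

lemma visits_fixed_window:
  assumes \<tau>: "\<tau> > 0" and \<epsilon>: "\<epsilon> > 0" and j: "j \<ge> 1"
  shows "\<exists>T0. \<forall>T\<ge>T0. \<forall>\<^sub>F n in sequentially. \<bar>real n * visits (u \<tau> n) T j - \<tau> * p j\<bar> \<le> \<epsilon>"
proof -
  \<comment> \<open>With this ratio the level \<open>u \<tau> n\<close> is compared to the level of
    \<open>\<tau>\<^sub>0\<close> at the index \<delta> n, where the limit is known.\<close>
  define \<delta> where "\<delta> = \<tau>\<^sub>0 / \<tau>"
  have \<delta>: "\<delta> > 0" and \<delta>\<tau>: "\<delta> * \<tau> = \<tau>\<^sub>0" using \<tau> \<tau>\<^sub>0 by (auto simp: \<delta>_def)
  define e where "e = \<delta> * \<epsilon> / 2"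
  have e: "e > 0" using \<delta> \<epsilon> by (simp add: e_def)
  obtain T0 where T0: "\<And>T. T \<ge> T0 \<Longrightarrow> \<forall>\<^sub>F n in sequentially. \<bar>real n * visits (u \<tau>\<^sub>0 n) T j - \<tau>\<^sub>0 * p j\<bar> \<le> e"
    using visits_fixed_window_\<tau>\<^sub>0[OF e j] by blast
  have "\<forall>\<^sub>F n in sequentially. \<bar>real n * visits (u \<tau> n) T j - \<tau> * p j\<bar> \<le> \<epsilon>" if "T \<ge> T0" for T
  proof -
    let ?m = "\<lambda>n. nat \<lfloor>\<delta> * real n\<rfloor>"
    have "\<forall>\<^sub>F n in sequentially. \<bar>real (?m n) * visits (u \<tau>\<^sub>0 (?m n)) T j - \<tau>\<^sub>0 * p j\<bar> \<le> e"
      by (rule eventually_compose_filterlim[OF T0[OF that] nat_floor_mult_at_top[OF \<delta>]])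
    moreover have "\<forall>\<^sub>F n in sequentially. dist (\<delta> * (real n * visits (u \<tau> n) T j) - real (?m n) * visits (u (\<delta> * \<tau>) (?m n)) T j) 0 < e"
      by (rule tendstoD[OF visits_level_change[OF \<tau> \<delta>] e])
    ultimately show ?thesis
    proof eventually_elim
      case (elim n)
      then have "\<bar>\<delta> * (real n * visits (u \<tau> n) T j) - \<tau>\<^sub>0 * p j\<bar> \<le> 2 * e"
        unfolding \<delta>\<tau> dist_real_def by linarith
      also have "\<delta> * (real n * visits (u \<tau> n) T j) - \<tau>\<^sub>0 * p j = \<delta> * (real n * visits (u \<tau> n) T j - \<tau> * p j)"
        unfolding \<delta>\<tau>[symmetric] by (simp add: algebra_simps)
      finally have "\<delta> * \<bar>real n * visits (u \<tau> n) T j - \<tau> * p j\<bar> \<le> \<delta> * \<epsilon>"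
        using \<delta> by (simp add: abs_mult e_def)
      then show ?case using \<delta> by simp
    qed
  qed
  then show ?thesis by blast
qed

text \<open>Back from the fixed window to all windows up to \<delta> n, now at an arbitrary level
  parameter; the blocks lie in this range once m is large.\<close>

lemma visits_limit:
  assumes \<tau>: "\<tau> > 0" and \<epsilon>: "\<epsilon> > 0" and j: "j \<ge> 1"
  shows "\<exists>T \<delta>. \<delta> > 0 \<and> (\<forall>\<^sub>F n in sequentially. \<forall>t. T \<le> t \<longrightarrow> real t \<le> \<delta> * real n \<longrightarrow>
    \<bar>real n * visits (u \<tau> n) t j - \<tau> * p j\<bar> \<le> \<epsilon>)"
proof -
  have e2: "\<epsilon> / 2 > 0" using \<epsilon> by simp
  obtain T0 \<delta> where \<delta>: "\<delta> > 0" and w: "\<And>T. T \<ge> T0 \<Longrightarrow> \<forall>\<^sub>F n in sequentially. \<forall>t. T \<le> t \<longrightarrow> real t \<le> \<delta> * real n \<longrightarrow>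
    \<bar>real n * visits (u \<tau> n) T j - real n * visits (u \<tau> n) t j\<bar> \<le> \<epsilon> / 2"
    using visits_window[OF \<tau> e2 j] by blast
  obtain T1 where T1: "\<And>T. T \<ge> T1 \<Longrightarrow> \<forall>\<^sub>F n in sequentially. \<bar>real n * visits (u \<tau> n) T j - \<tau> * p j\<bar> \<le> \<epsilon> / 2"
    using visits_fixed_window[OF \<tau> e2 j] by blast
  let ?T = "max T0 T1"
  have "\<forall>\<^sub>F n in sequentially. \<forall>t. ?T \<le> t \<longrightarrow> real t \<le> \<delta> * real n \<longrightarrow>
    \<bar>real n * visits (u \<tau> n) t j - \<tau> * p j\<bar> \<le> \<epsilon>"
    using w[OF max.cobounded1[of T0 T1]] T1[OF max.cobounded2[of T1 T0]]
  proof eventually_elim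
    case (elim n)
    show ?case
    proof (intro allI impI)
      fix t assume "?T \<le> t" "real t \<le> \<delta> * real n"
      then have "\<bar>real n * visits (u \<tau> n) ?T j - real n * visits (u \<tau> n) t j\<bar> \<le> \<epsilon> / 2" using elim(1) by blast
      then show "\<bar>real n * visits (u \<tau> n) t j - \<tau> * p j\<bar> \<le> \<epsilon>" using elim(2) by linarith
    qed
  qed
  with \<delta> show ?thesis by blast
qed

lemma p_nonneg: "j \<ge> 1 \<Longrightarrow> p j \<ge> 0"
  by (rule tendsto_lowerbound[OF lim_p]) (auto simp: cond_prob_def)

lemma sum_p_le_1: "(\<Sum>j = 1..J. p j) \<le> 1"
proof (rule tendsto_upperbound)
  show "(\<lambda>n. \<Sum>j = 1..J. \<P>(\<omega> in M. card (exceedances \<zeta> (u \<tau>\<^sub>0 n) n (kn n) \<omega>) = j \<bar> \<xi> 0 \<omega> > u \<tau>\<^sub>0 n)) \<longlonglongrightarrow> (\<Sum>j = 1..J. p j)"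
    by (intro tendsto_sum lim_p) auto
  show "\<forall>\<^sub>F n in sequentially. (\<Sum>j = 1..J. \<P>(\<omega> in M. card (exceedances \<zeta> (u \<tau>\<^sub>0 n) n (kn n) \<omega>) = j \<bar> \<xi> 0 \<omega> > u \<tau>\<^sub>0 n)) \<le> 1"
    using eventually_gt_at_top[of 0]
  proof eventually_elim
    case (elim n)
    let ?v = "u \<tau>\<^sub>0 n"
    let ?A = "\<lambda>j. {\<omega> \<in> space M. \<zeta> 0 \<omega> > ?v \<and> exceed \<zeta> ?v 0 (kn n) \<omega> = j}"
    have ev: "?A j \<in> events" for j
      by (rule exceed_event2[where Q="\<lambda>c. c = j"]) (rule measurable_scenery_walk)
    have "(\<Sum>j = 1..J. visits ?v (kn n) j) = prob (\<Union>j\<in>{1..J}. ?A j)"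
      unfolding visits_def using ev
      by (intro finite_measure_finite_Union[symmetric]) (auto simp: disjoint_family_on_def)
    also have "\<dots> \<le> h ?v"
      unfolding h_def \<zeta>_0 using measurable_\<xi>[of 0] by (intro finite_measure_mono) auto
    finally have "(\<Sum>j = 1..J. visits ?v (kn n) j) / h ?v \<le> 1"
      by (cases "h ?v = 0") (auto simp: divide_le_eq_1 less_le)
    then show ?case unfolding cond_prob_visits[OF elim] by (simp add: sum_divide_distrib)
  qed
qed auto

text \<open>The p(j) have bounded partial sums. As a consequence the differences p(j) - p(j + 1) sum
  to p(1), which makes the cluster size distribution have total mass 1.\<close>

lemma p_lim_0: "p \<longlonglongrightarrow> 0"
proof -
  have "summable (\<lambda>j. p (Suc j))"
  proof (rule summableI_nonneg_bounded)
    fix n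
    have "(\<Sum>j<n. p (Suc j)) = (\<Sum>j = 1..n. p j)"
      by (rule sum.reindex_bij_witness[of _ "\<lambda>j. j - 1" Suc]) auto
    then show "(\<Sum>j<n. p (Suc j)) \<le> 1" using sum_p_le_1[of n] by simp
  qed (simp add: p_nonneg)
  then have "(\<lambda>j. p (Suc j)) \<longlonglongrightarrow> 0" by (rule summable_LIMSEQ_zero)
  then show ?thesis by (simp add: filterlim_sequentially_Suc)
qed

text \<open>The bounds of \<open>single_exceedance_bounds\<close> with L = k and window
  \<open>kn n\<close>, multiplied by n. The restrictions on \<epsilon> keep both factors of the
  lower bound positive; letting \<epsilon> tend to 0 determines p(1).\<close>

lemma p_1_bounds:
  assumes \<epsilon>: "0 < \<epsilon>" "\<epsilon> < prob escape" "\<epsilon> < \<sigma> * \<tau>\<^sub>0"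
  shows "(\<sigma> * \<tau>\<^sub>0 - \<epsilon>) * (prob escape - \<epsilon>) \<le> \<tau>\<^sub>0 * p 1"
    and "\<tau>\<^sub>0 * p 1 \<le> (\<sigma> * \<tau>\<^sub>0 + \<epsilon>) * prob escape + (\<tau>\<^sub>0 + 1) * \<epsilon>"
proof -
  obtain T where T: "prob (space M - good k T) < \<epsilon>" using good_exists[OF \<epsilon>(1)] by blast
  obtain \<delta> where \<delta>: "\<delta> > 0" and la: "\<forall>\<^sub>F n in sequentially. real n * last_prob \<eta> (u \<tau>\<^sub>0 n) (k - 1) \<le> \<sigma> * \<tau>\<^sub>0 + \<epsilon> \<and>
     (\<forall>t. real t \<le> \<delta> * real n \<longrightarrow> real n * last_prob \<eta> (u \<tau>\<^sub>0 n) t \<ge> \<sigma> * \<tau>\<^sub>0 - \<epsilon>)"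
    using last_prob_asymptotics[OF \<tau>\<^sub>0 \<epsilon>(1)] by blast
  have hb: "\<forall>\<^sub>F n in sequentially. real n * h (u \<tau>\<^sub>0 n) < \<tau>\<^sub>0 + 1" by (rule order_tendstoD[OF lim_h[OF \<tau>\<^sub>0]]) simp
  have "\<forall>\<^sub>F n in sequentially. (\<sigma> * \<tau>\<^sub>0 - \<epsilon>) * (prob escape - \<epsilon>) \<le> real n * visits (u \<tau>\<^sub>0 n) (kn n) 1 \<and>
      real n * visits (u \<tau>\<^sub>0 n) (kn n) 1 \<le> (\<sigma> * \<tau>\<^sub>0 + \<epsilon>) * prob escape + (\<tau>\<^sub>0 + 1) * \<epsilon>"
    using la hb kn_eventually[OF \<delta>, of T]
  proof eventually_elim
    case (elim n)
    let ?v = "u \<tau>\<^sub>0 n" and ?bad = "prob (space M - good k T)"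
    have "(\<sigma> * \<tau>\<^sub>0 - \<epsilon>) * (prob escape - \<epsilon>) \<le> (real n * last_prob \<eta> ?v (kn n)) * (prob escape - ?bad)"
      using elim T \<epsilon> by (intro mult_mono) (auto simp: last_prob_def)
    also have "\<dots> = real n * (last_prob \<eta> ?v (kn n) * (prob escape - ?bad))" by simp
    also have "\<dots> \<le> real n * visits ?v (kn n) 1"
      unfolding visits_def using elim by (intro mult_left_mono single_exceedance_bounds(1)[OF k]) auto
    finally have lower: "(\<sigma> * \<tau>\<^sub>0 - \<epsilon>) * (prob escape - \<epsilon>) \<le> real n * visits ?v (kn n) 1" .
    have "real n * visits ?v (kn n) 1 \<le> real n * (last_prob \<eta> ?v k * prob escape + h ?v * ?bad)"
      unfolding visits_def h_def using elim by (intro mult_left_mono single_exceedance_bounds(2)[OF k]) auto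
    also have "\<dots> = (real n * last_prob \<eta> ?v k) * prob escape + (real n * h ?v) * ?bad"
      by (simp add: algebra_simps)
    also have "\<dots> \<le> (\<sigma> * \<tau>\<^sub>0 + \<epsilon>) * prob escape + (\<tau>\<^sub>0 + 1) * \<epsilon>"
    proof (intro add_mono mult_right_mono mult_mono)
      have "real n * last_prob \<eta> ?v k \<le> real n * last_prob \<eta> ?v (k - 1)"
        by (intro mult_left_mono last_prob_antimono[OF pattern_stationary_\<eta>]) auto
      then show "real n * last_prob \<eta> ?v k \<le> \<sigma> * \<tau>\<^sub>0 + \<epsilon>" using elim by linarith
    qed (use elim T \<tau>\<^sub>0 in auto)
    finally show ?case using lower by blast
  qed
  then have ev: "\<forall>\<^sub>F n in sequentially. (\<sigma> * \<tau>\<^sub>0 - \<epsilon>) * (prob escape - \<epsilon>) \<le> real n * visits (u \<tau>\<^sub>0 n) (kn n) 1"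
    "\<forall>\<^sub>F n in sequentially. real n * visits (u \<tau>\<^sub>0 n) (kn n) 1 \<le> (\<sigma> * \<tau>\<^sub>0 + \<epsilon>) * prob escape + (\<tau>\<^sub>0 + 1) * \<epsilon>"
    by (simp_all add: eventually_conj_iff)
  show "(\<sigma> * \<tau>\<^sub>0 - \<epsilon>) * (prob escape - \<epsilon>) \<le> \<tau>\<^sub>0 * p 1"
    by (rule tendsto_lowerbound[OF lim_visits_kn ev(1)]) auto
  show "\<tau>\<^sub>0 * p 1 \<le> (\<sigma> * \<tau>\<^sub>0 + \<epsilon>) * prob escape + (\<tau>\<^sub>0 + 1) * \<epsilon>"
    by (rule tendsto_upperbound[OF lim_visits_kn ev(2)]) auto
qed

lemma p_1: "p 1 = \<sigma> * prob escape"
proof -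
  have "\<forall>\<^sub>F \<epsilon> in at_right (0 :: real). \<epsilon> < prob escape"
    by (rule order_tendstoD(2)[OF tendsto_ident_at prob_escape_pos])
  moreover have "\<forall>\<^sub>F \<epsilon> in at_right (0 :: real). \<epsilon> < \<sigma> * \<tau>\<^sub>0"
    by (rule order_tendstoD(2)[OF tendsto_ident_at mult_pos_pos[OF \<sigma> \<tau>\<^sub>0]])
  moreover have "\<forall>\<^sub>F \<epsilon> in at_right (0 :: real). \<epsilon> > 0" by (rule eventually_at_right_less)
  ultimately have "\<forall>\<^sub>F \<epsilon> in at_right 0. (\<sigma> * \<tau>\<^sub>0 - \<epsilon>) * (prob escape - \<epsilon>) \<le> \<tau>\<^sub>0 * p 1 \<and>
      \<tau>\<^sub>0 * p 1 \<le> (\<sigma> * \<tau>\<^sub>0 + \<epsilon>) * prob escape + (\<tau>\<^sub>0 + 1) * \<epsilon>"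
    by eventually_elim (use p_1_bounds in blast)
  then have ev: "\<forall>\<^sub>F \<epsilon> in at_right 0. (\<sigma> * \<tau>\<^sub>0 - \<epsilon>) * (prob escape - \<epsilon>) \<le> \<tau>\<^sub>0 * p 1"
      "\<forall>\<^sub>F \<epsilon> in at_right 0. \<tau>\<^sub>0 * p 1 \<le> (\<sigma> * \<tau>\<^sub>0 + \<epsilon>) * prob escape + (\<tau>\<^sub>0 + 1) * \<epsilon>"
    by (simp_all add: eventually_conj_iff)
  have "((\<lambda>\<epsilon>. (\<sigma> * \<tau>\<^sub>0 - \<epsilon>) * (prob escape - \<epsilon>)) \<longlongrightarrow> (\<sigma> * \<tau>\<^sub>0 - 0) * (prob escape - 0)) (at_right 0)"
    by (intro tendsto_intros)
  from tendsto_upperbound[OF this ev(1)] have "\<sigma> * \<tau>\<^sub>0 * prob escape \<le> \<tau>\<^sub>0 * p 1" by simp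
  moreover have "((\<lambda>\<epsilon>. (\<sigma> * \<tau>\<^sub>0 + \<epsilon>) * prob escape + (\<tau>\<^sub>0 + 1) * \<epsilon>) \<longlongrightarrow> (\<sigma> * \<tau>\<^sub>0 + 0) * prob escape + (\<tau>\<^sub>0 + 1) * 0) (at_right 0)"
    by (intro tendsto_intros)
  from tendsto_lowerbound[OF this ev(2)] have "\<tau>\<^sub>0 * p 1 \<le> \<sigma> * \<tau>\<^sub>0 * prob escape" by simp
  ultimately have "\<tau>\<^sub>0 * p 1 = \<tau>\<^sub>0 * (\<sigma> * prob escape)" by (simp add: mult_ac)
  then show ?thesis using \<tau>\<^sub>0 by simp
qed

text \<open>The proportion of times covered by m blocks, each consisting of the
  \<open>n div m - l n + 1\<close> times from 0 to its right end.\<close>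

lemma block_length_ratio:
  assumes m: "m > 0" and l: "(\<lambda>n. real (l n) / real n) \<longlonglongrightarrow> 0"
  shows "(\<lambda>n. real m * (real (n div m) - real (l n) + 1) / real n) \<longlonglongrightarrow> 1"
proof (rule tendsto_sandwich[of "\<lambda>n. 1 - real m * (real (l n) / real n)" _ _ "\<lambda>n. 1 + real m * (1 / real n)"])
  have d: "real n - real m < real m * real (n div m)" "real m * real (n div m) \<le> real n" for n
  proof -
    have "m * (n div m) + n mod m = n" by simp
    then have "real m * real (n div m) + real (n mod m) = real n" by (metis of_nat_add of_nat_mult)
    moreover have "n mod m < m" using m by simp
    ultimately show "real n - real m < real m * real (n div m)" "real m * real (n div m) \<le> real n" by linarith+
  qed
  show "\<forall>\<^sub>F n in sequentially. 1 - real m * (real (l n) / real n) \<le> real m * (real (n div m) - real (l n) + 1) / real n"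
    using eventually_gt_at_top[of 0]
  proof eventually_elim
    case (elim n)
    have "real n - real m * real (l n) \<le> real m * (real (n div m) - real (l n) + 1)"
      using d(1)[of n] by (simp add: algebra_simps)
    then have "(real n - real m * real (l n)) / real n \<le> real m * (real (n div m) - real (l n) + 1) / real n"
      by (rule divide_right_mono) simp
    then show ?case using elim by (simp add: diff_divide_distrib)
  qed
  show "\<forall>\<^sub>F n in sequentially. real m * (real (n div m) - real (l n) + 1) / real n \<le> 1 + real m * (1 / real n)"
    using eventually_gt_at_top[of 0]
  proof eventually_elim
    case (elim n)
    have "real m * (real (n div m) - real (l n) + 1) = real m * real (n div m) - real m * real (l n) + real m"
      by (simp add: algebra_simps)
    also have "\<dots> \<le> real n + real m" using d(2)[of n] mult_nonneg_nonneg[of "real m" "real (l n)"] by linarith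
    finally have "real m * (real (n div m) - real (l n) + 1) / real n \<le> (real n + real m) / real n"
      by (rule divide_right_mono) simp
    then show ?case using elim by (simp add: add_divide_distrib)
  qed
  have "(\<lambda>n. 1 - real m * (real (l n) / real n)) \<longlonglongrightarrow> 1 - real m * 0" by (intro tendsto_intros l)
  then show "(\<lambda>n. 1 - real m * (real (l n) / real n)) \<longlonglongrightarrow> 1" by simp
  show "(\<lambda>n. 1 + real m * (1 / real n)) \<longlonglongrightarrow> 1" by real_asymp
qed

lemma short_gap_eventually:
  assumes m: "m > 0" and l: "(\<lambda>n. real (l n) / real n) \<longlonglongrightarrow> 0"
  shows "\<forall>\<^sub>F n in sequentially. l n < n div m"
proof -
  have "\<forall>\<^sub>F n in sequentially. real m * (real (n div m) - real (l n) + 1) / real n > 1 / 2"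
    by (rule order_tendstoD[OF block_length_ratio[OF m l]]) simp
  \<comment> \<open>For n \<ge> 2 m the summand 1 in each block, in total m, uses up at most n / 2,
    so the remaining length of a block is positive.\<close>
  then show ?thesis using eventually_ge_at_top[of "2 * m"]
  proof eventually_elim
    case (elim n)
    have n0: "real n > 0" using elim(2) m by simp
    have "real m * (real (n div m) - real (l n) + 1) > real n / 2" using elim(1) n0 by (simp add: field_simps)
    moreover have "real n / 2 \<ge> real m" using elim(2) by simp
    ultimately have "real m * (real (n div m) - real (l n) + 1) > real m * 1" by linarith
    then have "real (n div m) - real (l n) + 1 > 1" using m by (subst (asm) mult_less_cancel_left_pos) auto
    then show ?case by linarith
  qed
qed

text \<open>By \<open>exceed_telescope\<close> the tail is a sum over all windows inside the block.
  From T on each term is close to \<tau> p(j) / n, the first T terms are of order 1 / n and fixed in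
  number, and a block has about n / m terms. For m > 1 / \<delta> all windows are short enough for
  \<open>visits_limit\<close>.\<close>

lemma block_tail_limit:
  assumes \<tau>: "\<tau> > 0" and \<epsilon>: "\<epsilon> > 0" and j: "j \<ge> 1" and l: "(\<lambda>n. real (l n) / real n) \<longlonglongrightarrow> 0"
  shows "\<forall>\<^sub>F m in sequentially. \<forall>\<^sub>F n in sequentially.
    \<bar>real m * prob {\<omega> \<in> space M. exceed \<zeta> (u \<tau> n) 0 (n div m - l n) \<omega> \<ge> j} - \<tau> * p j\<bar> \<le> \<epsilon>"
proof -
  have e2: "\<epsilon> / 2 > 0" using \<epsilon> by simp
  obtain T \<delta> where \<delta>: "\<delta> > 0" and vl: "\<forall>\<^sub>F n in sequentially. \<forall>t. T \<le> t \<longrightarrow> real t \<le> \<delta> * real n \<longrightarrow>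
    \<bar>real n * visits (u \<tau> n) t j - \<tau> * p j\<bar> \<le> \<epsilon> / 2"
    using visits_limit[OF \<tau> e2 j] by blast
  \<comment> \<open>A crude bound for the error in short windows, where \<open>visits\<close> is
    only known to be at most the tail probability \<open>h\<close>.\<close>
  define A where "A = \<tau> + 1 + \<tau> * p j"
  have pj: "\<tau> * p j \<ge> 0" using p_nonneg[OF j] \<tau> by simp
  have A: "A > 0" using pj \<tau> by (simp add: A_def)
  have hb: "\<forall>\<^sub>F n in sequentially. real n * h (u \<tau> n) < \<tau> + 1" by (rule order_tendstoD[OF lim_h[OF \<tau>]]) simp
  have "\<forall>\<^sub>F m in sequentially. real m > 1 / \<delta> \<and> m > 0"
    using eventually_gt_at_top[of "nat \<lceil>1 / \<delta>\<rceil>"] by eventually_elim (simp, linarith)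
  then show ?thesis
  proof eventually_elim
    case (elim m)
    then have m: "m > 0" "1 / real m \<le> \<delta>" using \<delta> by (auto simp: field_simps)
    let ?c = "\<lambda>n. real m * (real (n div m) - real (l n) + 1) / real n"
    let ?D = "\<lambda>n. real m * real T * A * (1 / real n) + ?c n * (\<epsilon> / 2) + \<tau> * p j * \<bar>?c n - 1\<bar>"
    have "?D \<longlonglongrightarrow> real m * real T * A * 0 + 1 * (\<epsilon> / 2) + \<tau> * p j * \<bar>1 - 1\<bar>"
      by (intro tendsto_intros block_length_ratio m l lim_1_over_n)
    then have "\<forall>\<^sub>F n in sequentially. ?D n < \<epsilon>" by (rule order_tendstoD) (use \<epsilon> in simp)
    with vl hb short_gap_eventually[OF m(1) l] eventually_gt_at_top[of 0] show ?case
    proof eventually_elim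
      case (elim n)
      let ?v = "u \<tau> n" and ?b = "n div m - l n"
      let ?x = "\<lambda>t. real n * visits ?v t j - \<tau> * p j"
      have b1: "real ?b + 1 = real (n div m) - real (l n) + 1" using elim(3) by simp
      have small: "\<bar>?x t\<bar> \<le> A" for t
      proof -
        have "real n * visits ?v t j \<le> real n * h ?v" by (intro mult_left_mono visits_le_h) simp
        moreover have "0 \<le> real n * visits ?v t j" by simp
        ultimately show ?thesis using elim(2) pj \<tau> unfolding A_def by linarith
      qed
      have large: "\<bar>?x t\<bar> \<le> \<epsilon> / 2" if "T \<le> t" "t \<le> ?b" for t
      proof -
        have "real t \<le> real (n div m)" using that(2) by simp
        also have "\<dots> \<le> real n / real m" by (rule of_nat_div_le_of_nat)
        also have "\<dots> \<le> \<delta> * real n" using mult_right_mono[OF m(2), of "real n"] by simp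
        finally show ?thesis using elim(1) that(1) by blast
      qed
      have "\<bar>\<Sum>t\<le>?b. ?x t\<bar> \<le> (\<Sum>t\<le>?b. \<bar>?x t\<bar>)" by (rule sum_abs)
      also have "\<dots> \<le> (\<Sum>t\<le>?b. (if t < T then A else 0) + \<epsilon> / 2)"
      proof (rule sum_mono)
        fix t assume "t \<in> {..?b}"
        then show "\<bar>?x t\<bar> \<le> (if t < T then A else 0) + \<epsilon> / 2" using small[of t] large[of t] \<epsilon> by auto
      qed
      also have "\<dots> = (\<Sum>t\<in>{t \<in> {..?b}. t < T}. A) + (real ?b + 1) * (\<epsilon> / 2)"
        by (simp only: sum.distrib sum.inter_filter[symmetric] finite_atMost sum_constant) simp
      also have "(\<Sum>t\<in>{t \<in> {..?b}. t < T}. A) \<le> (\<Sum>t\<in>{..<T}. A)"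
        using A by (intro sum_mono2) auto
      finally have S: "\<bar>\<Sum>t\<le>?b. ?x t\<bar> \<le> real T * A + (real ?b + 1) * (\<epsilon> / 2)" by simp
      \<comment> \<open>Separates the two errors: the deviation of the summands from their limit,
        and the deviation of the covered proportion from 1.\<close>
      have alg: "a * V - q = a / c * (c * V - B * q) + q * (a * B / c - 1)" if "c > 0" for a c V B q :: real
        using that by (simp add: field_simps)
      have "prob {\<omega> \<in> space M. exceed \<zeta> ?v 0 ?b \<omega> \<ge> j} = (\<Sum>t\<le>?b. visits ?v t j)"
        unfolding visits_def by (rule exceed_telescope[OF pattern_stationary_scenery_walk j])
      moreover have "(\<Sum>t\<le>?b. ?x t) = real n * (\<Sum>t\<le>?b. visits ?v t j) - (real ?b + 1) * (\<tau> * p j)"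
        by (simp add: sum_subtractf sum_distrib_left)
      ultimately have e: "real m * prob {\<omega> \<in> space M. exceed \<zeta> ?v 0 ?b \<omega> \<ge> j} - \<tau> * p j =
          real m / real n * (\<Sum>t\<le>?b. ?x t) + \<tau> * p j * (?c n - 1)"
        using alg[of "real n" "real m" "\<Sum>t\<le>?b. visits ?v t j" "\<tau> * p j" "real ?b + 1"] elim(4)
        unfolding b1[symmetric] by simp
      have "\<bar>real m * prob {\<omega> \<in> space M. exceed \<zeta> ?v 0 ?b \<omega> \<ge> j} - \<tau> * p j\<bar> \<le>
          real m / real n * \<bar>\<Sum>t\<le>?b. ?x t\<bar> + \<tau> * p j * \<bar>?c n - 1\<bar>"
        unfolding e using p_nonneg[OF j] \<tau> by (intro order_trans[OF abs_triangle_ineq]) (simp add: abs_mult)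
      also have "\<dots> \<le> real m / real n * (real T * A + (real ?b + 1) * (\<epsilon> / 2)) + \<tau> * p j * \<bar>?c n - 1\<bar>"
        by (intro add_right_mono mult_left_mono S) simp
      also have "\<dots> = ?D n" unfolding b1 using elim(4) by (simp add: field_simps)
      finally show ?case using elim(5) by linarith
    qed
  qed
qed

lemma Delta_gap:
  assumes "\<tau> > 0"
  obtains l where "\<forall>\<^sub>F n in sequentially. 1 \<le> l n" "(\<lambda>n. mixing_coeff M \<zeta> (u \<tau>) n (l n)) \<longlonglongrightarrow> 0"
    "(\<lambda>n. real (l n) / real n) \<longlonglongrightarrow> 0"
proof -
  obtain l where l: "\<forall>\<^sub>F n in sequentially. 1 \<le> l n \<and> l n \<le> n - 1"
      "(\<lambda>n. mixing_coeff M \<zeta> (u \<tau>) n (l n)) \<longlonglongrightarrow> 0" "(\<lambda>n. real (l n)) \<in> o(\<lambda>n. real n)"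
    using Delta[OF assms] unfolding Delta_cond_def by blast
  have "\<forall>\<^sub>F n in sequentially. 1 \<le> l n" using l(1) by eventually_elim simp
  from that[OF this l(2) smalloD_tendsto[OF l(3)]] show ?thesis .
qed

text \<open>Obtained from the tails of the block counts, where at least j + 1 exceedances imply at
  least j. It makes the cluster size probabilities non-negative.\<close>

lemma p_antimono:
  assumes j: "j \<ge> 1" shows "p (j + 1) \<le> p j"
proof -
  obtain l where l: "(\<lambda>n. real (l n) / real n) \<longlonglongrightarrow> 0" using Delta_gap[OF \<tau>\<^sub>0] by metis
  have "\<tau>\<^sub>0 * p (j + 1) \<le> \<tau>\<^sub>0 * p j + e" if e: "e > 0" for e
  proof -
    have e2: "e / 2 > 0" using e by simp
    have "\<forall>\<^sub>F m in sequentially. \<forall>\<^sub>F n in sequentially. \<tau>\<^sub>0 * p (j + 1) \<le> \<tau>\<^sub>0 * p j + e"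
      using block_tail_limit[OF \<tau>\<^sub>0 e2 j l] block_tail_limit[OF \<tau>\<^sub>0 e2 le_add2 l, of j]
    proof eventually_elim
      case (elim m)
      from elim show ?case
      proof eventually_elim
        case (elim n)
        have "prob {\<omega> \<in> space M. exceed \<zeta> (u \<tau>\<^sub>0 n) 0 (n div m - l n) \<omega> \<ge> j + 1} \<le> prob {\<omega> \<in> space M. exceed \<zeta> (u \<tau>\<^sub>0 n) 0 (n div m - l n) \<omega> \<ge> j}"
          by (intro finite_measure_mono exceed_event[where Q="\<lambda>c. c \<ge> j"] measurable_scenery_walk) auto
        then have "real m * prob {\<omega> \<in> space M. exceed \<zeta> (u \<tau>\<^sub>0 n) 0 (n div m - l n) \<omega> \<ge> j + 1} \<le> real m * prob {\<omega> \<in> space M. exceed \<zeta> (u \<tau>\<^sub>0 n) 0 (n div m - l n) \<omega> \<ge> j}"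
          by (intro mult_left_mono) auto
        with elim show ?case by linarith
      qed
    qed
    then show ?thesis by (simp add: eventually_const_iff)
  qed
  then have "\<tau>\<^sub>0 * p (j + 1) \<le> \<tau>\<^sub>0 * p j" by (rule field_le_epsilon)
  then show ?thesis using \<tau>\<^sub>0 by simp
qed

lemma block_count_limit:
  assumes \<tau>: "\<tau> > 0" and \<epsilon>: "\<epsilon> > 0" and j: "j \<ge> 1" and l: "(\<lambda>n. real (l n) / real n) \<longlonglongrightarrow> 0"
  shows "\<forall>\<^sub>F m in sequentially. \<forall>\<^sub>F n in sequentially.
    real m * prob {\<omega> \<in> space M. exceed \<zeta> (u \<tau> n) 0 (n div m - l n) \<omega> = j} \<ge> \<tau> * (p j - p (j + 1)) - \<epsilon>"
proof -
  have e2: "\<epsilon> / 2 > 0" using \<epsilon> by simp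
  show ?thesis
    using block_tail_limit[OF \<tau> e2 j l] block_tail_limit[OF \<tau> e2 le_add2 l, of j]
  proof eventually_elim
    case (elim m)
    from elim show ?case
    proof eventually_elim
      case (elim n)
      let ?e = "\<lambda>\<omega>. exceed \<zeta> (u \<tau> n) 0 (n div m - l n) \<omega>"
      have eq: "{\<omega> \<in> space M. ?e \<omega> = j} = {\<omega> \<in> space M. ?e \<omega> \<ge> j} - {\<omega> \<in> space M. ?e \<omega> \<ge> j + 1}" by auto
      have ev: "{\<omega> \<in> space M. ?e \<omega> \<ge> i} \<in> events" for i
        by (rule exceed_event[where Q="\<lambda>c. c \<ge> i"]) (rule measurable_scenery_walk)
      have "prob {\<omega> \<in> space M. ?e \<omega> = j} = prob {\<omega> \<in> space M. ?e \<omega> \<ge> j} - prob {\<omega> \<in> space M. ?e \<omega> \<ge> j + 1}"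
        unfolding eq by (rule finite_measure_Diff[OF ev ev]) auto
      then have "real m * prob {\<omega> \<in> space M. ?e \<omega> = j} = real m * prob {\<omega> \<in> space M. ?e \<omega> \<ge> j} - real m * prob {\<omega> \<in> space M. ?e \<omega> \<ge> j + 1}"
        by (simp add: right_diff_distrib)
      with elim show ?case unfolding right_diff_distrib by linarith
    qed
  qed
qed

lemma block_empty_limit:
  assumes \<tau>: "\<tau> > 0" and \<epsilon>: "\<epsilon> > 0" and l: "(\<lambda>n. real (l n) / real n) \<longlonglongrightarrow> 0"
  shows "\<forall>\<^sub>F m in sequentially. \<forall>\<^sub>F n in sequentially.
    prob {\<omega> \<in> space M. exceed \<zeta> (u \<tau> n) 0 (n div m - l n) \<omega> = 0} \<ge> 1 - (\<tau> * p 1 + \<epsilon>) / real m"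
  using block_tail_limit[OF \<tau> \<epsilon> order_refl l] eventually_gt_at_top[of 0]
proof eventually_elim
  case (elim m)
  note m = elim(2)
  from elim(1) show ?case
  proof eventually_elim
    case (elim n)
    let ?e = "\<lambda>\<omega>. exceed \<zeta> (u \<tau> n) 0 (n div m - l n) \<omega>"
    have eq: "{\<omega> \<in> space M. ?e \<omega> = 0} = space M - {\<omega> \<in> space M. ?e \<omega> \<ge> 1}" by (auto simp: not_le)
    have ev: "{\<omega> \<in> space M. ?e \<omega> \<ge> 1} \<in> events" by (rule exceed_event[where Q="\<lambda>c. c \<ge> 1"]) (rule measurable_scenery_walk)
    have "prob {\<omega> \<in> space M. ?e \<omega> = 0} = 1 - prob {\<omega> \<in> space M. ?e \<omega> \<ge> 1}" unfolding eq by (rule prob_compl[OF ev])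
    moreover have "real m * prob {\<omega> \<in> space M. ?e \<omega> \<ge> 1} \<le> \<tau> * p 1 + \<epsilon>" using elim by linarith
    then have "prob {\<omega> \<in> space M. ?e \<omega> \<ge> 1} \<le> (\<tau> * p 1 + \<epsilon>) / real m" using m by (simp add: pos_le_divide_eq mult.commute)
    ultimately show ?case by linarith
  qed
qed

end

section \<open>Convergence\<close>

context marked_poisson
begin

lemma weight_nonneg: "weight m C \<ge> 0"
  unfolding weight_def by (intro mult_nonneg_nonneg prod_nonneg) (use lam in auto)

lemma point_measures_block_config: "m > 0 \<Longrightarrow> block_config m C \<in> point_measures"
  by (auto simp: point_measures_def block_config_def set_mset_sum_replicate)

lemma sum_weight_le_1:
  assumes "m > 0" shows "(\<Sum>C\<in>configs m L Q. weight m C) \<le> 1"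
proof -
  have "(\<Sum>C\<in>configs m L Q. weight m C) = prob (\<Union>C\<in>configs m L Q. config_event m C)"
    unfolding config_event(1)[OF assms, symmetric]
    using config_event(2)[OF assms] configs_subset disjoint_config_event[OF assms configs_subset(1)]
    by (intro finite_measure_finite_Union[symmetric]) auto
  then show ?thesis by simp
qed

text \<open>Compared block by block: an occupied block loses the factor y, and there are at most Q
  of them because each carries mass at least 1. The factor z for empty blocks is granted to all m
  blocks, which is allowed as z \<le> 1. The factor exp lam strips \<open>weight\<close> of its
  normalization.\<close>

lemma prod_ge_weight:
  assumes C: "C \<in> configs m L Q" and z: "0 \<le> z" "z \<le> 1" and y: "0 \<le> y" "y \<le> 1"
    and g0: "z \<le> g 0" and g: "\<And>c. c \<in> {1..L} \<Longrightarrow> y * (lam / real m * pmf P c) \<le> g c"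
  shows "z ^ m * y ^ Q * (exp lam * weight m C) \<le> (\<Prod>a<m. g (C a))"
proof -
  let ?y = "\<lambda>a. if C a = 0 then 1 else y" and ?x = "\<lambda>a. if C a = 0 then 1 else lam / real m * pmf P (C a)"
  have x0: "0 \<le> ?x a" for a using lam by simp
  have CL: "C a \<le> L" if "a < m" for a using C that by (auto simp: configs_def)
  have "card {a \<in> {..<m}. C a \<noteq> 0} = (\<Sum>a\<in>{a \<in> {..<m}. C a \<noteq> 0}. 1)" by simp
  also have "\<dots> \<le> (\<Sum>a\<in>{a \<in> {..<m}. C a \<noteq> 0}. C a)" by (intro sum_mono) auto
  also have "\<dots> \<le> (\<Sum>a\<in>{..<m}. C a)" by (intro sum_mono2) auto
  also have "\<dots> \<le> Q" using C by (simp add: configs_def)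
  finally have "y ^ Q \<le> y ^ card {a \<in> {..<m}. C a \<noteq> 0}" using y by (intro power_decreasing) auto
  also have "\<dots> = (\<Prod>a\<in>{a \<in> {..<m}. C a \<noteq> 0}. y)" by simp
  also have "\<dots> = (\<Prod>a<m. ?y a)" by (intro prod.mono_neutral_cong_left) auto
  finally have yQ: "y ^ Q \<le> (\<Prod>a<m. ?y a)" .
  have "z ^ m * y ^ Q * (exp lam * weight m C) = z ^ m * y ^ Q * (\<Prod>a<m. ?x a)"
    by (simp add: weight_def exp_minus)
  also have "\<dots> \<le> z ^ m * (\<Prod>a<m. ?y a) * (\<Prod>a<m. ?x a)"
    using z yQ x0 by (intro mult_right_mono mult_left_mono prod_nonneg) auto
  also have "\<dots> = (\<Prod>a<m. z * ?y a * ?x a)" by (simp add: prod.distrib)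
  also have "\<dots> \<le> (\<Prod>a<m. g (C a))"
  proof (rule prod_mono)
    fix a assume a: "a \<in> {..<m}"
    show "0 \<le> z * ?y a * ?x a \<and> z * ?y a * ?x a \<le> g (C a)"
    proof (cases "C a = 0")
      case True then show ?thesis using z g0 by simp
    next
      case False
      then have "y * ?x a \<le> g (C a)" using g[of "C a"] CL[of a] a by simp
      moreover have "0 \<le> y * ?x a" using y x0 by (intro mult_nonneg_nonneg) auto
      moreover have "z * (y * ?x a) \<le> 1 * (y * ?x a)" using z(2) calculation(2) by (rule mult_right_mono)
      moreover have "0 \<le> z * (y * ?x a)" using z(1) calculation(2) by (rule mult_nonneg_nonneg)
      ultimately show ?thesis using False by (simp add: mult.assoc)
    qed
  qed
  finally show ?thesis .
qed

end

section \<open>Comparison of the exceedance process with block configurations\<close>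

lemma sum_singleton_mset: "(\<Sum>i\<in>A. {#x#}) = replicate_mset (card A) x"
  by (induction A rule: infinite_finite_induct) auto

lemma image_mset_mset_set_sum: "finite A \<Longrightarrow> image_mset f (mset_set A) = (\<Sum>i\<in>A. {#f i#})"
  by (induction A rule: finite_induct) auto

lemma mset_set_exceedances:
  assumes "n > 0"
  shows "mset_set (exceedances \<zeta> v n n \<omega>) = image_mset (\<lambda>i. real i / real n) (mset_set {t \<in> {0..n}. \<zeta> t \<omega> > v})"
proof -
  have "exceedances \<zeta> v n n \<omega> = (\<lambda>i. real i / real n) ` {t \<in> {0..n}. \<zeta> t \<omega> > v}"
    by (auto simp: exceedances_def)
  moreover have "inj_on (\<lambda>i. real i / real n) A" for A using assms by (auto simp: inj_on_def)
  ultimately show ?thesis by (simp add: image_mset_mset_set)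
qed

lemma block_div:
  fixes r :: nat
  assumes "i \<in> {a * r..Suc a * r - l}" "1 \<le> l" "l < r"
  shows "i div r = a"
proof (rule div_nat_eqI)
  show "r * a \<le> i" using assms by (simp add: mult.commute)
  have "i \<le> Suc a * r - l" using assms(1) by simp
  also have "\<dots> < Suc a * r" using assms by (intro diff_less) auto
  finally show "i < r * Suc a" by (simp only: mult.commute)
qed

text \<open>Rounding n / m shifts the start of block a by at most a times, fewer than m. The
  assumption m * m \<le> n makes this shift at most n / m, the length of one block.\<close>

lemma block_position:
  fixes n m i a :: nat
  assumes m: "m > 0" and n: "m * m \<le> n" and a: "a < m" and i: "a * (n div m) \<le> i" "i < Suc a * (n div m)"
  shows "\<bar>real i / real n - real a / real m\<bar> \<le> 1 / real m"
proof -
  let ?r = "n div m"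
  have n0: "n > 0" using m n by (metis mult_pos_pos order.strict_trans2)
  have "m * ?r + n mod m = n" by simp
  then have e: "real m * real ?r + real (n mod m) = real n" by (metis of_nat_add of_nat_mult)
  have "n mod m < m" using m by simp
  then have lo: "real n - real m \<le> real m * real ?r" and up: "real m * real ?r \<le> real n" using e by linarith+
  have i': "real a * real ?r \<le> real i" "real i \<le> (real a + 1) * real ?r"
  proof -
    show "real a * real ?r \<le> real i" using i(1) by (metis of_nat_le_iff of_nat_mult)
    have "real i \<le> real (Suc a * ?r)" using i(2) by (intro of_nat_mono) simp
    then show "real i \<le> (real a + 1) * real ?r" by (simp add: algebra_simps)
  qed
  have "real m * real i \<le> real m * ((real a + 1) * real ?r)" using i'(2) by (intro mult_left_mono) auto
  also have "\<dots> = (real a + 1) * (real m * real ?r)" by simp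
  also have "\<dots> \<le> (real a + 1) * real n" using up by (intro mult_left_mono) auto
  finally have 1: "real m * real i \<le> (real a + 1) * real n" .
  have "real a * real m \<le> real m * real m" using a by (intro mult_right_mono) auto
  also have "\<dots> \<le> real n" using n by (metis of_nat_le_iff of_nat_mult)
  finally have "real a * real n - real n \<le> real a * (real n - real m)" by (simp add: algebra_simps)
  also have "\<dots> \<le> real a * (real m * real ?r)" using lo by (intro mult_left_mono) auto
  also have "\<dots> = real m * (real a * real ?r)" by simp
  also have "\<dots> \<le> real m * real i" using i'(1) by (intro mult_left_mono) auto
  finally have 2: "real a * real n - real n \<le> real m * real i" .
  have "real i / real n - real a / real m = (real m * real i - real a * real n) / (real m * real n)"
    using m n0 by (simp add: field_simps)
  moreover have "\<bar>real m * real i - real a * real n\<bar> \<le> real n" using 1 2 by (simp add: algebra_simps abs_le_iff)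
  then have "\<bar>real m * real i - real a * real n\<bar> / (real m * real n) \<le> real n / (real m * real n)"
    by (intro divide_right_mono) auto
  ultimately show ?thesis using m n0 by (simp add: abs_divide)
qed

locale cluster_limit = exceedance_clusters M \<xi> X \<rho> u k \<sigma> kn p \<tau>\<^sub>0
  for M :: "'a measure" and \<xi> X \<rho> u k \<sigma> kn p \<tau>\<^sub>0 +
  fixes \<tau> :: real and P :: "nat pmf"
  assumes \<tau>: "\<tau> > 0" and P0: "pmf P 0 = 0"
    and P: "\<And>j. j \<ge> 1 \<Longrightarrow> pmf P j = (p j - p (j + 1)) / p 1"
begin

lemma p1_pos: "p 1 > 0"
  unfolding p_1 using \<sigma> prob_escape_pos by simp

sublocale MP: marked_poisson "p 1 * \<tau>" P
  by unfold_locales (use p1_pos \<tau> P0 in simp_all)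

abbreviation "v \<equiv> u \<tau>"

definition Y :: "nat \<Rightarrow> 'a \<Rightarrow> real multiset" where
  "Y n \<omega> = mset_set (exceedances \<zeta> (v n) n n \<omega>)"

lemma point_measures_Y: "Y n \<omega> \<in> point_measures"
proof -
  have "exceedances \<zeta> (v n) n n \<omega> = (\<lambda>i. real i / real n) ` {t \<in> {0..n}. \<zeta> t \<omega> > v n}"
    by (auto simp: exceedances_def)
  then show ?thesis by (auto simp: Y_def point_measures_def divide_le_eq_1)
qed

lemma measurable_Y: "Y n \<in> M \<rightarrow>\<^sub>M borel_of_topology vague_topology"
proof (rule measurable_borel_of_topologyI)
  show "Y n \<omega> \<in> topspace vague_topology" for \<omega> using point_measures_Y by simp
  fix U assume "openin vague_topology U"
  let ?Q = "\<lambda>I. mset_set ((\<lambda>i. real i / real n) ` I) \<in> U"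
  have "exceedances \<zeta> (v n) n n \<omega> = (\<lambda>i. real i / real n) ` {t \<in> {0..n}. \<zeta> t \<omega> > v n}" for \<omega>
    by (auto simp: exceedances_def)
  then have "Y n -` U \<inter> space M = {\<omega> \<in> space M. ?Q {t \<in> {0..n}. \<zeta> t \<omega> > v n}}"
    by (auto simp: Y_def)
  also have "\<dots> \<in> events"
    by (rule pattern_event[where T="{0..n}" and Q="?Q" and \<zeta>=\<zeta>]) (auto intro: measurable_scenery_walk)
  finally show "Y n -` U \<inter> space M \<in> events" .
qed

text \<open>The second clause excludes exceedances in the gaps and after the last block, so that C
  describes the whole process up to displacements inside the blocks.\<close>

definition Y_config :: "nat \<Rightarrow> nat \<Rightarrow> nat \<Rightarrow> (nat \<Rightarrow> nat) \<Rightarrow> 'a set" where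
  "Y_config n m l C = {\<omega> \<in> space M. (\<forall>a<m. exceed \<zeta> (v n) (a * (n div m)) (Suc a * (n div m) - l) \<omega> = C a) \<and>
     (\<forall>i\<in>{0..n}. (\<forall>a<m. i \<notin> {a * (n div m)..Suc a * (n div m) - l}) \<longrightarrow> \<zeta> i \<omega> \<le> v n)}"

text \<open>The error consists of the mixing coefficients for m blocks and the expected number of
  exceedances at the times not covered by any block, counted exactly.\<close>

lemma prob_Y_config:
  assumes m: "m > 0" and l: "1 \<le> l" "l < n div m"
  shows "Y_config n m l C \<in> events"
    and "prob (Y_config n m l C) \<ge> (\<Prod>a<m. prob {\<omega> \<in> space M. exceed \<zeta> (v n) 0 (n div m - l) \<omega> = C a}) -
      (real m * mixing_coeff M \<zeta> v n l + (real n + 1 - real m * (real (n div m) - real l + 1)) * h (v n))"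
proof -
  let ?r = "n div m"
  let ?I = "\<lambda>a. {a * ?r..Suc a * ?r - l}"
  let ?A = "\<lambda>a. {\<omega> \<in> space M. exceed \<zeta> (v n) (a * ?r) (Suc a * ?r - l) \<omega> = C a}"
  let ?B = "space M \<inter> (\<Inter>a<m. ?A a)"
  let ?O = "{0..n} - (\<Union>a\<in>{..<m}. ?I a)"
  let ?U = "\<Union>i\<in>?O. {\<omega> \<in> space M. \<zeta> i \<omega> > v n}"
  have mz: "\<zeta> i \<in> borel_measurable M" for i by (rule measurable_scenery_walk)
  have eq: "Y_config n m l C = ?B - ?U"
  proof (intro set_eqI iffI)
    fix \<omega> assume "\<omega> \<in> ?B - ?U"
    then have w: "\<omega> \<in> space M" "\<And>a. a < m \<Longrightarrow> \<omega> \<in> ?A a" "\<omega> \<notin> ?U" by auto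
    have "\<zeta> i \<omega> \<le> v n" if "i \<in> {0..n}" "\<forall>a<m. i \<notin> ?I a" for i
    proof (rule ccontr)
      assume "\<not> \<zeta> i \<omega> \<le> v n"
      then have "\<omega> \<in> {\<omega> \<in> space M. \<zeta> i \<omega> > v n}" using w(1) by simp
      moreover have "i \<in> ?O" using that by blast
      ultimately show False using w(3) by blast
    qed
    then show "\<omega> \<in> Y_config n m l C" unfolding Y_config_def using w(1,2) by blast
  next
    fix \<omega> assume w: "\<omega> \<in> Y_config n m l C"
    have "\<omega> \<notin> ?U"
    proof
      assume "\<omega> \<in> ?U"
      then obtain i where i: "i \<in> ?O" "\<zeta> i \<omega> > v n" by blast
      then have "\<forall>a<m. i \<notin> ?I a" "i \<in> {0..n}" by blast+
      then have "\<zeta> i \<omega> \<le> v n" using w unfolding Y_config_def by blast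
      with i(2) show False by simp
    qed
    moreover have "\<omega> \<in> ?B" using w unfolding Y_config_def by blast
    ultimately show "\<omega> \<in> ?B - ?U" by blast
  qed
  have A: "?A a \<in> events" for a by (rule exceed_event[where Q="\<lambda>c. c = C a"]) (rule mz)
  have B: "?B \<in> events"
    by (intro sets.Int sets.top sets.finite_INT A) (use m in auto)
  have U1: "{\<omega> \<in> space M. \<zeta> i \<omega> > v n} \<in> events" for i using mz[of i] by measurable
  have U: "?U \<in> events" by (intro sets.finite_UN U1) simp
  show "Y_config n m l C \<in> events" unfolding eq by (rule sets.Diff[OF B U])
  have mr: "m * ?r \<le> n" by simp
  have "\<bar>prob ?B - (\<Prod>a<m. prob (?A a))\<bar> \<le> real m * mixing_coeff M \<zeta> v n l"
  proof (rule mixing_blocks[OF mz l mr])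
    fix a show "?A a \<in> level_sigma M \<zeta> (v n) (a * ?r) (Suc a * ?r - l)"
      unfolding exceed_def by (rule level_sigma_pattern[where Q="\<lambda>U. card U = C a"]) simp
  qed
  moreover have "prob (?A a) = prob {\<omega> \<in> space M. exceed \<zeta> (v n) 0 (?r - l) \<omega> = C a}" for a
  proof -
    have "Suc a * ?r - l = (?r - l) + a * ?r" using l by simp
    then show ?thesis using exceed_shift[where \<zeta>=\<zeta> and a=0 and b="?r - l" and h="a * ?r" and v="v n" and Q="\<lambda>c. c = C a", OF pattern_stationary_scenery_walk] by simp
  qed
  moreover have "prob ?B - prob ?U \<le> prob (?B - ?U)"
  proof -
    have "prob ?B \<le> prob ((?B - ?U) \<union> ?U)" using B U by (intro finite_measure_mono) auto
    also have "\<dots> \<le> prob (?B - ?U) + prob ?U" using B U by (intro measure_Un_le) auto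
    finally show ?thesis by simp
  qed
  moreover have "prob ?U \<le> (real n + 1 - real m * (real ?r - real l + 1)) * h (v n)"
  proof -
    have "prob ?U \<le> (\<Sum>i\<in>?O. prob {\<omega> \<in> space M. \<zeta> i \<omega> > v n})"
      using U1 by (intro finite_measure_subadditive_finite) auto
    also have "\<dots> = real (card ?O) * h (v n)"
      unfolding h_def pattern_stationary_single[OF pattern_stationary_scenery_walk] \<zeta>_0 by simp
    also have "card ?O = n + 1 - m * (?r - l + 1)"
    proof -
      have sub: "(\<Union>a\<in>{..<m}. ?I a) \<subseteq> {0..n}"
      proof (rule UN_least)
        fix a assume "a \<in> {..<m}"
        then have "Suc a * ?r \<le> m * ?r" by (intro mult_right_mono) auto
        then have "Suc a * ?r - l \<le> n" using mr by linarith
        then show "?I a \<subseteq> {0..n}" by auto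
      qed
      have "card (\<Union>a\<in>{..<m}. ?I a) = (\<Sum>a\<in>{..<m}. card (?I a))"
      proof (rule card_UN_disjoint)
        show "\<forall>a\<in>{..<m}. \<forall>b\<in>{..<m}. a \<noteq> b \<longrightarrow> ?I a \<inter> ?I b = {}"
        proof (intro ballI impI equals0I)
          fix a b t assume "a \<noteq> b" "t \<in> ?I a \<inter> ?I b"
          then show False using block_div[OF _ l, of t a] block_div[OF _ l, of t b] by blast
        qed
      qed auto
      also have "\<dots> = m * (?r - l + 1)"
      proof -
        have "card (?I a) = ?r - l + 1" for a using l by simp
        then show ?thesis by simp
      qed
      finally show ?thesis using card_Diff_subset[OF _ sub] by simp
    qed
    also have "real (n + 1 - m * (?r - l + 1)) = real n + 1 - real m * (real ?r - real l + 1)"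
    proof -
      have "m * (?r - l + 1) \<le> m * ?r" using l by (intro mult_left_mono) auto
      then have "m * (?r - l + 1) \<le> n + 1" using mr by linarith
      moreover have "real (m * (?r - l + 1)) = real m * (real ?r - real l + 1)"
        using l by (simp add: of_nat_diff distrib_left)
      ultimately show ?thesis by (simp only: of_nat_diff of_nat_add of_nat_1)
    qed
    finally show ?thesis .
  qed
  ultimately show "prob (Y_config n m l C) \<ge> (\<Prod>a<m. prob {\<omega> \<in> space M. exceed \<zeta> (v n) 0 (?r - l) \<omega> = C a}) -
      (real m * mixing_coeff M \<zeta> v n l + (real n + 1 - real m * (real ?r - real l + 1)) * h (v n))"
    unfolding eq by simp
qed

text \<open>Replacing each exceedance time i by its block number \<open>i div r\<close>, with r the
  block length, turns the process into the block configuration and moves no point by more than 1 /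
  m.\<close>

lemma Y_near_block_config:
  fixes F :: "real multiset \<Rightarrow> real"
  assumes m: "m > 0" and l: "1 \<le> l" "l < n div m" and n: "m * m \<le> n"
    and w: "\<omega> \<in> Y_config n m l C" and Q: "sum C {..<m} \<le> Q"
    and uc: "\<And>(A :: nat multiset) y z. size A \<le> Q \<Longrightarrow> (\<forall>i\<in>#A. y i \<in> {0..1} \<and> z i \<in> {0..1} \<and> \<bar>y i - z i\<bar> \<le> \<delta>) \<Longrightarrow>
      \<bar>F (image_mset y A) - F (image_mset z A)\<bar> \<le> \<kappa>"
    and \<delta>: "1 / real m \<le> \<delta>"
  shows "F (MP.block_config m C) - \<kappa> \<le> F (Y n \<omega>)"
proof -
  let ?r = "n div m"
  let ?I = "\<lambda>a. {t \<in> {a * ?r..Suc a * ?r - l}. \<zeta> t \<omega> > v n}"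
  let ?J = "{t \<in> {0..n}. \<zeta> t \<omega> > v n}"
  have n0: "n > 0" using m n by (metis mult_pos_pos order.strict_trans2)
  have mr: "m * ?r \<le> n" by simp
  have cI: "card (?I a) = C a" if "a < m" for a using w that by (simp add: Y_config_def exceed_def)
  have in_block: "\<exists>a<m. t \<in> ?I a" if "t \<in> ?J" for t
  proof (rule ccontr)
    assume "\<not> (\<exists>a<m. t \<in> ?I a)"
    then have "\<forall>a<m. t \<notin> {a * ?r..Suc a * ?r - l}" using that by blast
    moreover have "t \<in> {0..n}" using that by simp
    ultimately have "\<zeta> t \<omega> \<le> v n" using w unfolding Y_config_def by blast
    then show False using that by simp
  qed
  have J: "?J = (\<Union>a\<in>{..<m}. ?I a)"
  proof (intro equalityI subsetI)
    fix t assume "t \<in> ?J" then show "t \<in> (\<Union>a\<in>{..<m}. ?I a)" using in_block by blast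
  next
    fix t assume "t \<in> (\<Union>a\<in>{..<m}. ?I a)"
    then obtain a where a: "a < m" "t \<in> ?I a" by blast
    have "Suc a * ?r \<le> m * ?r" using a by (intro mult_right_mono) auto
    moreover have "t \<le> Suc a * ?r - l" "\<zeta> t \<omega> > v n" using a(2) by simp_all
    ultimately have "t \<le> n" using mr by linarith
    with \<open>\<zeta> t \<omega> > v n\<close> show "t \<in> ?J" by simp
  qed
  have div: "t div ?r = a" if "t \<in> ?I a" for t a by (rule block_div[OF _ l]) (use that in simp)
  let ?y = "\<lambda>i. real i / real n" and ?z = "\<lambda>i. real (i div ?r) / real m"
  have "image_mset ?z (mset_set ?J) = (\<Sum>i\<in>?J. {#?z i#})" by (rule image_mset_mset_set_sum) simp
  also have "\<dots> = (\<Sum>a\<in>{..<m}. \<Sum>i\<in>?I a. {#?z i#})"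
    unfolding J
  proof (rule sum.UNION_disjoint)
    show "\<forall>a\<in>{..<m}. \<forall>b\<in>{..<m}. a \<noteq> b \<longrightarrow> ?I a \<inter> ?I b = {}"
    proof (intro ballI impI equals0I)
      fix a b t assume "a \<noteq> b" "t \<in> ?I a \<inter> ?I b"
      then show False using div[of t a] div[of t b] by blast
    qed
  qed auto
  also have "\<dots> = (\<Sum>a\<in>{..<m}. replicate_mset (C a) (real a / real m))"
  proof (rule sum.cong[OF refl])
    fix a assume a: "a \<in> {..<m}"
    have "(\<Sum>i\<in>?I a. {#?z i#}) = (\<Sum>i\<in>?I a. {#real a / real m#})"
      by (intro sum.cong refl) (simp add: div)
    then show "(\<Sum>i\<in>?I a. {#?z i#}) = replicate_mset (C a) (real a / real m)"
      unfolding sum_singleton_mset using cI[of a] a by simp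
  qed
  finally have D: "image_mset ?z (mset_set ?J) = MP.block_config m C" by (simp add: MP.block_config_def)
  have "size (mset_set ?J) = size (image_mset ?z (mset_set ?J))" by simp
  also have "\<dots> \<le> Q" unfolding D MP.size_block_config by (rule Q)
  finally have size: "size (mset_set ?J) \<le> Q" .
  have "\<bar>F (image_mset ?y (mset_set ?J)) - F (image_mset ?z (mset_set ?J))\<bar> \<le> \<kappa>"
  proof (rule uc[OF size], rule ballI)
    fix i assume "i \<in># mset_set ?J"
    then have iJ: "i \<in> ?J" by simp
    then obtain a where a: "a < m" "i \<in> ?I a" using in_block by blast
    have ia: "i div ?r = a" using div[OF a(2)] .
    have "i < Suc a * ?r"
    proof -
      have "Suc a * ?r - l < Suc a * ?r" using l by (intro diff_less) auto
      then show ?thesis using a(2) by auto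
    qed
    then have "\<bar>?y i - real a / real m\<bar> \<le> 1 / real m"
      using a by (intro block_position[OF m n a(1)]) auto
    then have "\<bar>?y i - ?z i\<bar> \<le> \<delta>" unfolding ia using \<delta> by linarith
    moreover have "?y i \<in> {0..1}" using iJ n0 by simp
    moreover have "?z i \<in> {0..1}" unfolding ia using a m by simp
    ultimately show "?y i \<in> {0..1} \<and> ?z i \<in> {0..1} \<and> \<bar>?y i - ?z i\<bar> \<le> \<delta>" by blast
  qed
  then show ?thesis unfolding D Y_def mset_set_exceedances[OF n0] by linarith
qed

text \<open>The configuration events are disjoint. On them F is known up to \<kappa>, which costs at
  most \<kappa> in total, and elsewhere F \<ge> 0 suffices.\<close>

lemma integral_Y_ge:
  fixes F :: "real multiset \<Rightarrow> real"
  assumes m: "m > 0" and l: "1 \<le> l" "l < n div m"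
    and F: "continuous_map vague_topology euclideanreal F" "\<And>N. N \<in> point_measures \<Longrightarrow> F N \<in> {0..1}"
    and near: "\<And>\<omega> C. C \<in> MP.configs m L Q \<Longrightarrow> \<omega> \<in> Y_config n m l C \<Longrightarrow> F (MP.block_config m C) - \<kappa> \<le> F (Y n \<omega>)"
    and \<kappa>: "\<kappa> \<ge> 0"
  shows "(\<Sum>C\<in>MP.configs m L Q. prob (Y_config n m l C) * F (MP.block_config m C)) - \<kappa> \<le> (\<integral>\<omega>. F (Y n \<omega>) \<partial>M)"
proof -
  let ?C = "MP.configs m L Q"
  let ?A = "\<lambda>C. Y_config n m l C"
  have A: "?A C \<in> events" for C by (rule prob_Y_config(1)[OF m l])
  have fin: "finite ?C" by (rule MP.configs_subset(2))
  have unique: "C = C'" if C: "C \<in> ?C" "C' \<in> ?C" "\<omega> \<in> ?A C" "\<omega> \<in> ?A C'" for C C' \<omega>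
  proof -
    have "C a = C' a" if "a < m" for a
    proof -
      have "exceed \<zeta> (v n) (a * (n div m)) (Suc a * (n div m) - l) \<omega> = C a"
        using C(3) that unfolding Y_config_def by blast
      moreover have "exceed \<zeta> (v n) (a * (n div m)) (Suc a * (n div m) - l) \<omega> = C' a"
        using C(4) that unfolding Y_config_def by blast
      ultimately show ?thesis by simp
    qed
    then show ?thesis
      using C(1,2) MP.configs_subset(1)[of m L Q] by (intro PiE_ext[of C "{..<m}" "\<lambda>_. {..L}" C']) auto
  qed
  have int: "integrable M (indicator (?A C) :: _ \<Rightarrow> real)" for C
    by (intro integrable_real_indicator A) (simp add: emeasure_eq_measure)
  have F_int: "integrable M (\<lambda>\<omega>. F (Y n \<omega>))"
  proof (rule integrable_const_bound[of _ 1])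
    show "(\<lambda>\<omega>. F (Y n \<omega>)) \<in> borel_measurable M"
      by (rule measurable_compose[OF measurable_Y continuous_map_measurable_borel_of_topology[OF F(1)]])
  qed (use F(2)[OF point_measures_Y] in auto)
  have "(\<integral>\<omega>. (\<Sum>C\<in>?C. indicator (?A C) \<omega> * (F (MP.block_config m C) - \<kappa>)) \<partial>M) \<le> (\<integral>\<omega>. F (Y n \<omega>) \<partial>M)"
  proof (rule integral_mono[OF _ F_int])
    show "integrable M (\<lambda>\<omega>. \<Sum>C\<in>?C. indicator (?A C) \<omega> * (F (MP.block_config m C) - \<kappa>))"
      using int by auto
    fix \<omega>
    show "(\<Sum>C\<in>?C. indicator (?A C) \<omega> * (F (MP.block_config m C) - \<kappa>)) \<le> F (Y n \<omega>)"
    proof (cases "\<exists>C\<in>?C. \<omega> \<in> ?A C")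
      case True
      then obtain C where C: "C \<in> ?C" "\<omega> \<in> ?A C" by blast
      have ind: "indicator (?A C') \<omega> = (if C' = C then 1 else 0 :: real)" if "C' \<in> ?C" for C'
      proof (cases "C' = C")
        case True then show ?thesis using C(2) by simp
      next
        case False
        then have "\<omega> \<notin> ?A C'" using unique[OF that C(1) _ C(2)] by blast
        then show ?thesis using False by simp
      qed
      have "(\<Sum>C'\<in>?C. indicator (?A C') \<omega> * (F (MP.block_config m C') - \<kappa>)) = (\<Sum>C'\<in>?C. if C' = C then F (MP.block_config m C) - \<kappa> else 0)"
        by (intro sum.cong refl) (simp add: ind)
      also have "\<dots> = F (MP.block_config m C) - \<kappa>" using C(1) fin by simp
      finally show ?thesis using near[OF C] by simp
    next
      case False
      then have "(\<Sum>C'\<in>?C. indicator (?A C') \<omega> * (F (MP.block_config m C') - \<kappa>)) = 0"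
        by (intro sum.neutral ballI) simp
      then show ?thesis using F(2)[OF point_measures_Y, of n \<omega>] by simp
    qed
  qed
  also have "(\<integral>\<omega>. (\<Sum>C\<in>?C. indicator (?A C) \<omega> * (F (MP.block_config m C) - \<kappa>)) \<partial>M) =
      (\<Sum>C\<in>?C. prob (?A C) * (F (MP.block_config m C) - \<kappa>))"
    using int A by simp
  also have "\<dots> = (\<Sum>C\<in>?C. prob (?A C) * F (MP.block_config m C)) - \<kappa> * (\<Sum>C\<in>?C. prob (?A C))"
    by (simp only: right_diff_distrib sum_subtractf sum_distrib_right mult.commute[of \<kappa>])
  finally have main: "(\<Sum>C\<in>?C. prob (?A C) * F (MP.block_config m C)) - \<kappa> * (\<Sum>C\<in>?C. prob (?A C)) \<le> (\<integral>\<omega>. F (Y n \<omega>) \<partial>M)" .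
  have "disjoint_family_on ?A ?C"
    unfolding disjoint_family_on_def
  proof (intro ballI impI equals0I)
    fix C C' \<omega> assume "C \<in> ?C" "C' \<in> ?C" "C \<noteq> C'" "\<omega> \<in> ?A C \<inter> ?A C'"
    then show False using unique[of C C' \<omega>] by blast
  qed
  then have "(\<Sum>C\<in>?C. prob (?A C)) = prob (\<Union>C\<in>?C. ?A C)"
    by (rule finite_measure_finite_Union[OF fin image_subsetI[OF A], symmetric])
  then have "\<kappa> * (\<Sum>C\<in>?C. prob (?A C)) \<le> \<kappa> * 1" using \<kappa> by (intro mult_left_mono) auto
  with main show ?thesis by linarith
qed

text \<open>\<open>integral_N_le\<close> bounds the limit integral by a finite sum over
  configurations; each term is bounded by its counterpart for the exceedance process, first for m
  large and then for n large depending on m.\<close>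

lemma eventually_integral_Y_ge:
  assumes F: "continuous_map vague_topology euclideanreal F" "\<And>N. N \<in> point_measures \<Longrightarrow> F N \<in> {0..1}"
    and \<epsilon>: "\<epsilon> > 0"
  shows "\<forall>\<^sub>F n in sequentially. (\<integral>\<omega>. F (MP.N \<omega>) \<partial>MP.MP) - \<epsilon> \<le> (\<integral>\<omega>. F (Y n \<omega>) \<partial>M)"
proof -
  let ?lam = "p 1 * \<tau>"
  obtain l where l: "\<forall>\<^sub>F n in sequentially. 1 \<le> l n" "(\<lambda>n. mixing_coeff M \<zeta> v n (l n)) \<longlonglongrightarrow> 0"
    "(\<lambda>n. real (l n) / real n) \<longlonglongrightarrow> 0"
    by (rule Delta_gap[OF \<tau>])
  \<comment> \<open>\<kappa> is spent four times: on the truncation of the limit, on the relative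
    loss of the weights, on the errors of the single configurations and on moving the points. The
    bound 1 / 2 keeps y positive.\<close>
  define \<kappa> where "\<kappa> = min (\<epsilon> / 8) (1 / 2)"
  have \<kappa>: "0 < \<kappa>" "\<kappa> < 1" "4 * \<kappa> \<le> \<epsilon>" using \<epsilon> by (auto simp: \<kappa>_def)
  obtain L Q where LQ: "\<forall>\<^sub>F m in sequentially.
      (\<integral>\<omega>. F (MP.N \<omega>) \<partial>MP.MP) \<le> (\<Sum>C\<in>MP.configs m L Q. MP.weight m C * F (MP.block_config m C)) + \<kappa>"
    using MP.integral_N_le[OF F \<kappa>(1)] by blast
  obtain \<delta> where \<delta>: "\<delta> > 0" and uc: "\<And>(A :: nat multiset) y z. size A \<le> Q \<Longrightarrow>
      (\<forall>i\<in>#A. y i \<in> {0..1} \<and> z i \<in> {0..1} \<and> \<bar>y i - z i\<bar> \<le> \<delta>) \<Longrightarrow>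
      \<bar>F (image_mset y A) - F (image_mset z A)\<bar> \<le> \<kappa>"
    using vague_uniformly_continuous[OF F(1) \<kappa>(1), of Q] by blast
  \<comment> \<open>By Bernoulli's inequality Q + 1 factors y lose at most \<kappa>: Q for the
    occupied blocks and one for the empty blocks taken together.\<close>
  define y where "y = 1 - \<kappa> / real (Suc Q)"
  have yb: "0 < y" "y < 1" using \<kappa> by (auto simp: y_def divide_less_eq)
  have yQ: "y ^ Suc Q \<ge> 1 - \<kappa>"
  proof -
    have "- 1 \<le> - (\<kappa> / real (Suc Q))" using yb(1) by (simp add: y_def)
    from Bernoulli_inequality[OF this, of "Suc Q"] show ?thesis by (simp add: y_def del: of_nat_Suc power_Suc)
  qed
  \<comment> \<open>Half of 1 - y, so that y < 1 - e \<le> exp(-e): an excess e in the probability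
    of a non-empty block still leaves a factor larger than y in the limit.\<close>
  define e where "e = (1 - y) / 2"
  have e: "e > 0" using yb by (simp add: e_def)
  let ?z = "\<lambda>m. 1 - (?lam + e) / real m"
  have ev_exp: "\<forall>\<^sub>F m in sequentially. ?z m ^ m \<ge> y * exp (- ?lam)"
  proof -
    have "(\<lambda>m. (1 + (- (?lam + e)) / real m) ^ m) \<longlonglongrightarrow> exp (- (?lam + e))"
      by (rule tendsto_exp_limit_sequentially)
    moreover have "y * exp (- ?lam) < exp (- (?lam + e))"
    proof -
      have "y < 1 - e" unfolding e_def using yb(2) by (simp add: field_simps)
      also have "\<dots> \<le> exp (- e)" using exp_ge_add_one_self[of "- e"] by simp
      finally have "y * exp (- ?lam) < exp (- e) * exp (- ?lam)" by simp
      then show ?thesis by (simp add: exp_add[symmetric] add.commute)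
    qed
    ultimately have "\<forall>\<^sub>F m in sequentially. (1 + (- (?lam + e)) / real m) ^ m > y * exp (- ?lam)"
      by (rule order_tendstoD)
    then show ?thesis
    proof eventually_elim
      case (elim m)
      have "1 + (- (?lam + e)) / real m = ?z m" by (simp add: minus_divide_left)
      with elim show ?case by simp
    qed
  qed
  have ev_empty: "\<forall>\<^sub>F m in sequentially. \<forall>\<^sub>F n in sequentially.
      prob {\<omega> \<in> space M. exceed \<zeta> (v n) 0 (n div m - l n) \<omega> = 0} \<ge> ?z m"
    using block_empty_limit[OF \<tau> e l(3)] by (simp add: mult.commute)
  have ev_count: "\<forall>\<^sub>F m in sequentially. \<forall>c\<in>{1..L}. \<forall>\<^sub>F n in sequentially.
      prob {\<omega> \<in> space M. exceed \<zeta> (v n) 0 (n div m - l n) \<omega> = c} \<ge> y * (?lam / real m * pmf P c)"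
  proof (rule eventually_ball_finite[OF finite_atLeastAtMost], rule ballI)
    fix c assume c: "c \<in> {1..L}"
    then have c1: "c \<ge> 1" by simp
    show "\<forall>\<^sub>F m in sequentially. \<forall>\<^sub>F n in sequentially.
      prob {\<omega> \<in> space M. exceed \<zeta> (v n) 0 (n div m - l n) \<omega> = c} \<ge> y * (?lam / real m * pmf P c)"
    \<comment> \<open>The relative slack 1 - y turns into a positive absolute error for
      \<open>block_count_limit\<close> only if c has positive probability; otherwise the claim is
      trivial.\<close>
    proof (cases "pmf P c = 0")
      case True then show ?thesis by simp
    next
      case False
      then have pc: "pmf P c > 0" by (simp add: order_less_le)
      have lp: "\<tau> * (p c - p (c + 1)) = ?lam * pmf P c" using P[OF c1] p1_pos by simp
      have "(1 - y) * (?lam * pmf P c) > 0" using pc yb p1_pos \<tau> by simp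
      from block_count_limit[OF \<tau> this c1 l(3)] eventually_gt_at_top[of 0] show ?thesis
      proof eventually_elim
        case (elim m)
        note m = elim(2)
        from elim(1) show ?case
        proof eventually_elim
          case (elim n)
          have "y * (?lam * pmf P c) \<le> real m * prob {\<omega> \<in> space M. exceed \<zeta> (v n) 0 (n div m - l n) \<omega> = c}"
            using elim unfolding lp by (simp add: left_diff_distrib)
          then have "y * (?lam * pmf P c) / real m \<le> prob {\<omega> \<in> space M. exceed \<zeta> (v n) 0 (n div m - l n) \<omega> = c}"
            using m by (simp add: pos_divide_le_eq mult.commute)
          then show ?case by simp
        qed
      qed
    qed
  qed
  have "(\<lambda>m. 1 / real m) \<longlonglongrightarrow> 0" by (rule lim_1_over_n)
  then have ev_\<delta>: "\<forall>\<^sub>F m in sequentially. 1 / real m < \<delta>" using \<delta> by (rule order_tendstoD)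
  have "(\<lambda>m. (?lam + e) / real m) \<longlonglongrightarrow> 0" by real_asymp
  then have ev_z: "\<forall>\<^sub>F m in sequentially. (?lam + e) / real m < 1" by (rule order_tendstoD) simp
  have "\<forall>\<^sub>F m in sequentially. \<forall>\<^sub>F n in sequentially. (\<integral>\<omega>. F (MP.N \<omega>) \<partial>MP.MP) - \<epsilon> \<le> (\<integral>\<omega>. F (Y n \<omega>) \<partial>M)"
    using LQ ev_exp ev_empty ev_count ev_\<delta> ev_z eventually_gt_at_top[of 0]
  proof eventually_elim
    case (elim m)
    note m = elim(7)
    let ?C = "MP.configs m L Q"
    \<comment> \<open>The errors of all configurations must add up to at most \<kappa>. Their number
      depends on m, L and Q but not on n.\<close>
    let ?\<theta> = "\<kappa> / real (card ?C + 1)"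
    let ?err = "\<lambda>n. real m * mixing_coeff M \<zeta> v n (l n) + (real n + 1 - real m * (real (n div m) - real (l n) + 1)) * h (v n)"
    have z: "0 \<le> ?z m" "?z m \<le> 1" using elim(6) p1_pos \<tau> e by auto
    have err: "?err \<longlonglongrightarrow> 0"
    proof -
      have "(\<lambda>n. (1 + 1 / real n - real m * (real (n div m) - real (l n) + 1) / real n) * (real n * h (v n))) \<longlonglongrightarrow> (1 + 0 - 1) * \<tau>"
        by (intro tendsto_mult tendsto_diff tendsto_add tendsto_const lim_1_over_n block_length_ratio m l(3) lim_h \<tau>)
      then have "(\<lambda>n. (1 + 1 / real n - real m * (real (n div m) - real (l n) + 1) / real n) * (real n * h (v n))) \<longlonglongrightarrow> 0" by simp
      then have A: "(\<lambda>n. (real n + 1 - real m * (real (n div m) - real (l n) + 1)) * h (v n)) \<longlonglongrightarrow> 0"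
        by (rule Lim_transform_eventually, use eventually_gt_at_top[of 0] in eventually_elim) (simp add: field_simps)
      have "?err \<longlonglongrightarrow> real m * 0 + 0" by (intro tendsto_intros l(2) A)
      then show ?thesis by simp
    qed
    have "?\<theta> > 0" using \<kappa> by simp
    with err have ev_err: "\<forall>\<^sub>F n in sequentially. ?err n < ?\<theta>" by (rule order_tendstoD)
    have ev_count': "\<forall>\<^sub>F n in sequentially. \<forall>c\<in>{1..L}.
        prob {\<omega> \<in> space M. exceed \<zeta> (v n) 0 (n div m - l n) \<omega> = c} \<ge> y * (?lam / real m * pmf P c)"
      by (rule eventually_ball_finite[OF finite_atLeastAtMost elim(4)])
    show ?case
      using elim(3) ev_count' ev_err l(1) short_gap_eventually[OF m l(3)] eventually_ge_at_top[of "m * m"]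
    proof eventually_elim
      case (elim n)
      note ln = elim(4,5) and mn = elim(6)
      let ?g = "\<lambda>c. prob {\<omega> \<in> space M. exceed \<zeta> (v n) 0 (n div m - l n) \<omega> = c}"
      let ?p = "\<lambda>C. prob (Y_config n m (l n) C)" and ?w = "MP.weight m" and ?F = "\<lambda>C. F (MP.block_config m C)"
      have F01: "0 \<le> ?F C" "?F C \<le> 1" if "C \<in> ?C" for C
        using F(2)[OF MP.point_measures_block_config[OF m, of C]] by auto
      have pw: "?p C * ?F C \<ge> ?w C * ?F C - \<kappa> * ?w C - ?\<theta>" if C: "C \<in> ?C" for C
      proof -
        have "(1 - \<kappa>) * ?w C \<le> (y ^ Suc Q) * ?w C" using yQ MP.weight_nonneg by (rule mult_right_mono)
        also have "\<dots> = (y * exp (- ?lam)) * (y ^ Q * (exp ?lam * ?w C))" by (simp add: exp_minus field_simps)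
        also have "\<dots> \<le> ?z m ^ m * (y ^ Q * (exp ?lam * ?w C))"
          using \<open>y * exp (- ?lam) \<le> ?z m ^ m\<close> yb MP.weight_nonneg by (intro mult_right_mono) auto
        also have "\<dots> = ?z m ^ m * y ^ Q * (exp ?lam * ?w C)" by (simp only: mult.assoc)
        also have "\<dots> \<le> (\<Prod>a<m. ?g (C a))"
          using elim(1,2) yb z by (intro MP.prod_ge_weight[OF C]) auto
        finally have "(1 - \<kappa>) * ?w C - ?\<theta> \<le> ?p C"
          using prob_Y_config(2)[OF m ln, of C] elim(3) by linarith
        then have "((1 - \<kappa>) * ?w C - ?\<theta>) * ?F C \<le> ?p C * ?F C" using F01(1)[OF C] by (rule mult_right_mono)
        moreover have "\<kappa> * ?w C * ?F C \<le> \<kappa> * ?w C * 1" "?\<theta> * ?F C \<le> ?\<theta> * 1"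
          using F01(2)[OF C] \<kappa> MP.weight_nonneg by (intro mult_left_mono; simp)+
        ultimately show ?thesis by (simp add: algebra_simps)
      qed
      have "(\<Sum>C\<in>?C. ?w C * ?F C - \<kappa> * ?w C - ?\<theta>) \<le> (\<Sum>C\<in>?C. ?p C * ?F C)"
        by (intro sum_mono pw)
      moreover have "(\<Sum>C\<in>?C. ?w C * ?F C - \<kappa> * ?w C - ?\<theta>) = (\<Sum>C\<in>?C. ?w C * ?F C) - \<kappa> * (\<Sum>C\<in>?C. ?w C) - real (card ?C) * ?\<theta>"
        by (simp add: sum_subtractf sum_distrib_left)
      moreover have "\<kappa> * (\<Sum>C\<in>?C. ?w C) \<le> \<kappa> * 1" using \<kappa> MP.sum_weight_le_1[OF m] by (intro mult_left_mono) auto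
      moreover have "real (card ?C) * ?\<theta> \<le> \<kappa>" using \<kappa> by (simp add: field_simps)
      moreover have "(\<Sum>C\<in>?C. ?p C * ?F C) - \<kappa> \<le> (\<integral>\<omega>. F (Y n \<omega>) \<partial>M)"
      proof (rule integral_Y_ge[OF m ln F])
        fix \<omega> C assume C: "C \<in> ?C" and w: "\<omega> \<in> Y_config n m (l n) C"
        have sC: "sum C {..<m} \<le> Q" using C by (simp add: MP.configs_def)
        show "?F C - \<kappa> \<le> F (Y n \<omega>)"
        proof (rule Y_near_block_config[where F=F and Q=Q and \<delta>=\<delta> and \<kappa>=\<kappa>, OF m ln mn w sC])
          show "1 / real m \<le> \<delta>" using \<open>1 / real m < \<delta>\<close> by simp
        qed (rule uc)
      qed (simp_all add: less_imp_le[OF \<kappa>(1)])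
      ultimately show ?case
        using \<open>(\<integral>\<omega>. F (MP.N \<omega>) \<partial>MP.MP) \<le> (\<Sum>C\<in>?C. ?w C * ?F C) + \<kappa>\<close> \<kappa>(3) by linarith
    qed
  qed
  then show ?thesis by (simp add: eventually_const_iff)
qed

lemma integrable_F_Y:
  assumes "continuous_map vague_topology euclideanreal F" "\<And>N. N \<in> point_measures \<Longrightarrow> \<bar>F N\<bar> \<le> A"
  shows "integrable M (\<lambda>\<omega>. F (Y n \<omega>))" and "integrable MP.MP (\<lambda>\<omega>. F (MP.N \<omega>))"
proof -
  note mF = continuous_map_measurable_borel_of_topology[OF assms(1)]
  show "integrable M (\<lambda>\<omega>. F (Y n \<omega>))"
    by (rule integrable_const_bound[of _ A])
       (use assms(2)[OF point_measures_Y] measurable_compose[OF measurable_Y mF] in auto)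
  show "integrable MP.MP (\<lambda>\<omega>. F (MP.N \<omega>))"
    by (rule MP.integrable_const_bound[of _ A])
       (use assms(2)[OF MP.point_measures_N] measurable_compose[OF MP.measurable_N mF] in auto)
qed

lemma converges_Y: "converges_in_distribution vague_topology M Y MP.MP MP.N"
  unfolding converges_in_distribution_def
proof (intro conjI allI impI measurable_Y MP.measurable_N)
  fix F :: "real multiset \<Rightarrow> real"
  assume F: "continuous_map vague_topology euclideanreal F \<and> bounded (F ` topspace vague_topology)"
  then obtain A where A: "A > 0" "\<And>N. N \<in> point_measures \<Longrightarrow> \<bar>F N\<bar> \<le> A"
    unfolding bounded_pos by auto
  let ?IY = "\<lambda>n. \<integral>\<omega>. F (Y n \<omega>) \<partial>M" and ?IN = "\<integral>\<omega>. F (MP.N \<omega>) \<partial>MP.MP"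
  have Fc: "continuous_map vague_topology euclideanreal F" using F by blast
  have one_sided: "\<forall>\<^sub>F n in sequentially. s * ?IN - e < s * ?IY n" if s: "s = 1 \<or> s = -1" and e: "e > 0" for s e :: real
  proof -
    \<comment> \<open>Rescales a function bounded by A to values in [0, 1]; the function for s = -1
      is 1 minus the one for s = 1. The error e / (4 A) becomes e / 2 after scaling back, which
      leaves room for the strict inequality.\<close>
    let ?G = "\<lambda>N. (A + s * F N) / (2 * A)"
    have Gc: "continuous_map vague_topology euclideanreal ?G"
      using A(1) Fc by (intro continuous_intros) auto
    have G01: "?G N \<in> {0..1}" if "N \<in> point_measures" for N
      using A(1) A(2)[OF that] s by (auto simp: field_simps)
    have e': "e / (4 * A) > 0" using e A(1) by simp
    have I: "(\<integral>\<omega>. ?G (Y n \<omega>) \<partial>M) = 1 / 2 + s * ?IY n / (2 * A)"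
      "(\<integral>\<omega>. ?G (MP.N \<omega>) \<partial>MP.MP) = 1 / 2 + s * ?IN / (2 * A)" for n
      using integrable_F_Y[OF Fc A(2)] A(1)
      by (simp_all add: add_divide_distrib prob_space MP.prob_space[unfolded MP.space_MP] del: One_nat_def)
    have "\<forall>\<^sub>F n in sequentially. (\<integral>\<omega>. ?G (MP.N \<omega>) \<partial>MP.MP) - e / (4 * A) \<le> (\<integral>\<omega>. ?G (Y n \<omega>) \<partial>M)"
      by (rule eventually_integral_Y_ge[OF Gc _ e']) (rule G01)
    then show ?thesis
      unfolding I
    proof eventually_elim
      case (elim n)
      then have "s * ?IN / (2 * A) - e / (4 * A) \<le> s * ?IY n / (2 * A)" by simp
      then have "(s * ?IN / (2 * A) - e / (4 * A)) * (2 * A) \<le> s * ?IY n / (2 * A) * (2 * A)"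
        using A(1) by (intro mult_right_mono) auto
      then have "s * ?IN - e / 2 \<le> s * ?IY n" using A(1) by (simp add: left_diff_distrib)
      with e show ?case by linarith
    qed
  qed
  show "?IY \<longlonglongrightarrow> ?IN"
  proof (rule order_tendstoI)
    fix a assume "a < ?IN"
    then show "\<forall>\<^sub>F n in sequentially. a < ?IY n" using one_sided[of 1 "?IN - a"] by simp
  next
    fix a assume "?IN < a"
    then show "\<forall>\<^sub>F n in sequentially. ?IY n < a" using one_sided[of "-1" "a - ?IN"] by simp
  qed
qed

end

text \<open>Non-negativity is \<open>p_antimono\<close>; the series telescopes to p(1), since p
  tends to 0, and p(1) is positive because the walk escapes with positive probability.\<close>

lemma (in exceedance_clusters) cluster_pmf_exists:
  "\<exists>P. pmf P 0 = 0 \<and> (\<forall>j\<ge>1. pmf P j = (p j - p (j + 1)) / p 1)"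
proof -
  have p1: "p 1 > 0" unfolding p_1 using \<sigma> prob_escape_pos by simp
  define f where "f j = (if j = 0 then 0 else (p j - p (j + 1)) / p 1)" for j
  have f0: "0 \<le> f j" for j using p_antimono[of j] p1 by (simp add: f_def)
  have "(\<lambda>j. p (Suc j)) \<longlonglongrightarrow> 0" using p_lim_0 by (simp add: filterlim_sequentially_Suc)
  then have "(\<lambda>j. p (Suc j) - p (Suc (Suc j))) sums (p (Suc 0) - 0)" by (rule telescope_sums')
  then have "(\<lambda>j. (p (Suc j) - p (Suc (Suc j))) / p 1) sums ((p (Suc 0) - 0) / p 1)" by (rule sums_divide)
  then have "(\<lambda>j. f (Suc j)) sums 1" using p1 by (simp add: f_def)
  then have fs: "f sums 1" using sums_Suc[of f 1] by (simp add: f_def)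
  have "(\<integral>\<^sup>+j. ennreal (f j) \<partial>count_space UNIV) = 1"
    unfolding nn_integral_count_space_nat suminf_ennreal_eq[OF f0 fs] by simp
  then have "pmf (embed_pmf f) j = f j" for j by (intro pmf_embed_pmf f0)
  then show ?thesis by (intro exI[of _ "embed_pmf f"]) (simp add: f_def)
qed
theorem proposition3:
  fixes M :: "'a measure"
    and \<xi> :: "int \<Rightarrow> 'a \<Rightarrow> real"
    and X :: "nat \<Rightarrow> 'a \<Rightarrow> int"
    and u :: "real \<Rightarrow> nat \<Rightarrow> real"
    and kn :: "nat \<Rightarrow> nat"
    and p :: "nat \<Rightarrow> real"
    and \<rho> q \<sigma> \<theta> \<tau>\<^sub>0 :: real
    and k :: nat
  assumes "prob_space M"
    and "0 < \<rho>" "\<rho> < 1" "\<rho> \<noteq> 1 / 2"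
    and "prob_space.indep_vars M (\<lambda>_. count_space UNIV) X {1..}"
    and "\<And>i. i \<ge> 1 \<Longrightarrow> \<P>(\<omega> in M. X i \<omega> = 1) = \<rho>"
    and "\<And>i. i \<ge> 1 \<Longrightarrow> \<P>(\<omega> in M. X i \<omega> = -1) = 1 - \<rho>"
    and "\<And>s. \<xi> s \<in> borel_measurable M"
    and "stationary M \<xi>"
    and "indep_rvs M
           (\<Pi>\<^sub>M s\<in>UNIV. borel) (\<lambda>\<omega> s. \<xi> s \<omega>)
           (\<Pi>\<^sub>M i\<in>{1..}. count_space UNIV) (\<lambda>\<omega>. \<lambda>i\<in>{1..}. X i \<omega>)"
    and "q = \<P>(\<omega> in M. \<forall>i\<ge>1. walk X i \<omega> \<noteq> 0)"
    and "\<And>\<tau> n. \<tau> > 0 \<Longrightarrow> u \<tau> n > 0"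
    and "\<And>\<tau>. \<tau> > 0 \<Longrightarrow> (\<lambda>n. real n * \<P>(\<omega> in M. \<xi> 0 \<omega> > u \<tau> n)) \<longlonglongrightarrow> \<tau>"
    and "\<And>n. kn n > 0"
    and "filterlim kn at_top sequentially"
    and "(\<lambda>n. real (kn n)) \<in> o(\<lambda>n. real n)"
    and "k \<ge> 1"
    and "\<And>\<tau>. \<tau> > 0 \<Longrightarrow> D_cond k M (\<lambda>s. \<xi> (int s)) (u \<tau>)"
    and "\<And>\<tau>. \<tau> > 0 \<Longrightarrow> Delta_cond M (scenery_walk \<xi> X) (u \<tau>)"
    and "0 < \<sigma>" "\<sigma> \<le> 1"
    and "has_extremal_index M (\<lambda>s. \<xi> (int s)) u \<sigma>"
    and "\<tau>\<^sub>0 > 0"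
    and "\<And>j. j \<ge> 1 \<Longrightarrow>
           (\<lambda>n. \<P>(\<omega> in M. card (exceedances (scenery_walk \<xi> X) (u \<tau>\<^sub>0 n) n (kn n) \<omega>) = j
                   \<bar> \<xi> 0 \<omega> > u \<tau>\<^sub>0 n)) \<longlonglongrightarrow> p j"
    and "\<theta> = \<sigma> * q"
    and "\<tau> > 0"
  shows "\<exists>(M' :: (nat \<times> (nat \<Rightarrow> real) \<times> (nat \<Rightarrow> nat)) measure) N.
           prob_space M' \<and>
           compound_poisson_process M' (\<theta> * \<tau>) (\<lambda>j. (p j - p (j + 1)) / \<theta>) N \<and>
           converges_in_distribution vague_topology
             M (\<lambda>n \<omega>. mset_set (exceedances (scenery_walk \<xi> X) (u \<tau> n) n n \<omega>)) M' N"
proof -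
  interpret prob_space M by (rule assms(1))
  interpret exceedance_clusters M \<xi> X \<rho> u k \<sigma> kn p \<tau>\<^sub>0
    by unfold_locales (fact assms | rule assms; assumption)+
  obtain P where P: "pmf P 0 = 0" "\<And>j. j \<ge> 1 \<Longrightarrow> pmf P j = (p j - p (j + 1)) / p 1"
    using cluster_pmf_exists by blast
  interpret C: cluster_limit M \<xi> X \<rho> u k \<sigma> kn p \<tau>\<^sub>0 \<tau> P
    by unfold_locales (fact assms P | rule P; assumption)+
  \<comment> \<open>The construction normalizes by p(1); by \<open>p_1\<close> this is the extremal
    index times the escape probability.\<close>
  have \<theta>: "\<theta> = p 1" unfolding p_1 escape_def using assms(11,25) by simp
  have "compound_poisson_process C.MP.MP (\<theta> * \<tau>) (\<lambda>j. (p j - p (j + 1)) / \<theta>) C.MP.N"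
    unfolding \<theta> by (rule C.MP.compound_poisson_process_N) (simp add: P)
  moreover have "(\<lambda>n \<omega>. mset_set (exceedances (scenery_walk \<xi> X) (u \<tau> n) n n \<omega>)) = C.Y"
    by (simp add: fun_eq_iff C.Y_def)
  ultimately show ?thesis
    using C.converges_Y C.MP.prob_space_axioms by (intro exI[of _ C.MP.MP] exI[of _ C.MP.N]) simp
qed

end
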